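(* For $n\ge 0$ and $k\in\mathbb Z$, there are generators $i_n,\eta_n,\eta_n^k$ such that $$\pi_{n+k}S(n)=\begin{cases}\mathbb Z\,i_n,& k=0,\\ \mathbb Z\,\eta_n,& n=k\ \text{odd},\\ \mathbb Z_2\,\eta_n^k,& 0<k<n,\ k\ \text{odd},\\ 0,&\text{otherwise,}\end{cases}$$ where $S(n)$ is the $n$-sphere in the category $\mathsf{sNil}$ of simplicial nil(2)-groups.
   Context: $\mathsf{Nil}$ is the category of groups with trivial triple commutators ($\gamma_3=1$), and $\mathsf{sNil}$ the category of simplicial objects in $\mathsf{Nil}$. For a simplicial group $G$, $\pi_qG$ is the $q$-th homology of the Moore complex $N_qG=\bigcap_{i>0}\ker d_i$, $N_0G=G_0$, with boundary induced by $d_0$ ($\pi_q=0$ for $q<0$). $S(n)$, $n\geq0$, is the free object of $\mathsf{sNil}$ generated by a single element in degree $n$; equivalently $S(n)$ is homotopy equivalent to the nilization $G(S^{n+1})/\gamma_3(G(S^{n+1}))$ of the Kan loop group $G(S^{n+1})$ of the $(n+1)$-sphere. $i_n\in\pi_nS(n)$ is the canonical class such that $[S(n),X]\to\pi_nX$, $f\mapsto\pi_n(f)(i_n)$, is an isomorphism for all $X$ in $\mathsf{sNil}$ (here $[-,-]$ denotes morphisms in the homotopy category of $\mathsf{sNil}$, localized at the maps inducing isomorphisms on $\pi_*$). *)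

theory Defs
  imports "HOL-Algebra.Generated_Groups" "HOL-Algebra.Elementary_Groups"
begin

section \<open>Groups of nilpotency class two\<close>

definition group_comm :: "('a, 'b) monoid_scheme \<Rightarrow> 'a \<Rightarrow> 'a \<Rightarrow> 'a" where
  "group_comm G a b = a \<otimes>\<^bsub>G\<^esub> b \<otimes>\<^bsub>G\<^esub> inv\<^bsub>G\<^esub> a \<otimes>\<^bsub>G\<^esub> inv\<^bsub>G\<^esub> b"

definition gamma2 :: "('a, 'b) monoid_scheme \<Rightarrow> 'a set" where
  "gamma2 G = generate G {group_comm G a b | a b. a \<in> carrier G \<and> b \<in> carrier G}"

definition gamma3 :: "('a, 'b) monoid_scheme \<Rightarrow> 'a set" where
  "gamma3 G = generate G {group_comm G a b | a b. a \<in> gamma2 G \<and> b \<in> carrier G}"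

definition nil_group :: "('a, 'b) monoid_scheme \<Rightarrow> bool" where
  "nil_group G \<longleftrightarrow> group G \<and> gamma3 G = {\<one>\<^bsub>G\<^esub>}"


section \<open>Free nil groups\<close>

text \<open>A letter \<open>(x, True)\<close> stands for the generator \<open>x\<close>, and \<open>(x, False)\<close> for its inverse.
  Killing the triple commutators of words amounts to dividing the free group \<open>F\<close> by \<open>\<gamma>\<^sub>3 F\<close>; see
  \<open>free_nil_universal\<close> for the universal property.\<close>

type_synonym 'a word = "('a \<times> bool) list"

definition word_inv :: "'a word \<Rightarrow> 'a word" where
  "word_inv w = rev (map (\<lambda>(x, b). (x, \<not> b)) w)"

definition word_comm :: "'a word \<Rightarrow> 'a word \<Rightarrow> 'a word" where
  "word_comm u v = u @ v @ word_inv u @ word_inv v"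

abbreviation words :: "'a set \<Rightarrow> 'a word set" where
  "words A \<equiv> lists (A \<times> UNIV)"

inductive nil_cong :: "'a set \<Rightarrow> 'a word \<Rightarrow> 'a word \<Rightarrow> bool" for A where
  nil_refl: "u \<in> words A \<Longrightarrow> nil_cong A u u"
| nil_sym: "nil_cong A u v \<Longrightarrow> nil_cong A v u"
| nil_trans: "nil_cong A u v \<Longrightarrow> nil_cong A v w \<Longrightarrow> nil_cong A u w"
| nil_append: "nil_cong A u u' \<Longrightarrow> nil_cong A v v' \<Longrightarrow> nil_cong A (u @ v) (u' @ v')"
| nil_cancel: "x \<in> A \<Longrightarrow> nil_cong A [(x, b), (x, \<not> b)] []"
| nil_triple: "u \<in> words A \<Longrightarrow> v \<in> words A \<Longrightarrow> w \<in> words A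
    \<Longrightarrow> nil_cong A (word_comm (word_comm u v) w) []"

definition nil_class :: "'a set \<Rightarrow> 'a word \<Rightarrow> 'a word set" where
  "nil_class A u = {v. nil_cong A u v}"

definition free_nil :: "'a set \<Rightarrow> 'a word set monoid" where
  "free_nil A =
    \<lparr>carrier = nil_class A ` words A,
     monoid.mult = (\<lambda>C D. \<Union>u\<in>C. \<Union>v\<in>D. nil_class A (u @ v)),
     one = nil_class A []\<rparr>"

definition free_gen :: "'a set \<Rightarrow> 'a \<Rightarrow> 'a word set" where
  "free_gen A x = nil_class A [(x, True)]"

fun word_eval :: "('b, 'c) monoid_scheme \<Rightarrow> ('a \<Rightarrow> 'b) \<Rightarrow> 'a word \<Rightarrow> 'b" where
  "word_eval G f [] = \<one>\<^bsub>G\<^esub>"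
| "word_eval G f ((x, b) # w) = (if b then f x else inv\<^bsub>G\<^esub> (f x)) \<otimes>\<^bsub>G\<^esub> word_eval G f w"

text \<open>The homomorphism out of \<open>free_nil A\<close> that extends \<open>f\<close>: all representatives of a class have
  the same value (see \<open>free_lift_class\<close>).\<close>

definition free_lift :: "('b, 'c) monoid_scheme \<Rightarrow> ('a \<Rightarrow> 'b) \<Rightarrow> 'a word set \<Rightarrow> 'b" where
  "free_lift G f C = the_elem (word_eval G f ` C)"

lemma nil_cong_words: "nil_cong A u v \<Longrightarrow> u \<in> words A \<and> v \<in> words A"
  by (induction rule: nil_cong.induct) (auto simp: word_comm_def word_inv_def lists_eq_set)

lemma word_inv_words: "u \<in> words A \<Longrightarrow> word_inv u \<in> words A"
  by (auto simp: word_inv_def lists_eq_set)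

lemma nil_cong_inv_right: "u \<in> words A \<Longrightarrow> nil_cong A (u @ word_inv u) []"
proof (induction u)
  case Nil
  then show ?case by (simp add: word_inv_def nil_refl)
next
  case (Cons a u)
  obtain x b where a: "a = (x, b)" by force
  have u: "u \<in> words A" and x: "x \<in> A" using Cons.prems a by auto
  have r: "nil_cong A [a] [a]" "nil_cong A [(x, \<not> b)] [(x, \<not> b)]"
    using x a by (auto intro!: nil_refl)
  have "nil_cong A ([a] @ ((u @ word_inv u) @ [(x, \<not> b)])) ([a] @ ([] @ [(x, \<not> b)]))"
    by (intro nil_append r Cons.IH u)
  also have "[a] @ ([] @ [(x, \<not> b)]) = [(x, b), (x, \<not> b)]" by (simp add: a)
  finally have "nil_cong A ((a # u) @ word_inv (a # u)) [(x, b), (x, \<not> b)]"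
    by (simp add: word_inv_def a)
  then show ?case using nil_cancel[OF x] nil_trans by blast
qed

lemma word_inv_inv: "word_inv (word_inv u) = u"
  by (induction u) (auto simp: word_inv_def)

lemma nil_cong_inv_left: "u \<in> words A \<Longrightarrow> nil_cong A (word_inv u @ u) []"
  using nil_cong_inv_right[of "word_inv u" A] word_inv_words word_inv_inv by metis

lemma nil_class_eq_iff:
  "u \<in> words A \<Longrightarrow> nil_class A u = nil_class A v \<longleftrightarrow> nil_cong A u v"
  unfolding nil_class_def by (blast intro: nil_refl nil_sym nil_trans)

lemma free_nil_carrier: "u \<in> words A \<Longrightarrow> nil_class A u \<in> carrier (free_nil A)"
  by (simp add: free_nil_def)

lemma free_nil_mult:
  assumes "u \<in> words A" "v \<in> words A"
  shows "nil_class A u \<otimes>\<^bsub>free_nil A\<^esub> nil_class A v = nil_class A (u @ v)"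
proof -
  have eq: "nil_class A (u' @ v') = nil_class A (u @ v)"
    if "u' \<in> nil_class A u" "v' \<in> nil_class A v" for u' v'
  proof -
    have "nil_cong A (u' @ v') (u @ v)"
      using that by (auto simp: nil_class_def intro: nil_append nil_sym)
    then show ?thesis using nil_class_eq_iff nil_cong_words by blast
  qed
  have "(\<Union>u'\<in>nil_class A u. \<Union>v'\<in>nil_class A v. nil_class A (u' @ v'))
      = (\<Union>u'\<in>nil_class A u. \<Union>v'\<in>nil_class A v. nil_class A (u @ v))"
    by (rule SUP_cong[OF refl], rule SUP_cong[OF refl], rule eq)
  also have "\<dots> = nil_class A (u @ v)"
  proof -
    have "nil_class A u \<noteq> {}" "nil_class A v \<noteq> {}"
      using assms nil_refl unfolding nil_class_def by blast+
    then show ?thesis by simp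
  qed
  finally show ?thesis by (simp add: free_nil_def)
qed

lemma free_nil_cases:
  assumes "C \<in> carrier (free_nil A)"
  obtains u where "u \<in> words A" "C = nil_class A u"
  using assms by (auto simp: free_nil_def)

lemma free_nil_one: "\<one>\<^bsub>free_nil A\<^esub> = nil_class A []"
  by (simp add: free_nil_def)

lemma group_free_nil: "group (free_nil A)"
proof (rule groupI)
  fix C D assume "C \<in> carrier (free_nil A)" "D \<in> carrier (free_nil A)"
  then show "C \<otimes>\<^bsub>free_nil A\<^esub> D \<in> carrier (free_nil A)"
    by (elim free_nil_cases) (simp add: free_nil_mult free_nil_carrier)
next
  fix C D E
  assume "C \<in> carrier (free_nil A)" "D \<in> carrier (free_nil A)" "E \<in> carrier (free_nil A)"
  then show "C \<otimes>\<^bsub>free_nil A\<^esub> D \<otimes>\<^bsub>free_nil A\<^esub> E = C \<otimes>\<^bsub>free_nil A\<^esub> (D \<otimes>\<^bsub>free_nil A\<^esub> E)"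
    by (elim free_nil_cases) (simp add: free_nil_mult)
next
  show "\<one>\<^bsub>free_nil A\<^esub> \<in> carrier (free_nil A)" by (simp add: free_nil_def)
next
  fix C assume "C \<in> carrier (free_nil A)"
  then obtain u where u: "u \<in> words A" "C = nil_class A u" by (rule free_nil_cases)
  show "\<one>\<^bsub>free_nil A\<^esub> \<otimes>\<^bsub>free_nil A\<^esub> C = C"
    using u by (simp add: free_nil_one free_nil_mult)
  have "nil_class A (word_inv u) \<otimes>\<^bsub>free_nil A\<^esub> C = nil_class A (word_inv u @ u)"
    using u free_nil_mult[OF word_inv_words] by blast
  also have "\<dots> = \<one>\<^bsub>free_nil A\<^esub>"
    using nil_cong_inv_left[OF u(1)] nil_class_eq_iff nil_cong_words
    by (metis free_nil_one)
  finally show "\<exists>D\<in>carrier (free_nil A). D \<otimes>\<^bsub>free_nil A\<^esub> C = \<one>\<^bsub>free_nil A\<^esub>"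
    using free_nil_carrier[OF word_inv_words[OF u(1)]] by blast
qed

lemma free_nil_inv:
  assumes "u \<in> words A"
  shows "inv\<^bsub>free_nil A\<^esub> (nil_class A u) = nil_class A (word_inv u)"
proof -
  interpret group "free_nil A" by (rule group_free_nil)
  have "nil_class A (word_inv u) \<otimes>\<^bsub>free_nil A\<^esub> nil_class A u = \<one>\<^bsub>free_nil A\<^esub>"
    using assms nil_cong_inv_left[OF assms] nil_class_eq_iff nil_cong_words free_nil_mult
      word_inv_words free_nil_one by metis
  then show ?thesis
    using assms by (metis inv_equality free_nil_carrier word_inv_words)
qed

lemma (in group) commute_if_comm_one:
  assumes "a \<in> carrier G" "b \<in> carrier G" "group_comm G a b = \<one>"
  shows "a \<otimes> b = b \<otimes> a"
proof -
  have "a \<otimes> b \<otimes> inv (b \<otimes> a) = \<one>"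
    using assms by (simp add: group_comm_def inv_mult_group m_assoc)
  then show ?thesis using assms by (metis inv_solve_right' m_closed l_one one_closed)
qed

lemma (in group) group_comm_eq_one:
  assumes "a \<in> carrier G" "b \<in> carrier G" "a \<otimes> b = b \<otimes> a"
  shows "group_comm G a b = \<one>"
proof -
  have "group_comm G a b = (a \<otimes> b) \<otimes> inv (b \<otimes> a)"
    using assms(1,2) by (simp add: group_comm_def inv_mult_group m_assoc)
  then show ?thesis using assms by simp
qed

lemma (in group) gamma2_carrier: "gamma2 G \<subseteq> carrier G"
  unfolding gamma2_def by (rule generate_incl) (auto simp: group_comm_def)

lemma (in group) nil_groupI:
  assumes "\<And>a b c. \<lbrakk>a \<in> carrier G; b \<in> carrier G; c \<in> carrier G\<rbrakk>
    \<Longrightarrow> group_comm G (group_comm G a b) c = \<one>"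
  shows "nil_group G"
proof -
  have central: "z \<otimes> c = c \<otimes> z" if "z \<in> gamma2 G" "c \<in> carrier G" for z c
    using that(1) unfolding gamma2_def
  proof (induction z rule: generate.induct)
    case one
    then show ?case using that(2) by simp
  next
    case (incl h)
    then show ?case using assms that(2)
      by (auto intro!: commute_if_comm_one simp: group_comm_def)
  next
    case (inv h)
    then obtain a b where h: "h = group_comm G a b" "a \<in> carrier G" "b \<in> carrier G" by blast
    have hc: "h \<in> carrier G" using h by (simp add: group_comm_def)
    have "h \<otimes> c = c \<otimes> h" using assms that(2) h hc by (auto intro!: commute_if_comm_one)
    then show ?case using hc that(2) by (metis inv_closed inv_solve_left inv_solve_right m_closed m_assoc)
  next
    case (eng x y)
    have c: "x \<in> carrier G" "y \<in> carrier G"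
      using eng gamma2_carrier unfolding gamma2_def by auto
    have "(x \<otimes> y) \<otimes> c = x \<otimes> (c \<otimes> y)" using c that(2) eng by (simp add: m_assoc)
    also have "\<dots> = (c \<otimes> x) \<otimes> y" using c that(2) eng by (simp add: m_assoc[symmetric])
    finally show ?case using c that(2) by (simp add: m_assoc)
  qed
  have "group_comm G a b = \<one>" if "a \<in> gamma2 G" "b \<in> carrier G" for a b
    using that central gamma2_carrier group_comm_eq_one by blast
  then have "{group_comm G a b | a b. a \<in> gamma2 G \<and> b \<in> carrier G} \<subseteq> {\<one>}" by blast
  then have "gamma3 G \<subseteq> generate G {\<one>}" unfolding gamma3_def by (rule mono_generate)
  moreover have "\<one> \<in> gamma3 G" unfolding gamma3_def by (rule generate.one)
  ultimately have "gamma3 G = {\<one>}" using generate_one by auto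
  then show ?thesis unfolding nil_group_def using is_group by blast
qed

lemma nil_group_comm:
  assumes "nil_group G" "a \<in> carrier G" "b \<in> carrier G" "c \<in> carrier G"
  shows "group_comm G (group_comm G a b) c = \<one>\<^bsub>G\<^esub>"
proof -
  have "group_comm G a b \<in> gamma2 G"
    unfolding gamma2_def using assms by (blast intro: generate.incl)
  then have "group_comm G (group_comm G a b) c \<in> gamma3 G"
    unfolding gamma3_def using assms by (blast intro: generate.incl)
  then show ?thesis using assms(1) by (simp add: nil_group_def)
qed

lemma free_nil_comm:
  assumes "u \<in> words A" "v \<in> words A"
  shows "group_comm (free_nil A) (nil_class A u) (nil_class A v) = nil_class A (word_comm u v)"
  using assms
  by (simp add: group_comm_def word_comm_def free_nil_mult free_nil_inv word_inv_words)

lemma nil_group_free_nil: "nil_group (free_nil A)"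
proof (rule group.nil_groupI[OF group_free_nil])
  fix C D E
  assume "C \<in> carrier (free_nil A)" "D \<in> carrier (free_nil A)" "E \<in> carrier (free_nil A)"
  then obtain u v w where *: "u \<in> words A" "v \<in> words A" "w \<in> words A"
    "C = nil_class A u" "D = nil_class A v" "E = nil_class A w"
    by (metis free_nil_cases)
  have uv: "word_comm u v \<in> words A"
    using *(1,2) word_inv_words by (auto simp: word_comm_def)
  have "group_comm (free_nil A) (group_comm (free_nil A) C D) E
      = nil_class A (word_comm (word_comm u v) w)"
    using * uv by (simp add: free_nil_comm)
  also have "\<dots> = nil_class A []"
    using nil_triple[OF *(1-3)] nil_class_eq_iff nil_cong_words by blast
  finally show "group_comm (free_nil A) (group_comm (free_nil A) C D) E = \<one>\<^bsub>free_nil A\<^esub>"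
    by (simp add: free_nil_one)
qed


context
  fixes G :: "('b, 'c) monoid_scheme" and A :: "'a set" and f :: "'a \<Rightarrow> 'b"
  assumes G: "nil_group G" and f: "f \<in> A \<rightarrow> carrier G"
begin

interpretation group G using G by (simp add: nil_group_def)

lemma word_eval_closed: "u \<in> words A \<Longrightarrow> word_eval G f u \<in> carrier G"
proof (induction u)
  case (Cons a u)
  then show ?case using f by (cases a) auto
qed simp

lemma word_eval_append:
  "u \<in> words A \<Longrightarrow> v \<in> words A \<Longrightarrow> word_eval G f (u @ v) = word_eval G f u \<otimes>\<^bsub>G\<^esub> word_eval G f v"
proof (induction u)
  case Nil
  then show ?case by (simp add: word_eval_closed)
next
  case (Cons a u)
  obtain x b where a: "a = (x, b)" by force
  have "f x \<in> carrier G" using Cons.prems a f by auto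
  then show ?case using Cons a by (simp add: word_eval_closed m_assoc)
qed

lemma word_eval_inv: "u \<in> words A \<Longrightarrow> word_eval G f (word_inv u) = inv\<^bsub>G\<^esub> word_eval G f u"
proof (induction u)
  case Nil
  then show ?case by (simp add: word_inv_def)
next
  case (Cons a u)
  obtain x b where a: "a = (x, b)" by force
  have u: "u \<in> words A" and x: "x \<in> A" and fx: "f x \<in> carrier G" using Cons.prems a f by auto
  have "word_eval G f (word_inv (a # u)) = word_eval G f (word_inv u @ [(x, \<not> b)])"
    by (simp add: word_inv_def a)
  also have "\<dots> = word_eval G f (word_inv u) \<otimes>\<^bsub>G\<^esub> word_eval G f [(x, \<not> b)]"
    using u x by (intro word_eval_append word_inv_words) auto
  also have "\<dots> = inv\<^bsub>G\<^esub> word_eval G f (a # u)"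
    using Cons.IH[OF u] fx u by (simp add: a inv_mult_group word_eval_closed)
  finally show ?case .
qed

lemma word_eval_comm:
  assumes "u \<in> words A" "v \<in> words A"
  shows "word_eval G f (word_comm u v) = group_comm G (word_eval G f u) (word_eval G f v)"
  using assms word_inv_words[OF assms(1)] word_inv_words[OF assms(2)]
  by (simp add: word_comm_def group_comm_def word_eval_append word_eval_inv word_eval_closed m_assoc)

lemma word_eval_cong: "nil_cong A u v \<Longrightarrow> word_eval G f u = word_eval G f v"
proof (induction rule: nil_cong.induct)
  case (nil_append u u' v v')
  then show ?case using nil_cong_words[OF nil_append(1)] nil_cong_words[OF nil_append(2)]
    by (simp add: word_eval_append)
next
  case (nil_cancel x b)
  have "f x \<in> carrier G" using nil_cancel f by auto
  then show ?case by simp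
next
  case (nil_triple u v w)
  have "word_comm u v \<in> words A"
    using nil_triple word_inv_words by (auto simp: word_comm_def)
  then show ?case using nil_triple
    by (simp add: word_eval_comm nil_group_comm[OF G] word_eval_closed)
qed auto

lemma free_lift_class:
  assumes "u \<in> words A"
  shows "free_lift G f (nil_class A u) = word_eval G f u"
proof -
  have "word_eval G f ` nil_class A u = {word_eval G f u}"
    using assms word_eval_cong by (auto simp: nil_class_def intro!: image_eqI nil_refl dest: nil_sym)
  then show ?thesis by (simp add: free_lift_def)
qed

lemma free_lift_hom: "free_lift G f \<in> hom (free_nil A) G"
proof (rule homI)
  fix C assume "C \<in> carrier (free_nil A)"
  then show "free_lift G f C \<in> carrier G"
    by (elim free_nil_cases) (simp add: free_lift_class word_eval_closed)
next
  fix C D assume "C \<in> carrier (free_nil A)" "D \<in> carrier (free_nil A)"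
  then show "free_lift G f (C \<otimes>\<^bsub>free_nil A\<^esub> D) = free_lift G f C \<otimes>\<^bsub>G\<^esub> free_lift G f D"
    by (elim free_nil_cases) (simp add: free_lift_class word_eval_append free_nil_mult)
qed

lemma free_lift_gen:
  assumes "x \<in> A"
  shows "free_lift G f (free_gen A x) = f x"
proof -
  have "f x \<in> carrier G" using f assms by auto
  then show ?thesis using assms by (simp add: free_gen_def free_lift_class)
qed

end

lemma free_gen_closed: "x \<in> A \<Longrightarrow> free_gen A x \<in> carrier (free_nil A)"
  by (simp add: free_gen_def free_nil_carrier)

lemma free_nil_hom_eqI:
  assumes G: "group G" and h: "h \<in> hom (free_nil A) G" "k \<in> hom (free_nil A) G"
    and gen: "\<And>x. x \<in> A \<Longrightarrow> h (free_gen A x) = k (free_gen A x)"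
    and C: "C \<in> carrier (free_nil A)"
  shows "h C = k C"
proof -
  interpret h: group_hom "free_nil A" G h
    using G h(1) group_free_nil by (simp add: group_hom_def group_hom_axioms_def)
  interpret k: group_hom "free_nil A" G k
    using G h(2) group_free_nil by (simp add: group_hom_def group_hom_axioms_def)
  have "u \<in> words A \<Longrightarrow> h (nil_class A u) = k (nil_class A u)" for u
  proof (induction u)
    case Nil
    then show ?case using h.hom_one k.hom_one by (simp add: free_nil_one)
  next
    case (Cons a u)
    obtain x b where a: "a = (x, b)" by force
    have x: "x \<in> A" and u: "u \<in> words A" using Cons.prems a by auto
    have e: "nil_class A (a # u) = nil_class A [a] \<otimes>\<^bsub>free_nil A\<^esub> nil_class A u"
      using x u a free_nil_mult[of "[a]" A u] by simp
    have "nil_class A [a] = (if b then free_gen A x else inv\<^bsub>free_nil A\<^esub> (free_gen A x))"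
      using x a by (simp add: free_gen_def free_nil_inv word_inv_def)
    then have "h (nil_class A [a]) = k (nil_class A [a])"
      using gen[OF x] h.hom_inv[OF free_gen_closed[OF x]] k.hom_inv[OF free_gen_closed[OF x]]
      by (cases b) simp_all
    moreover have "nil_class A [a] \<in> carrier (free_nil A)" "nil_class A u \<in> carrier (free_nil A)"
      using x u a by (auto intro!: free_nil_carrier)
    ultimately show ?case using Cons.IH[OF u] by (simp add: e)
  qed
  then show ?thesis using C free_nil_cases by metis
qed

theorem free_nil_universal:
  assumes "nil_group G" "f \<in> A \<rightarrow> carrier G"
  shows "\<exists>h\<in>hom (free_nil A) G. (\<forall>x\<in>A. h (free_gen A x) = f x) \<and>
    (\<forall>k\<in>hom (free_nil A) G. (\<forall>x\<in>A. k (free_gen A x) = f x) \<longrightarrow>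
      (\<forall>C\<in>carrier (free_nil A). k C = h C))"
proof (rule bexI[of _ "free_lift G f"], intro conjI ballI impI)
  show "free_lift G f \<in> hom (free_nil A) G" by (rule free_lift_hom[OF assms])
  show "free_lift G f (free_gen A x) = f x" if "x \<in> A" for x
    using free_lift_gen[OF assms that] .
  fix k C
  assume k: "k \<in> hom (free_nil A) G" "\<forall>x\<in>A. k (free_gen A x) = f x"
    and C: "C \<in> carrier (free_nil A)"
  have "group G" using assms(1) by (simp add: nil_group_def)
  then show "k C = free_lift G f C"
    using k free_lift_gen[OF assms]
    by (intro free_nil_hom_eqI[OF _ k(1) free_lift_hom[OF assms] _ C]) simp_all
qed


section \<open>Simplicial groups and their homotopy groups\<close>

text \<open>The face \<open>sface X q i\<close> maps \<open>X\<^sub>q\<close> to \<open>X\<^sub>q\<^sub>-\<^sub>1\<close> and is meaningful for \<open>q > 0\<close> and \<open>i \<le> q\<close>;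
  the degeneracy \<open>sdegen X q i\<close> maps \<open>X\<^sub>q\<close> to \<open>X\<^sub>q\<^sub>+\<^sub>1\<close> and is meaningful for \<open>i \<le> q\<close>.\<close>

record 'a simplicial =
  sgrp :: "nat \<Rightarrow> 'a monoid"
  sface :: "nat \<Rightarrow> nat \<Rightarrow> 'a \<Rightarrow> 'a"
  sdegen :: "nat \<Rightarrow> nat \<Rightarrow> 'a \<Rightarrow> 'a"

locale simplicial_group =
  fixes X :: "'a simplicial"
  assumes sgrp_group: "group (sgrp X q)"
    and face_hom: "i \<le> Suc q \<Longrightarrow> sface X (Suc q) i \<in> hom (sgrp X (Suc q)) (sgrp X q)"
    and degen_hom: "i \<le> q \<Longrightarrow> sdegen X q i \<in> hom (sgrp X q) (sgrp X (Suc q))"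
    and face_face: "\<lbrakk>x \<in> carrier (sgrp X (Suc (Suc q))); i < j; j \<le> Suc (Suc q)\<rbrakk> \<Longrightarrow>
      sface X (Suc q) i (sface X (Suc (Suc q)) j x) =
      sface X (Suc q) (j - 1) (sface X (Suc (Suc q)) i x)"
    and face_degen_less: "\<lbrakk>x \<in> carrier (sgrp X (Suc q)); i < j; j \<le> Suc q\<rbrakk> \<Longrightarrow>
      sface X (Suc (Suc q)) i (sdegen X (Suc q) j x) =
      sdegen X q (j - 1) (sface X (Suc q) i x)"
    and face_degen_same: "\<lbrakk>x \<in> carrier (sgrp X q); j \<le> q; i = j \<or> i = Suc j\<rbrakk> \<Longrightarrow>
      sface X (Suc q) i (sdegen X q j x) = x"
    and face_degen_greater:
      "\<lbrakk>x \<in> carrier (sgrp X (Suc q)); j \<le> Suc q; Suc j < i; i \<le> Suc (Suc q)\<rbrakk> \<Longrightarrow>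
      sface X (Suc (Suc q)) i (sdegen X (Suc q) j x) =
      sdegen X q j (sface X (Suc q) (i - 1) x)"
    and degen_degen: "\<lbrakk>x \<in> carrier (sgrp X q); i \<le> j; j \<le> q\<rbrakk> \<Longrightarrow>
      sdegen X (Suc q) i (sdegen X q j x) = sdegen X (Suc q) (Suc j) (sdegen X q i x)"

locale simplicial_nil_group = simplicial_group +
  assumes sgrp_nil: "nil_group (sgrp X q)"

definition simplicial_hom :: "'a simplicial \<Rightarrow> 'b simplicial \<Rightarrow> (nat \<Rightarrow> 'a \<Rightarrow> 'b) \<Rightarrow> bool" where
  "simplicial_hom X Y f \<longleftrightarrow>
    (\<forall>q. f q \<in> hom (sgrp X q) (sgrp Y q)) \<and>
    (\<forall>q i. \<forall>x\<in>carrier (sgrp X (Suc q)). i \<le> Suc q \<longrightarrow>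
      f q (sface X (Suc q) i x) = sface Y (Suc q) i (f (Suc q) x)) \<and>
    (\<forall>q i. \<forall>x\<in>carrier (sgrp X q). i \<le> q \<longrightarrow>
      f (Suc q) (sdegen X q i x) = sdegen Y q i (f q x))"

definition moore :: "'a simplicial \<Rightarrow> nat \<Rightarrow> 'a set" where
  "moore X q = {x \<in> carrier (sgrp X q). \<forall>i. 0 < i \<and> i \<le> q \<longrightarrow>
    sface X q i x = \<one>\<^bsub>sgrp X (q - 1)\<^esub>}"

definition moore_cycles :: "'a simplicial \<Rightarrow> nat \<Rightarrow> 'a set" where
  "moore_cycles X q = {x \<in> moore X q. q > 0 \<longrightarrow> sface X q 0 x = \<one>\<^bsub>sgrp X (q - 1)\<^esub>}"

definition moore_boundaries :: "'a simplicial \<Rightarrow> nat \<Rightarrow> 'a set" where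
  "moore_boundaries X q = sface X (Suc q) 0 ` moore X (Suc q)"

definition homotopy_class :: "'a simplicial \<Rightarrow> nat \<Rightarrow> 'a \<Rightarrow> 'a set" where
  "homotopy_class X q x = moore_boundaries X q #>\<^bsub>sgrp X q\<^esub> x"

definition homotopy_group :: "'a simplicial \<Rightarrow> int \<Rightarrow> 'a set monoid" where
  "homotopy_group X q =
    (if q < 0 then singleton_group {}
     else (sgrp X (nat q))\<lparr>carrier := moore_cycles X (nat q)\<rparr> Mod moore_boundaries X (nat q))"


section \<open>The spheres in simplicial nil groups\<close>

text \<open>A \<open>q\<close>-simplex of \<open>\<Delta>[n]\<close> is the sorted list of its \<open>q + 1\<close> vertices in \<open>{0..n}\<close>. The simplices
  of \<open>\<Delta>[n]/\<partial>\<Delta>[n]\<close> other than the base point are those in which every vertex occurs. Dividing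
  the free nil group on the pointed simplicial set \<open>\<Delta>[n]/\<partial>\<Delta>[n]\<close> by the base point gives the
  free simplicial nil group on one element \<open>\<iota>\<^sub>n\<close> in degree \<open>n\<close> with trivial faces (see
  \<open>nil_sphere_universal\<close>). For \<open>n = 0\<close> the boundary is empty and \<open>\<Delta>[0]\<close> gets a disjoint base
  point, so that \<open>S(0)\<close> is the constant simplicial group on \<open>\<int>\<close>.\<close>

definition sphere_simplices :: "nat \<Rightarrow> nat \<Rightarrow> nat list set" where
  "sphere_simplices n q = {v. sorted v \<and> length v = Suc q \<and> set v = {0..n}}"

definition del_vertex :: "nat \<Rightarrow> 'a list \<Rightarrow> 'a list" where
  "del_vertex i v = take i v @ drop (Suc i) v"

definition dup_vertex :: "nat \<Rightarrow> 'a list \<Rightarrow> 'a list" where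
  "dup_vertex i v = take (Suc i) v @ drop i v"

text \<open>The map of free nil groups induced by a map of pointed sets; values of \<open>f\<close> outside \<open>B\<close> play
  the role of the base point.\<close>

definition free_map :: "'a set \<Rightarrow> 'b set \<Rightarrow> ('a \<Rightarrow> 'b) \<Rightarrow> 'a word set \<Rightarrow> 'b word set" where
  "free_map A B f =
    free_lift (free_nil B) (\<lambda>x. if f x \<in> B then free_gen B (f x) else \<one>\<^bsub>free_nil B\<^esub>)"

definition nil_sphere :: "nat \<Rightarrow> nat list word set simplicial" where
  "nil_sphere n =
    \<lparr>sgrp = (\<lambda>q. free_nil (sphere_simplices n q)),
     sface = (\<lambda>q i. free_map (sphere_simplices n q) (sphere_simplices n (q - 1)) (del_vertex i)),
     sdegen = (\<lambda>q i. free_map (sphere_simplices n q) (sphere_simplices n (Suc q)) (dup_vertex i))\<rparr>"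

definition sphere_gen :: "nat \<Rightarrow> nat list word set" where
  "sphere_gen n = free_gen (sphere_simplices n n) [0..<Suc n]"

text \<open>Under \<open>[S(n), X] \<rightarrow> \<pi>\<^sub>n X\<close> the identity of \<open>S(n)\<close> corresponds to the class of the free generator
  \<open>\<iota>\<^sub>n\<close>.\<close>

definition sphere_class :: "nat \<Rightarrow> nat list word set set" where
  "sphere_class n = homotopy_class (nil_sphere n) n (sphere_gen n)"


lemma free_map_values:
  "(\<lambda>x. if f x \<in> B then free_gen B (f x) else \<one>\<^bsub>free_nil B\<^esub>) \<in> A \<rightarrow> carrier (free_nil B)"
  using group_free_nil[of B] by (auto simp: free_gen_closed group.is_monoid)

lemma free_map_hom: "free_map A B f \<in> hom (free_nil A) (free_nil B)"
  unfolding free_map_def by (rule free_lift_hom[OF nil_group_free_nil free_map_values])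

lemma free_map_gen:
  "x \<in> A \<Longrightarrow> free_map A B f (free_gen A x) = (if f x \<in> B then free_gen B (f x) else \<one>\<^bsub>free_nil B\<^esub>)"
  unfolding free_map_def by (rule free_lift_gen[OF nil_group_free_nil free_map_values])

lemma free_map_one: "free_map A B f \<one>\<^bsub>free_nil A\<^esub> = \<one>\<^bsub>free_nil B\<^esub>"
  using hom_one[OF free_map_hom group_free_nil group_free_nil] .

lemma free_map_comp:
  assumes "\<And>x. x \<in> A \<Longrightarrow> f x \<notin> B \<Longrightarrow> g (f x) \<notin> C" and "c \<in> carrier (free_nil A)"
  shows "free_map B C g (free_map A B f c) = free_map A C (\<lambda>x. g (f x)) c"
proof -
  have "(free_map B C g \<circ> free_map A B f) c = free_map A C (\<lambda>x. g (f x)) c"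
  proof (rule free_nil_hom_eqI[OF group_free_nil _ free_map_hom _ assms(2)])
    show "free_map B C g \<circ> free_map A B f \<in> hom (free_nil A) (free_nil C)"
      by (rule hom_compose[OF free_map_hom free_map_hom])
    show "(free_map B C g \<circ> free_map A B f) (free_gen A x)
        = free_map A C (\<lambda>x. g (f x)) (free_gen A x)" if "x \<in> A" for x
      using that assms(1)[OF that] by (auto simp: free_map_gen free_map_one)
  qed
  then show ?thesis by simp
qed

lemma free_map_cong:
  assumes "\<And>x. x \<in> A \<Longrightarrow> f x = g x" "c \<in> carrier (free_nil A)"
  shows "free_map A B f c = free_map A B g c"
  by (rule free_nil_hom_eqI[OF group_free_nil free_map_hom free_map_hom _ assms(2)])
    (simp add: free_map_gen assms(1))

lemma free_map_id:
  assumes "c \<in> carrier (free_nil A)"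
  shows "free_map A A (\<lambda>x. x) c = c"
proof -
  have "free_map A A (\<lambda>x. x) c = (\<lambda>c. c) c"
    by (rule free_nil_hom_eqI[OF group_free_nil free_map_hom _ _ assms])
      (auto simp: free_map_gen intro: homI)
  then show ?thesis by simp
qed

lemma length_del_vertex: "i < length v \<Longrightarrow> length (del_vertex i v) = length v - 1"
  by (simp add: del_vertex_def)

lemma length_dup_vertex: "i < length v \<Longrightarrow> length (dup_vertex i v) = Suc (length v)"
  by (simp add: dup_vertex_def)

lemma nth_del_vertex:
  "i < length v \<Longrightarrow> k < length v - 1 \<Longrightarrow> del_vertex i v ! k = v ! (if k < i then k else Suc k)"
  by (auto simp: del_vertex_def nth_append)

lemma nth_dup_vertex:
  "i < length v \<Longrightarrow> k \<le> length v \<Longrightarrow> dup_vertex i v ! k = v ! (if k \<le> i then k else k - 1)"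
  by (auto simp: dup_vertex_def nth_append min_def intro!: arg_cong[of _ _ "nth v"])

lemma set_del_vertex: "set (del_vertex i v) \<subseteq> set v"
  by (auto simp: del_vertex_def dest: in_set_takeD in_set_dropD)

lemma set_dup_vertex: "set (dup_vertex i v) = set v"
proof -
  have "v = take i v @ drop i v" by simp
  then have "set v = set (take i v) \<union> set (drop i v)" by (metis set_append)
  then show ?thesis
    unfolding dup_vertex_def set_append using set_take_subset[of "Suc i" v]
      set_take_subset_set_take[of i "Suc i" v] by auto
qed

lemma sorted_del_vertex:
  assumes "sorted v" "i < length v"
  shows "sorted (del_vertex i v)"
  unfolding sorted_iff_nth_mono using assms
  by (auto simp: length_del_vertex nth_del_vertex intro!: sorted_nth_mono)

lemma sorted_dup_vertex:
  assumes "sorted v" "i < length v"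
  shows "sorted (dup_vertex i v)"
  unfolding sorted_iff_nth_mono using assms
  by (auto simp: length_dup_vertex nth_dup_vertex intro!: sorted_nth_mono)

lemmas vertex_simps = length_del_vertex length_dup_vertex nth_del_vertex nth_dup_vertex

lemma del_del_vertex:
  "i < j \<Longrightarrow> j < length v \<Longrightarrow> del_vertex i (del_vertex j v) = del_vertex (j - 1) (del_vertex i v)"
  by (intro nth_equalityI) (auto simp: vertex_simps)

lemma del_dup_vertex_less:
  "i < j \<Longrightarrow> j < length v \<Longrightarrow> del_vertex i (dup_vertex j v) = dup_vertex (j - 1) (del_vertex i v)"
  by (intro nth_equalityI) (auto simp: vertex_simps intro!: arg_cong[of _ _ "nth v"])

lemma del_dup_vertex_same:
  "j < length v \<Longrightarrow> del_vertex j (dup_vertex j v) = v"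
  "j < length v \<Longrightarrow> del_vertex (Suc j) (dup_vertex j v) = v"
  by (intro nth_equalityI; auto simp: vertex_simps)+

lemma del_dup_vertex_greater:
  "Suc j < i \<Longrightarrow> i \<le> length v \<Longrightarrow> del_vertex i (dup_vertex j v) = dup_vertex j (del_vertex (i - 1) v)"
  by (intro nth_equalityI) (auto simp: vertex_simps intro!: arg_cong[of _ _ "nth v"])

lemma dup_dup_vertex:
  "i \<le> j \<Longrightarrow> j < length v \<Longrightarrow> dup_vertex i (dup_vertex j v) = dup_vertex (Suc j) (dup_vertex i v)"
  by (intro nth_equalityI) (auto simp: vertex_simps intro!: arg_cong[of _ _ "nth v"])

lemma sphere_simplices_del_iff:
  assumes "v \<in> sphere_simplices n (Suc q)" "i \<le> Suc q"
  shows "del_vertex i v \<in> sphere_simplices n q \<longleftrightarrow> set (del_vertex i v) = {0..n}"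
  using assms sorted_del_vertex[of v i] by (auto simp: sphere_simplices_def vertex_simps)

lemma sphere_simplices_dup:
  "v \<in> sphere_simplices n q \<Longrightarrow> i \<le> q \<Longrightarrow> dup_vertex i v \<in> sphere_simplices n (Suc q)"
  using sorted_dup_vertex[of v i] by (auto simp: sphere_simplices_def vertex_simps set_dup_vertex)

lemma sphere_del_outside:
  assumes "v \<in> sphere_simplices n (Suc q)" "i \<le> Suc q" "del_vertex i v \<notin> sphere_simplices n q"
    and "set w \<subseteq> set (del_vertex i v)"
  shows "w \<notin> sphere_simplices n p"
proof
  assume "w \<in> sphere_simplices n p"
  then have "set (del_vertex i v) = {0..n}"
    using assms(1,4) set_del_vertex[of i v] by (auto simp: sphere_simplices_def)
  then show False using assms sphere_simplices_del_iff by blast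
qed

lemma sphere_del_comp:
  assumes "c \<in> carrier (free_nil (sphere_simplices n (Suc q)))" "i \<le> Suc q"
    and "\<And>w. set (g w) \<subseteq> set w"
  shows "free_map (sphere_simplices n q) (sphere_simplices n p) g
      (free_map (sphere_simplices n (Suc q)) (sphere_simplices n q) (del_vertex i) c)
    = free_map (sphere_simplices n (Suc q)) (sphere_simplices n p) (\<lambda>v. g (del_vertex i v)) c"
  by (rule free_map_comp[OF _ assms(1)]) (rule sphere_del_outside[OF _ assms(2) _ assms(3)])

lemma sphere_dup_comp:
  assumes "c \<in> carrier (free_nil (sphere_simplices n q))" "i \<le> q"
  shows "free_map (sphere_simplices n (Suc q)) (sphere_simplices n p) g
      (free_map (sphere_simplices n q) (sphere_simplices n (Suc q)) (dup_vertex i) c)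
    = free_map (sphere_simplices n q) (sphere_simplices n p) (\<lambda>v. g (dup_vertex i v)) c"
  using sphere_simplices_dup[OF _ assms(2)] by (intro free_map_comp[OF _ assms(1)]) blast

theorem simplicial_nil_group_nil_sphere: "simplicial_nil_group (nil_sphere n)"
proof -
  let ?S = "sphere_simplices n"
  have len: "length v = Suc q" if "v \<in> ?S q" for v q
    using that by (simp add: sphere_simplices_def)
  note comp = sphere_del_comp[OF _ _ set_del_vertex] sphere_dup_comp
    sphere_del_comp[OF _ _ equalityD1[OF set_dup_vertex]]
  have 1: "free_map (?S (Suc q)) (?S q) (del_vertex i)
        (free_map (?S (Suc (Suc q))) (?S (Suc q)) (del_vertex j) c)
      = free_map (?S (Suc q)) (?S q) (del_vertex (j - 1))
        (free_map (?S (Suc (Suc q))) (?S (Suc q)) (del_vertex i) c)"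
    if "c \<in> carrier (free_nil (?S (Suc (Suc q))))" "i < j" "j \<le> Suc (Suc q)" for q i j c
    using that
    by (simp add: comp) (rule free_map_cong, simp_all add: del_del_vertex len)
  have 2: "free_map (?S (Suc (Suc q))) (?S (Suc q)) (del_vertex i)
        (free_map (?S (Suc q)) (?S (Suc (Suc q))) (dup_vertex j) c)
      = free_map (?S q) (?S (Suc q)) (dup_vertex (j - 1))
        (free_map (?S (Suc q)) (?S q) (del_vertex i) c)"
    if "c \<in> carrier (free_nil (?S (Suc q)))" "i < j" "j \<le> Suc q" for q i j c
    using that
    by (simp add: comp) (rule free_map_cong, simp_all add: del_dup_vertex_less len)
  have 3: "free_map (?S (Suc (Suc q))) (?S (Suc q)) (del_vertex i)
        (free_map (?S (Suc q)) (?S (Suc (Suc q))) (dup_vertex j) c)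
      = free_map (?S q) (?S (Suc q)) (dup_vertex j)
        (free_map (?S (Suc q)) (?S q) (del_vertex (i - 1)) c)"
    if "c \<in> carrier (free_nil (?S (Suc q)))" "j \<le> Suc q" "Suc j < i" "i \<le> Suc (Suc q)" for q i j c
  proof -
    have "i - 1 \<le> Suc q" using that by simp
    then show ?thesis using that
      by (simp add: comp) (rule free_map_cong, simp_all add: del_dup_vertex_greater len)
  qed
  have 4: "free_map (?S (Suc q)) (?S q) (del_vertex i) (free_map (?S q) (?S (Suc q)) (dup_vertex j) c) = c"
    if "c \<in> carrier (free_nil (?S q))" "j \<le> q" "i = j \<or> i = Suc j" for q i j c
  proof -
    have "free_map (?S (Suc q)) (?S q) (del_vertex i) (free_map (?S q) (?S (Suc q)) (dup_vertex j) c)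
        = free_map (?S q) (?S q) (\<lambda>v. v) c"
      using that
      by (simp add: comp) (rule free_map_cong, auto simp: del_dup_vertex_same len)
    then show ?thesis using that free_map_id by simp
  qed
  have 5: "free_map (?S (Suc q)) (?S (Suc (Suc q))) (dup_vertex i)
        (free_map (?S q) (?S (Suc q)) (dup_vertex j) c)
      = free_map (?S (Suc q)) (?S (Suc (Suc q))) (dup_vertex (Suc j))
        (free_map (?S q) (?S (Suc q)) (dup_vertex i) c)"
    if "c \<in> carrier (free_nil (?S q))" "i \<le> j" "j \<le> q" for q i j c
    using that
    by (simp add: comp) (rule free_map_cong, simp_all add: dup_dup_vertex len)
  show ?thesis
    by (intro simplicial_nil_group.intro simplicial_group.intro simplicial_nil_group_axioms.intro)
      (simp_all add: nil_sphere_def group_free_nil nil_group_free_nil free_map_hom 1 2 3 4 5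
        del: One_nat_def)
qed


lemma sphere_simplices_less: "q < n \<Longrightarrow> sphere_simplices n q = {}"
proof -
  assume "q < n"
  have False if "length v = Suc q" "set v = {0..n}" for v
    using card_length[of v] that \<open>q < n\<close> by simp
  then show ?thesis unfolding sphere_simplices_def by blast
qed

lemma sphere_simplices_same: "sphere_simplices n n = {[0..<Suc n]}"
proof -
  have "v = [0..<Suc n]" if "sorted v" "length v = Suc n" "set v = {0..n}" for v
  proof -
    have "distinct v" using that by (simp add: card_distinct)
    moreover have "set [0..<Suc n] = {0..n}"
      by (simp only: set_upt atLeastLessThanSuc_atLeastAtMost)
    ultimately show ?thesis using that
      by (intro sorted_distinct_set_unique sorted_upt distinct_upt) simp_all
  qed
  moreover have "[0..<Suc n] \<in> sphere_simplices n n"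
    unfolding sphere_simplices_def mem_Collect_eq set_upt atLeastLessThanSuc_atLeastAtMost
      length_upt by (intro conjI sorted_upt) simp_all
  ultimately show ?thesis unfolding sphere_simplices_def by blast
qed

definition first_repeat :: "nat list \<Rightarrow> nat" where
  "first_repeat v = (LEAST i. v ! i = v ! Suc i)"

lemma sphere_repeat:
  assumes "v \<in> sphere_simplices n (Suc q)" "n \<le> q"
  shows "first_repeat v \<le> q" "v ! first_repeat v = v ! Suc (first_repeat v)"
proof -
  have v: "sorted v" "length v = Suc (Suc q)" "card (set v) = Suc n"
    using assms by (auto simp: sphere_simplices_def)
  have "\<exists>i\<le>q. v ! i = v ! Suc i"
  proof (rule ccontr)
    assume no: "\<not> (\<exists>i\<le>q. v ! i = v ! Suc i)"
    have "v ! i < v ! Suc i" if "Suc i < length v" for i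
    proof -
      have "v ! i \<le> v ! Suc i" using v that by (intro sorted_nth_mono) auto
      moreover have "v ! i \<noteq> v ! Suc i" using no that v by auto
      ultimately show ?thesis by simp
    qed
    then have "sorted_wrt (<) v" by (simp add: sorted_wrt_iff_nth_Suc_transp)
    then have "distinct v" using strict_sorted_iff by blast
    then show False using v assms(2) distinct_card by fastforce
  qed
  then obtain i where i: "i \<le> q" "v ! i = v ! Suc i" by blast
  then show "v ! first_repeat v = v ! Suc (first_repeat v)"
    unfolding first_repeat_def by (intro LeastI)
  show "first_repeat v \<le> q"
    unfolding first_repeat_def using i by (intro order.trans[OF Least_le]) auto
qed

lemma dup_del_vertex:
  assumes "Suc j < length v" "v ! j = v ! Suc j"
  shows "dup_vertex j (del_vertex j v) = v"
proof (rule nth_equalityI)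
  fix k assume "k < length (dup_vertex j (del_vertex j v))"
  then have k: "k < length v" using assms by (simp add: vertex_simps)
  show "dup_vertex j (del_vertex j v) ! k = v ! k"
    using assms k by (cases "k = j"; cases "k < j") (auto simp: vertex_simps)
qed (use assms in \<open>simp add: vertex_simps\<close>)

lemma sphere_del_repeat:
  assumes "v \<in> sphere_simplices n (Suc q)" "j \<le> q" "v ! j = v ! Suc j"
  shows "del_vertex j v \<in> sphere_simplices n q" "dup_vertex j (del_vertex j v) = v"
proof -
  have "length v = Suc (Suc q)" using assms(1) by (simp add: sphere_simplices_def)
  then show d: "dup_vertex j (del_vertex j v) = v" using assms by (intro dup_del_vertex) auto
  then have "set (del_vertex j v) = set v" using set_dup_vertex by metis
  then show "del_vertex j v \<in> sphere_simplices n q"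
    using sphere_simplices_del_iff[OF assms(1), of j] assms(1,2) by (simp add: sphere_simplices_def)
qed

text \<open>For \<open>v \<in> sphere_simplices n q\<close>, the iterated degeneracy of \<open>x \<in> X\<^sub>n\<close> along the surjection
  \<open>{0..q} \<rightarrow> {0..n}\<close> listed by \<open>v\<close>.\<close>

primrec degeneracy :: "'a simplicial \<Rightarrow> nat \<Rightarrow> 'a \<Rightarrow> nat \<Rightarrow> nat list \<Rightarrow> 'a" where
  "degeneracy X n x 0 v = x"
| "degeneracy X n x (Suc q) v =
    (if q < n then x
     else sdegen X q (first_repeat v) (degeneracy X n x q (del_vertex (first_repeat v) v)))"

declare degeneracy.simps(2) [simp del]

context
  fixes X :: "'a simplicial" and n :: nat and x :: 'a
  assumes X: "simplicial_nil_group X"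
    and x: "x \<in> carrier (sgrp X n)"
    and dx: "n > 0 \<Longrightarrow> i \<le> n \<Longrightarrow> sface X n i x = \<one>\<^bsub>sgrp X (n - 1)\<^esub>"
begin

interpretation simplicial_nil_group X by (rule X)

lemma degen_one: "i \<le> q \<Longrightarrow> sdegen X q i \<one>\<^bsub>sgrp X q\<^esub> = \<one>\<^bsub>sgrp X (Suc q)\<^esub>"
  using hom_one[OF degen_hom sgrp_group sgrp_group] by blast

abbreviation "dg \<equiv> degeneracy X n x"

lemma dg_le: "q \<le> n \<Longrightarrow> dg q v = x"
  by (cases q) (auto simp: degeneracy.simps(2))

lemma dg_closed: "v \<in> sphere_simplices n q \<Longrightarrow> dg q v \<in> carrier (sgrp X q)"
proof (induction q arbitrary: v)
  case 0
  then have "n = 0" using sphere_simplices_less by (cases n) auto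
  then show ?case using x by simp
next
  case (Suc q)
  consider "Suc q < n" | "Suc q = n" | "n \<le> q" by linarith
  then show ?case
  proof cases
    case 1
    then show ?thesis using Suc.prems sphere_simplices_less by auto
  next
    case 2
    then show ?thesis using x by (auto simp: dg_le)
  next
    case 3
    note r = sphere_repeat[OF Suc.prems 3]
    have "dg q (del_vertex (first_repeat v) v) \<in> carrier (sgrp X q)"
      using Suc.IH sphere_del_repeat(1)[OF Suc.prems r] by blast
    then show ?thesis using 3 hom_in_carrier[OF degen_hom[OF r(1)]]
      by (simp add: degeneracy.simps(2))
  qed
qed

lemma dg_dup:
  "v \<in> sphere_simplices n q \<Longrightarrow> i \<le> q \<Longrightarrow> dg (Suc q) (dup_vertex i v) = sdegen X q i (dg q v)"
proof (induction q arbitrary: v i)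
  case 0
  then have n: "n = 0" using sphere_simplices_less by (cases n) auto
  have "dup_vertex i v \<in> sphere_simplices n (Suc 0)" using 0 sphere_simplices_dup by blast
  then have "first_repeat (dup_vertex i v) \<le> 0" using sphere_repeat(1) n by blast
  then show ?case using n 0 by (simp add: degeneracy.simps(2))
next
  case (Suc q)
  have n: "n \<le> Suc q" using Suc.prems sphere_simplices_less[of "Suc q" n] by (cases "Suc q < n") auto
  have len: "length v = Suc (Suc q)" using Suc.prems by (simp add: sphere_simplices_def)
  let ?w = "dup_vertex i v"
  define j where "j = first_repeat ?w"
  have w: "?w \<in> sphere_simplices n (Suc (Suc q))" using Suc.prems sphere_simplices_dup by blast
  have jr: "?w ! j = ?w ! Suc j" using sphere_repeat(2)[OF w n] by (simp add: j_def)
  have eq: "dg (Suc (Suc q)) ?w = sdegen X (Suc q) j (dg (Suc q) (del_vertex j ?w))"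
    using n by (simp add: j_def degeneracy.simps(2))
  have least: "j \<le> k" if "?w ! k = ?w ! Suc k" for k
    unfolding j_def first_repeat_def using that by (rule Least_le)
  have "?w ! i = ?w ! Suc i" using Suc.prems len by (simp add: vertex_simps)
  then have "j \<le> i" by (rule least)
  then consider "j = i" | "j < i" by linarith
  then show ?case
  proof cases
    case 1
    then show ?thesis using eq Suc.prems len by (simp add: del_dup_vertex_same)
  next
    case 2
    have vr: "v ! j = v ! Suc j" using jr 2 Suc.prems len by (simp add: vertex_simps)
    have fr: "first_repeat v = j"
      unfolding first_repeat_def
    proof (rule Least_equality[where P = "\<lambda>i. v ! i = v ! Suc i", OF vr])
      fix k assume k: "v ! k = v ! Suc k"
      show "j \<le> k"
      proof (rule ccontr)
        assume "\<not> j \<le> k"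
        then have "?w ! k = ?w ! Suc k" using k 2 Suc.prems len by (simp add: vertex_simps)
        then show False using least \<open>\<not> j \<le> k\<close> by blast
      qed
    qed
    have "n \<noteq> Suc q"
    proof
      assume "n = Suc q"
      then have "v = [0..<Suc (Suc q)]" using Suc.prems sphere_simplices_same by auto
      then show False using vr 2 Suc.prems by (auto simp del: upt_Suc)
    qed
    then have nq: "n \<le> q" using n by simp
    have jq: "j \<le> q" using 2 Suc.prems by simp
    let ?u = "del_vertex j v"
    have u: "?u \<in> sphere_simplices n q" by (rule sphere_del_repeat(1)[OF Suc.prems(1) jq vr])
    have i: "i - 1 \<le> q" "j \<le> i - 1" "Suc (i - 1) = i" using 2 Suc.prems by auto
    have "del_vertex j ?w = dup_vertex (i - 1) ?u"
      using 2 Suc.prems len by (intro del_dup_vertex_less) auto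
    then have "dg (Suc (Suc q)) ?w = sdegen X (Suc q) j (sdegen X q (i - 1) (dg q ?u))"
      using eq Suc.IH[OF u i(1)] by simp
    also have "\<dots> = sdegen X (Suc q) i (sdegen X q j (dg q ?u))"
      using degen_degen[OF dg_closed[OF u] i(2,1)] i(3) by simp
    also have "sdegen X q j (dg q ?u) = dg (Suc q) v" using nq fr by (simp add: degeneracy.simps(2))
    finally show ?thesis .
  qed
qed

lemma dg_face:
  "v \<in> sphere_simplices n (Suc q) \<Longrightarrow> i \<le> Suc q \<Longrightarrow> sface X (Suc q) i (dg (Suc q) v) =
    (if del_vertex i v \<in> sphere_simplices n q then dg q (del_vertex i v) else \<one>\<^bsub>sgrp X q\<^esub>)"
proof (induction q arbitrary: v i rule: less_induct)
  case (less q)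
  consider "Suc q < n" | "Suc q = n" | "n \<le> q" by linarith
  then show ?case
  proof cases
    case 1
    then show ?thesis using less.prems sphere_simplices_less by auto
  next
    case 2
    then show ?thesis using dx[of i] less.prems sphere_simplices_less[of q n] by (auto simp: dg_le)
  next
    case 3
    define j where "j = first_repeat v"
    let ?w = "del_vertex j v"
    have r: "j \<le> q" "v ! j = v ! Suc j" unfolding j_def using sphere_repeat[OF less.prems(1) 3] by auto
    have w: "?w \<in> sphere_simplices n q" and v: "dup_vertex j ?w = v"
      using sphere_del_repeat[OF less.prems(1) r] by auto
    have len: "length ?w = Suc q" using w by (simp add: sphere_simplices_def)
    have eq: "dg (Suc q) v = sdegen X q j (dg q ?w)" using dg_dup[OF w r(1)] v by simp
    have wc: "dg q ?w \<in> carrier (sgrp X q)" by (rule dg_closed[OF w])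
    have step: "sdegen X p k (sface X (Suc p) l (dg (Suc p) ?w)) =
        (if dup_vertex k (del_vertex l ?w) \<in> sphere_simplices n q
         then dg q (dup_vertex k (del_vertex l ?w)) else \<one>\<^bsub>sgrp X q\<^esub>)"
      if p: "q = Suc p" and k: "k \<le> p" and l: "l \<le> Suc p" for p k l
    proof (cases "del_vertex l ?w \<in> sphere_simplices n p")
      case True
      then show ?thesis
        using less.IH[of p ?w l] p w l sphere_simplices_dup[OF True k] dg_dup[OF True k]
        by simp
    next
      case False
      then have "dup_vertex k (del_vertex l ?w) \<notin> sphere_simplices n q"
        using sphere_del_outside[OF _ l False equalityD1[OF set_dup_vertex]] w p by blast
      then show ?thesis using less.IH[of p ?w l] p w l False k by (simp add: degen_one)
    qed
    consider "i < j" | "i = j \<or> i = Suc j" | "Suc j < i" by linarith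
    then show ?thesis
    proof cases
      case 1
      then obtain p where p: "q = Suc p" using r(1) by (cases q) auto
      have "del_vertex i v = dup_vertex (j - 1) (del_vertex i ?w)"
        using del_dup_vertex_less[of i j ?w] 1 r(1) len v by simp
      then show ?thesis
        using step[OF p, of "j - 1" i] face_degen_less[of "dg q ?w" p i j] 1 r(1) wc eq
        unfolding p by simp
    next
      case 2
      then have "del_vertex i v = ?w"
        using del_dup_vertex_same[of j ?w] r(1) len v by auto
      then show ?thesis using face_degen_same[OF wc r(1) 2] w eq by simp
    next
      case 3
      then obtain p where p: "q = Suc p" using less.prems(2) by (cases q) auto
      have "del_vertex i v = dup_vertex j (del_vertex (i - 1) ?w)"
        using del_dup_vertex_greater[of j i ?w] 3 less.prems(2) len v by simp
      moreover have "j \<le> p" "i - 1 \<le> Suc p" using 3 less.prems(2) p by auto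
      ultimately show ?thesis
        using step[OF p, of j "i - 1"] face_degen_greater[of "dg q ?w" p j i] 3 less.prems(2) r(1) wc eq
        unfolding p by simp
    qed
  qed
qed

lemma dg_pi: "dg q \<in> sphere_simplices n q \<rightarrow> carrier (sgrp X q)"
  using dg_closed by blast

lemma simplicial_hom_lift:
  "simplicial_hom (nil_sphere n) X (\<lambda>q. free_lift (sgrp X q) (dg q))"
proof -
  let ?S = "sphere_simplices n"
  let ?f = "\<lambda>q. free_lift (sgrp X q) (dg q)"
  note hom = free_lift_hom[OF sgrp_nil dg_pi] and gen = free_lift_gen[OF sgrp_nil dg_pi]
  note one = hom_one[OF hom group_free_nil sgrp_group]
  have 1: "(?f q \<circ> free_map (?S (Suc q)) (?S q) (del_vertex i)) c = (sface X (Suc q) i \<circ> ?f (Suc q)) c"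
    if c: "c \<in> carrier (free_nil (?S (Suc q)))" and i: "i \<le> Suc q" for q i c
    by (rule free_nil_hom_eqI[OF sgrp_group hom_compose[OF free_map_hom hom] hom_compose[OF hom face_hom[OF i]] _ c])
      (simp add: free_map_gen gen one dg_face i)
  have 2: "(?f (Suc q) \<circ> free_map (?S q) (?S (Suc q)) (dup_vertex i)) c = (sdegen X q i \<circ> ?f q) c"
    if c: "c \<in> carrier (free_nil (?S q))" and i: "i \<le> q" for q i c
    by (rule free_nil_hom_eqI[OF sgrp_group hom_compose[OF free_map_hom hom] hom_compose[OF hom degen_hom[OF i]] _ c])
      (simp add: free_map_gen gen sphere_simplices_dup dg_dup i)
  show ?thesis
    unfolding simplicial_hom_def using hom 1 2 by (simp add: nil_sphere_def)
qed

lemma simplicial_hom_unique: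
  assumes g: "simplicial_hom (nil_sphere n) X g" "g n (sphere_gen n) = x"
    and c: "c \<in> carrier (sgrp (nil_sphere n) q)"
  shows "g q c = free_lift (sgrp X q) (dg q) c"
proof -
  let ?S = "sphere_simplices n"
  have ghom: "g q \<in> hom (free_nil (?S q)) (sgrp X q)" for q
    using g(1) by (simp add: simplicial_hom_def nil_sphere_def)
  have gdeg: "g (Suc q) (free_map (?S q) (?S (Suc q)) (dup_vertex i) c) = sdegen X q i (g q c)"
    if "c \<in> carrier (free_nil (?S q))" "i \<le> q" for q i c
    using g(1) that by (simp add: simplicial_hom_def nil_sphere_def)
  have gv: "v \<in> ?S q \<Longrightarrow> g q (free_gen (?S q) v) = dg q v" for q v
  proof (induction q arbitrary: v)
    case 0
    then have "n = 0" using sphere_simplices_less by (cases n) auto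
    then show ?case using 0 g(2) sphere_simplices_same[of 0] by (auto simp: sphere_gen_def)
  next
    case (Suc q)
    consider "Suc q < n" | "Suc q = n" | "n \<le> q" by linarith
    then show ?case
    proof cases
      case 1
      then show ?thesis using Suc.prems sphere_simplices_less by auto
    next
      case 2
      then have "v = [0..<Suc n]" using Suc.prems sphere_simplices_same[of n] by simp
      then show ?thesis using 2 g(2) by (auto simp: sphere_gen_def dg_le simp del: upt_Suc)
    next
      case 3
      define j where "j = first_repeat v"
      let ?w = "del_vertex j v"
      have r: "j \<le> q" "v ! j = v ! Suc j" unfolding j_def using sphere_repeat[OF Suc.prems 3] by auto
      have w: "?w \<in> ?S q" and v: "dup_vertex j ?w = v"
        using sphere_del_repeat[OF Suc.prems r] by auto
      have "free_gen (?S (Suc q)) v = free_map (?S q) (?S (Suc q)) (dup_vertex j) (free_gen (?S q) ?w)"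
        using w v Suc.prems by (simp add: free_map_gen)
      then have "g (Suc q) (free_gen (?S (Suc q)) v) = sdegen X q j (dg q ?w)"
        using gdeg[OF free_gen_closed[OF w] r(1)] Suc.IH[OF w] by simp
      then show ?thesis using dg_dup[OF w r(1)] v by simp
    qed
  qed
  have "c \<in> carrier (free_nil (?S q))" using c by (simp add: nil_sphere_def)
  then show ?thesis
    by (rule free_nil_hom_eqI[OF sgrp_group ghom free_lift_hom[OF sgrp_nil dg_pi], rotated])
      (simp only: gv free_lift_gen[OF sgrp_nil dg_pi])
qed

end

theorem nil_sphere_universal:
  assumes "simplicial_nil_group X" "x \<in> carrier (sgrp X n)"
    and "\<And>i. n > 0 \<Longrightarrow> i \<le> n \<Longrightarrow> sface X n i x = \<one>\<^bsub>sgrp X (n - 1)\<^esub>"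
  shows "\<exists>f. simplicial_hom (nil_sphere n) X f \<and> f n (sphere_gen n) = x \<and>
    (\<forall>g. simplicial_hom (nil_sphere n) X g \<and> g n (sphere_gen n) = x \<longrightarrow>
      (\<forall>q. \<forall>c\<in>carrier (sgrp (nil_sphere n) q). g q c = f q c))"
proof (intro exI conjI allI impI ballI)
  show "simplicial_hom (nil_sphere n) X (\<lambda>q. free_lift (sgrp X q) (degeneracy X n x q))"
    by (rule simplicial_hom_lift[OF assms])
  have "free_lift (sgrp X n) (degeneracy X n x n) (sphere_gen n) = degeneracy X n x n [0..<Suc n]"
    unfolding sphere_gen_def
    by (rule free_lift_gen[OF simplicial_nil_group.sgrp_nil[OF assms(1)] dg_pi[OF assms]]) (simp_all add: sphere_simplices_same)
  then show "free_lift (sgrp X n) (degeneracy X n x n) (sphere_gen n) = x"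
    using dg_le[OF assms] by simp
  show "g q c = free_lift (sgrp X q) (degeneracy X n x q) c"
    if "simplicial_hom (nil_sphere n) X g \<and> g n (sphere_gen n) = x"
      "c \<in> carrier (sgrp (nil_sphere n) q)" for g q c
    using simplicial_hom_unique[OF assms] that by blast
qed


lemma sphere_gen_cycle: "sphere_gen n \<in> moore_cycles (nil_sphere n) n"
proof -
  have v: "[0..<Suc n] \<in> sphere_simplices n n" by (simp only: sphere_simplices_same singletonI)
  have "sface (nil_sphere n) n i (sphere_gen n) = \<one>\<^bsub>sgrp (nil_sphere n) (n - 1)\<^esub>" if "n > 0" for i
    using that sphere_simplices_less[of "n - 1" n] v
    by (simp add: nil_sphere_def sphere_gen_def free_map_gen del: upt_Suc)
  moreover have "sphere_gen n \<in> carrier (sgrp (nil_sphere n) n)"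
    using free_gen_closed[OF v] by (simp add: nil_sphere_def sphere_gen_def del: upt_Suc)
  ultimately show ?thesis by (auto simp: moore_cycles_def moore_def)
qed


section \<open>Cyclic groups with a given generator\<close>

text \<open>\<open>G\<close> is freely generated by \<open>x\<close> as a module over \<open>\<int>/m\<close>, where \<open>\<int>/0 = \<int>\<close>.\<close>

definition cyclic_on :: "nat \<Rightarrow> ('a, 'b) monoid_scheme \<Rightarrow> 'a \<Rightarrow> bool" where
  "cyclic_on m G x \<longleftrightarrow> group G \<and> x \<in> carrier G \<and>
    (\<lambda>j :: int. x [^]\<^bsub>G\<^esub> j) \<in> iso (integer_mod_group m) G"

end

theory Submission
  imports Defs "HOL-Algebra.Free_Abelian_Groups"
begin

text \<open>The Magnus embedding \<open>u \<mapsto> 1 + u\<close> into the tensor algebra truncated in degree two identifies the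
  commutator subgroup of the free nil group on \<open>A\<close> with the antisymmetric tensors over \<open>A\<close>. As the
  normalised chains of \<open>S\<^sup>n\<close> are concentrated in degree \<open>n\<close>, the Moore complex of \<open>S(n)\<close> above degree
  \<open>n\<close> is that of the antisymmetric tensors. A nondegenerate pair of simplices of \<open>S\<^sup>n\<close> is a lattice
  path from \<open>(0, 0)\<close> to \<open>(n, n)\<close> with unit steps east, north and diagonal, and a face map that does
  not vanish replaces two successive steps east and north, in either order, by a diagonal one. The
  antisymmetric chains on paths that start with a diagonal step form a subcomplex, which is the complex
  for \<open>n - 1\<close>. The quotient by it has the homology of \<open>S\<^sup>n\<^sup>-\<^sup>1 \<and> S\<^sup>n\<close>, generated by a shuffle product, and
  the connecting map is up to sign multiplication by \<open>2\<close> if \<open>n\<close> is even and zero if \<open>n\<close> is odd.\<close>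

section \<open>The complex of lattice paths\<close>

text \<open>Over the integers antisymmetric tensors cannot be split off by averaging, since that
  divides by 2, and the torsion in the answer reflects this defect. Instead, an antisymmetric chain
  is recovered from its coefficients on the paths that start east or diagonally; those on paths that
  start north follow by reflection. The east part is subject to no symmetry condition, which is why
  the quotient is an ordinary smash product, shifted by the first step. The factor 2 is a sign
  count. At a diagonal first step the boundary adds the coefficients for east-north and for
  north-east. For antisymmetrised shuffles of \<open>k\<close> steps in each direction, these two
  agree for even \<open>k\<close> and cancel for odd \<open>k\<close>. Hence an odd \<open>k\<close>
  creates an infinite cyclic class in the top degree for \<open>n = k\<close>; for
  \<open>n = k + 1\<close> the new top chain bounds twice that class; for larger \<open>n\<close>
  the class only receives further diagonal steps in front. An even \<open>k\<close> creates no
  class, because its top chain is not a cycle.\<close>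

type_synonym step = "bool \<times> bool"

abbreviation east :: step where "east \<equiv> (True, False)"
abbreviation north :: step where "north \<equiv> (False, True)"
abbreviation diagonal :: step where "diagonal \<equiv> (True, True)"

text \<open>A path is degenerate if it contains the step \<open>(False, False)\<close>; the degree of a path is its length.\<close>

definition path_chains :: "nat \<Rightarrow> nat \<Rightarrow> nat \<Rightarrow> (step list \<Rightarrow> int) set" where
  "path_chains a b q = {f. \<forall>w. f w \<noteq> 0 \<longrightarrow> length w = q \<and> (False, False) \<notin> set w \<and>
    length (filter fst w) = a \<and> length (filter snd w) = b}"

text \<open>The second argument is a chain, given by its coefficients, and the first one the path at which
  the coefficient of the boundary is taken.\<close>

primrec path_bd :: "step list \<Rightarrow> (step list \<Rightarrow> int) \<Rightarrow> int" where
  "path_bd [] f = 0"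
| "path_bd (x # w) f = - path_bd w (\<lambda>u. f (x # u)) -
    (if x = diagonal then f (east # north # w) + f (north # east # w) else 0)"

definition prepend :: "step \<Rightarrow> (step list \<Rightarrow> int) \<Rightarrow> step list \<Rightarrow> int" where
  "prepend x f w = (case w of [] \<Rightarrow> 0 | y # u \<Rightarrow> if y = x then f u else 0)"

text \<open>A north step is moved past the \<open>a\<close> east steps still to come, so the value
  is the sign of the shuffle permutation. This is the Eilenberg-Zilber product of the fundamental
  classes of spheres of dimensions \<open>a\<close> and \<open>b\<close>.\<close>

primrec shuffle :: "step list \<Rightarrow> nat \<Rightarrow> nat \<Rightarrow> int" where
  "shuffle [] a b = (if a = 0 \<and> b = 0 then 1 else 0)"
| "shuffle (x # w) a b =
    (if x = east \<and> a > 0 then shuffle w (a - 1) b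
     else if x = north \<and> b > 0 then (-1) ^ a * shuffle w a (b - 1) else 0)"

lemma prepend_simps [simp]:
  "prepend x f [] = 0" "prepend x f (y # u) = (if y = x then f u else 0)"
  by (simp_all add: prepend_def)

lemma path_bd_add: "path_bd w (\<lambda>u. f u + g u) = path_bd w f + path_bd w g"
  by (induction w arbitrary: f g) auto

lemma path_bd_mult: "path_bd w (\<lambda>u. c * f u) = c * path_bd w f"
  by (induction w arbitrary: f) (auto simp: algebra_simps)

lemma path_bd_zero [simp]: "path_bd w (\<lambda>u. 0) = 0"
  by (induction w) auto

lemma path_bd_uminus: "path_bd w (\<lambda>u. - f u) = - path_bd w f"
  using path_bd_mult[of w "-1" f] by simp

lemma path_bd_diff: "path_bd w (\<lambda>u. f u - g u) = path_bd w f - path_bd w g"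
  using path_bd_add[of w f "\<lambda>u. - g u"] by (simp add: path_bd_uminus)

lemmas path_bd_linear = path_bd_add path_bd_diff path_bd_uminus path_bd_mult

text \<open>Only a diagonal first step needs an argument. It can be split before or after a split in
  the tail; the first order puts one more letter in front of the tail, so the two orders have
  opposite signs. The letters east and north cannot be split again.\<close>

lemma path_bd_bd: "path_bd w (\<lambda>u. path_bd u f) = 0"
proof (induction w arbitrary: f)
  case (Cons x w)
  then show ?case by (cases "x = diagonal") (simp_all add: path_bd_linear)
qed simp

lemma path_bd_swap: "path_bd (map prod.swap w) f = path_bd w (\<lambda>u. f (map prod.swap u))"
proof (induction w arbitrary: f)
  case (Cons x w)
  then show ?case by (cases x) auto
qed simp

lemma path_chainsD:
  assumes "f \<in> path_chains a b q" "f w \<noteq> 0"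
  shows "length w = q" "(False, False) \<notin> set w" "length (filter fst w) = a" "length (filter snd w) = b"
  using assms by (auto simp: path_chains_def)

lemma path_chains_lin:
  assumes "f \<in> path_chains a b q" "g \<in> path_chains a b q"
  shows "(\<lambda>w. f w + g w) \<in> path_chains a b q" "(\<lambda>w. c * f w) \<in> path_chains a b q"
    "(\<lambda>w. - f w) \<in> path_chains a b q" "(\<lambda>w. f w - g w) \<in> path_chains a b q"
  using assms unfolding path_chains_def mem_Collect_eq
  by (metis add_0 mult_eq_0_iff neg_equal_0_iff_equal diff_0_right)+

lemma path_chains_zero: "(\<lambda>w. 0) \<in> path_chains a b q"
  by (simp add: path_chains_def)

lemma path_chains_tail:
  assumes "f \<in> path_chains a b (Suc q)"
  shows "(\<lambda>w. f (east # w)) \<in> path_chains (a - 1) b q"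
    "(\<lambda>w. f (north # w)) \<in> path_chains a (b - 1) q"
    "(\<lambda>w. f (diagonal # w)) \<in> path_chains (a - 1) (b - 1) q"
proof -
  have "length w = Suc q \<and> (False, False) \<notin> set w \<and>
    length (filter fst w) = a \<and> length (filter snd w) = b" if "f w \<noteq> 0" for w
    using path_chainsD[OF assms that] by blast
  then show "(\<lambda>w. f (east # w)) \<in> path_chains (a - 1) b q"
    "(\<lambda>w. f (north # w)) \<in> path_chains a (b - 1) q"
    "(\<lambda>w. f (diagonal # w)) \<in> path_chains (a - 1) (b - 1) q"
    unfolding path_chains_def by fastforce+
qed

lemma path_chains_outside:
  assumes "f \<in> path_chains a b q"
  shows "f ((False, False) # w) = 0" "q > 0 \<Longrightarrow> f [] = 0"
    "a = 0 \<Longrightarrow> f (east # w) = 0" "b = 0 \<Longrightarrow> f (north # w) = 0"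
    "a = 0 \<or> b = 0 \<Longrightarrow> f (diagonal # w) = 0"
  using path_chainsD[OF assms] by force+

lemma length_le_steps:
  "(False, False) \<notin> set w \<Longrightarrow> length w \<le> length (filter fst w) + length (filter snd w)"
proof (induction w)
  case (Cons x w)
  then show ?case by (cases x) auto
qed simp

lemma path_chains_long: "f \<in> path_chains a b q \<Longrightarrow> a + b < q \<Longrightarrow> f w = 0"
  using path_chainsD[of f a b q w] length_le_steps[of w] by force

lemma path_chains_prepend:
  "f \<in> path_chains a b q \<Longrightarrow> prepend east f \<in> path_chains (Suc a) b (Suc q)"
  "f \<in> path_chains a b q \<Longrightarrow> prepend north f \<in> path_chains a (Suc b) (Suc q)"
  "f \<in> path_chains a b q \<Longrightarrow> prepend diagonal f \<in> path_chains (Suc a) (Suc b) (Suc q)"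
  unfolding path_chains_def by (auto simp: prepend_def split: list.splits)

lemma step_cases:
  obtains "x = (False, False)" | "x = east" | "x = north" | "x = diagonal"
  by (metis surj_pair)

text \<open>The witness \<open>u\<close> splits one diagonal step of \<open>w\<close> into two unit
  steps. This keeps the end point and adds one to the length, so the boundary of a chain lies in the
  expected \<open>path_chains\<close>.\<close>

lemma path_bd_nonzero:
  assumes "path_bd w f \<noteq> 0"
  obtains u where "f u \<noteq> 0" "length u = Suc (length w)" "(False, False) \<notin> set u \<Longrightarrow> (False, False) \<notin> set w"
    "length (filter fst u) = length (filter fst w)" "length (filter snd u) = length (filter snd w)"
  using assms
proof (induction w arbitrary: f thesis)
  case (Cons x w)
  show ?case
  proof (cases "path_bd w (\<lambda>u. f (x # u)) = 0")
    case True
    then have x: "x = diagonal" "f (east # north # w) \<noteq> 0 \<or> f (north # east # w) \<noteq> 0"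
      using Cons.prems(2) by (auto split: if_splits)
    then show ?thesis
      using Cons.prems(1)[of "east # north # w"] Cons.prems(1)[of "north # east # w"] by auto
  next
    case False
    show ?thesis
      by (rule Cons.IH[OF _ False], rule_tac u = "x # u" in Cons.prems(1)) auto
  qed
qed simp

lemma path_chains_bd: "f \<in> path_chains a b (Suc q) \<Longrightarrow> (\<lambda>w. path_bd w f) \<in> path_chains a b q"
  unfolding path_chains_def mem_Collect_eq
  by (intro allI impI) (erule path_bd_nonzero, metis Suc_inject)

text \<open>The two ways to split a diagonal step differ by one transposition, so their signs
  cancel.\<close>

lemma path_bd_shuffle: "path_bd w (\<lambda>u. shuffle u a b) = 0"
proof (induction w arbitrary: a b)
  case (Cons x w)
  have "path_bd w (\<lambda>u. shuffle (x # u) a b) = 0"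
  proof -
    consider "x = east" "a > 0" | "x = north" "b > 0" | "\<not> (x = east \<and> a > 0)" "\<not> (x = north \<and> b > 0)"
      by blast
    then show ?thesis
    proof cases
      case 3
      then have "(\<lambda>u. shuffle (x # u) a b) = (\<lambda>u. 0)" by auto
      then show ?thesis by simp
    qed (simp_all add: Cons path_bd_mult)
  qed
  moreover have "shuffle (east # north # w) a b + shuffle (north # east # w) a b = 0"
    by (cases a; cases b) auto
  ultimately show ?case by (simp del: shuffle.simps)
qed simp

lemma shuffle_chains: "(\<lambda>w. shuffle w a b) \<in> path_chains a b (a + b)"
proof -
  have "length w = a + b \<and> (False, False) \<notin> set w \<and>
    length (filter fst w) = a \<and> length (filter snd w) = b" if "shuffle w a b \<noteq> 0" for w
    using that
  proof (induction w arbitrary: a b)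
    case (Cons x w)
    then show ?case using Cons.IH[of "a - 1" b] Cons.IH[of a "b - 1"] by (auto split: if_splits)
  qed (auto split: if_splits)
  then show ?thesis by (simp add: path_chains_def)
qed

lemma shuffle_nonzero: "\<exists>w. shuffle w a b \<noteq> 0"
proof (induction a)
  case 0
  show ?case
  proof (induction b)
    case (Suc b)
    then obtain w where "shuffle w 0 b \<noteq> 0" by blast
    then have "shuffle (north # w) 0 (Suc b) \<noteq> 0" by simp
    then show ?case by blast
  qed (auto intro: exI[of _ "[]"])
next
  case (Suc a)
  then obtain w where "shuffle w a b \<noteq> 0" by blast
  then have "shuffle (east # w) (Suc a) b \<noteq> 0" by simp
  then show ?case by blast
qed

text \<open>Reflection exchanges a block of \<open>a\<close> steps with a block of \<open>b\<close>
  steps, a permutation of sign \<open>(-1) ^ (a * b)\<close>. For \<open>a = b = k\<close> the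
  shuffle product is therefore antisymmetric if \<open>k\<close> is odd and symmetric if
  \<open>k\<close> is even.\<close>

lemma shuffle_swap: "shuffle (map prod.swap w) a b = (-1) ^ (a * b) * shuffle w b a"
proof (induction w arbitrary: a b)
  case (Cons x w)
  show ?case
    by (rule step_cases[of x]; cases a; cases b)
      (simp_all add: Cons minus_one_power_iff)
qed auto

text \<open>The complex of all paths from \<open>(0, 0)\<close> to \<open>(a, b)\<close> is the complex of normalised chains of
  \<open>S\<^sup>a \<and> S\<^sup>b\<close>.\<close>

lemma path_cycle:
  assumes "f \<in> path_chains a b q" "\<And>w. path_bd w f = 0"
  shows "(q < a + b \<longrightarrow> (\<exists>g\<in>path_chains a b (Suc q). \<forall>w. f w = path_bd w g)) \<and>
    (q = a + b \<longrightarrow> (\<exists>c. \<forall>w. f w = c * shuffle w a b))"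
  using assms
proof (induction q arbitrary: a b f)
  case 0
  have "f w = 0" if "w \<noteq> [] \<or> a + b > 0" for w
    using path_chainsD[OF 0(1), of w] that by (cases "f w = 0") auto
  note z = this
  show ?case
  proof (cases "a + b = 0")
    case True
    have "f w = f [] * shuffle w a b" for w using z[of w] True by (cases w) simp_all
    then have "\<exists>c. \<forall>w. f w = c * shuffle w a b" by blast
    then show ?thesis using True by (metis less_irrefl)
  next
    case False
    then have "f w = path_bd w (\<lambda>w. 0)" for w using z[of w] by simp
    then show ?thesis using False path_chains_zero[of a b "Suc 0"] by (metis less_irrefl)
  qed
next
  case (Suc q)
  note out = path_chains_outside[OF Suc.prems(1)] and tail = path_chains_tail[OF Suc.prems(1)]
  \<comment> \<open>The chain is split by its first letter. A merge produces only diagonal letters,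
    so the east and north parts are cycles; the diagonal part is a cycle up to the merges at the
    front.\<close>
  have cE: "path_bd w (\<lambda>u. f (east # u)) = 0" for w using Suc.prems(2)[of "east # w"] by simp
  have cN: "path_bd w (\<lambda>u. f (north # u)) = 0" for w using Suc.prems(2)[of "north # w"] by simp
  have cD: "path_bd w (\<lambda>u. f (diagonal # u)) = - f (east # north # w) - f (north # east # w)" for w
    using Suc.prems(2)[of "diagonal # w"] by simp
  have 1: "\<exists>g\<in>path_chains a b (Suc (Suc q)). \<forall>w. f w = path_bd w g" if q: "Suc q < a + b"
  proof -
    have "\<exists>g. (\<forall>w. f (east # w) = path_bd w g) \<and> prepend east g \<in> path_chains a b (Suc (Suc q))"
    proof (cases a)
      case 0
      have "prepend east (\<lambda>w. 0) = (\<lambda>w. 0)" by (auto simp: prepend_def fun_eq_iff split: list.splits)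
      then show ?thesis using 0 out(3) path_chains_zero by (intro exI[of _ "\<lambda>w. 0"]) simp
    next
      case (Suc a')
      then show ?thesis using Suc.IH[OF tail(1) cE] q path_chains_prepend(1)[of _ a' b "Suc q"] by auto
    qed
    then obtain gE where gE: "\<And>w. f (east # w) = path_bd w gE" "prepend east gE \<in> path_chains a b (Suc (Suc q))"
      by blast
    have "\<exists>g. (\<forall>w. f (north # w) = path_bd w g) \<and> prepend north g \<in> path_chains a b (Suc (Suc q))"
    proof (cases b)
      case 0
      have "prepend north (\<lambda>w. 0) = (\<lambda>w. 0)" by (auto simp: prepend_def fun_eq_iff split: list.splits)
      then show ?thesis using 0 out(4) path_chains_zero by (intro exI[of _ "\<lambda>w. 0"]) simp
    next
      case (Suc b')
      then show ?thesis using Suc.IH[OF tail(2) cN] q path_chains_prepend(2)[of _ a b' "Suc q"] by auto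
    qed
    then obtain gN where gN: "\<And>w. f (north # w) = path_bd w gN" "prepend north gN \<in> path_chains a b (Suc (Suc q))"
      by blast
    \<comment> \<open>Passing the first letter changes the sign of the boundary, so adding the
      boundary of \<open>G\<close> removes the east and north parts of \<open>f\<close>.\<close>
    define G where "G = (\<lambda>w. prepend east gE w + prepend north gN w)"
    define H where "H = (\<lambda>w. f w + path_bd w G)"
    have G: "G \<in> path_chains a b (Suc (Suc q))"
      unfolding G_def by (rule path_chains_lin(1)[OF gE(2) gN(2)])
    have H: "H \<in> path_chains a b (Suc q)"
      unfolding H_def by (rule path_chains_lin(1)[OF Suc.prems(1) path_chains_bd[OF G]])
    have Hz: "H (east # w) = 0" "H (north # w) = 0" "H ((False, False) # w) = 0" "H [] = 0" for w
      using path_chains_outside[OF H] gE(1) gN(1) by (auto simp: H_def G_def path_bd_add)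
    have HD: "H = prepend diagonal (\<lambda>u. H (diagonal # u))"
    proof
      fix w show "H w = prepend diagonal (\<lambda>u. H (diagonal # u)) w"
      proof (cases w)
        case (Cons x u)
        then show ?thesis using Hz by (cases x rule: step_cases) auto
      qed (simp add: Hz)
    qed
    have "path_bd w H = 0" for w unfolding H_def by (simp add: path_bd_add path_bd_bd Suc.prems(2))
    from this[of "diagonal # _"] have cH: "path_bd w (\<lambda>u. H (diagonal # u)) = 0" for w by (simp add: Hz)
    have "\<exists>g\<in>path_chains a b (Suc (Suc q)). \<forall>w. H w = path_bd w g"
    proof (cases "a = 0 \<or> b = 0")
      case True
      then have "prepend diagonal (\<lambda>u. H (diagonal # u)) w = 0" for w
        using path_chains_outside(5)[OF H True] by (cases w) auto
      then have "H w = 0" for w using HD by metis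
      then show ?thesis using path_chains_zero[of a b "Suc (Suc q)"] by (intro bexI[of _ "\<lambda>w. 0"]) simp_all
    next
      case False
      then obtain a' b' where ab: "a = Suc a'" "b = Suc b'" by (metis not0_implies_Suc)
      have h: "(\<lambda>u. H (diagonal # u)) \<in> path_chains a' b' q" using path_chains_tail(3)[OF H] ab by simp
      consider "q < a' + b'" | "q = a' + b'" using q ab by linarith
      then show ?thesis
      proof cases
        case 1
        then obtain g where g: "g \<in> path_chains a' b' (Suc q)" "\<And>w. H (diagonal # w) = path_bd w g"
          using Suc.IH[OF h cH] by blast
        have "H w = path_bd w (\<lambda>w. - prepend diagonal g w)" for w
          by (subst HD) (cases w, auto simp: path_bd_uminus g(2))
        moreover have "(\<lambda>w. - prepend diagonal g w) \<in> path_chains a b (Suc (Suc q))"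
          using path_chains_lin(3)[OF path_chains_prepend(3)[OF g(1)]] path_chains_prepend(3)[OF g(1)] ab by simp
        ultimately show ?thesis by blast
      next
        case 2
        then obtain c where c: "\<And>w. H (diagonal # w) = c * shuffle w a' b'"
          using Suc.IH[OF h cH] by blast
        \<comment> \<open>In this degree the induction leaves a multiple of the shuffle cycle, which
          bounds in the larger complex. The only merge at the front of \<open>K\<close> is that of
          east with north, and it returns the shuffles of \<open>a'\<close> and \<open>b'\<close>
          with the sign \<open>(-1) ^ a'\<close>.\<close>
        define K where "K = prepend east (\<lambda>w. shuffle w a' b)"
        have K: "K \<in> path_chains a b (Suc (Suc q))"
          unfolding K_def using path_chains_prepend(1)[OF shuffle_chains[of a' b]] ab 2 by simp
        have "H w = path_bd w (\<lambda>w. (- c * (-1) ^ a') * K w)" for w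
        proof (cases w)
          case (Cons x u)
          then show ?thesis unfolding path_bd_mult using Hz
            by (cases x rule: step_cases) (auto simp: K_def c path_bd_shuffle ab simp flip: power_add)
        qed (simp add: Hz)
        then show ?thesis using path_chains_lin(2)[OF K K] by blast
      qed
    qed
    then obtain g where g: "g \<in> path_chains a b (Suc (Suc q))" "\<And>w. H w = path_bd w g" by blast
    have "f w = path_bd w (\<lambda>u. g u - G u)" for w using g(2)[of w] by (simp add: H_def path_bd_diff)
    then show ?thesis using path_chains_lin(4)[OF g(1) G] by blast
  qed
  have 2: "\<exists>c. \<forall>w. f w = c * shuffle w a b" if q: "Suc q = a + b"
  proof -
    have fD: "f (diagonal # w) = 0" for w
      using out(5) path_chains_long[OF tail(3), of w] q by (cases "a = 0 \<or> b = 0") auto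
    obtain cE where E: "\<And>w. f (east # w) = (if a > 0 then cE * shuffle w (a - 1) b else 0)"
    proof (cases "a > 0")
      case True
      then show ?thesis using Suc.IH[OF tail(1) cE] q that by auto
    qed (use out(3) that in auto)
    obtain cN where N: "\<And>w. f (north # w) = (if b > 0 then cN * shuffle w a (b - 1) else 0)"
    proof (cases "b > 0")
      case True
      then show ?thesis using Suc.IH[OF tail(2) cN] q that by auto
    qed (use out(4) that in auto)
    define c where "c = (if a > 0 then cE else cN)"
    \<comment> \<open>In the top degree there are no paths with a diagonal step, so the coefficients
      for east-north and north-east must cancel. This ties the two constants together.\<close>
    have cc: "cN = (-1) ^ a * c" if "b > 0"
    proof (cases a)
      case (Suc a')
      obtain w where w: "shuffle w a' (b - 1) \<noteq> 0" using shuffle_nonzero by blast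
      have "f (east # north # w) + f (north # east # w) = 0" using cD[of w] by (simp add: fD)
      then have "(cE * (-1) ^ a' + cN) * shuffle w a' (b - 1) = 0"
        using that Suc by (simp add: E N algebra_simps)
      then show ?thesis using w Suc by (simp add: c_def add_eq_0_iff mult.commute)
    qed (simp add: c_def)
    have "f w = c * shuffle w a b" for w
    proof (cases w)
      case (Cons x u)
      then show ?thesis using out fD
        by (cases x rule: step_cases) (auto simp: E N cc, auto simp: c_def)
    qed (use out q in auto)
    then show ?thesis by blast
  qed
  show ?case using 1 2 by blast
qed

section \<open>Antisymmetric chains on lattice paths\<close>

definition alt_chains :: "nat \<Rightarrow> nat \<Rightarrow> (step list \<Rightarrow> int) set" where
  "alt_chains n q = {f \<in> path_chains n n q. \<forall>w. f (map prod.swap w) = - f w}"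

lemma alt_chains_lin:
  assumes "f \<in> alt_chains n q" "g \<in> alt_chains n q"
  shows "(\<lambda>w. f w + g w) \<in> alt_chains n q" "(\<lambda>w. c * f w) \<in> alt_chains n q"
    "(\<lambda>w. - f w) \<in> alt_chains n q" "(\<lambda>w. f w - g w) \<in> alt_chains n q"
  using assms path_chains_lin[of f n n q g] by (auto simp: alt_chains_def)

lemma alt_chains_long: "f \<in> alt_chains n q \<Longrightarrow> 2 * n < q \<Longrightarrow> f w = 0"
  using path_chains_long[of f n n q] by (simp add: alt_chains_def)

lemma alt_chains_zero: "(\<lambda>w. 0) \<in> alt_chains n q"
  by (simp add: alt_chains_def path_chains_zero)

lemma alt_chains_bd: "f \<in> alt_chains n (Suc q) \<Longrightarrow> (\<lambda>w. path_bd w f) \<in> alt_chains n q"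
  by (auto simp: alt_chains_def path_chains_bd path_bd_swap path_bd_uminus)

lemma alt_chains_tail: "f \<in> alt_chains (Suc n) (Suc q) \<Longrightarrow> (\<lambda>w. f (diagonal # w)) \<in> alt_chains n q"
  unfolding alt_chains_def using path_chains_tail(3)[of f "Suc n" "Suc n" q]
  by (auto dest: spec[of _ "diagonal # _"])

lemma alt_chains_prepend: "f \<in> alt_chains n q \<Longrightarrow> prepend diagonal f \<in> alt_chains (Suc n) (Suc q)"
proof -
  assume f: "f \<in> alt_chains n q"
  have "prepend diagonal f (map prod.swap w) = - prepend diagonal f w" for w
    using f by (cases w) (auto simp: alt_chains_def prod.swap_def)
  then show ?thesis using f path_chains_prepend(3) by (auto simp: alt_chains_def)
qed

lemma alt_chains_north: "f \<in> alt_chains n q \<Longrightarrow> f (north # w) = - f (east # map prod.swap w)"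
proof -
  assume "f \<in> alt_chains n q"
  then have "f (map prod.swap (east # map prod.swap w)) = - f (east # map prod.swap w)"
    by (simp only: alt_chains_def mem_Collect_eq)
  then show ?thesis by (simp add: comp_def)
qed

lemma swap_path:
  "length (filter fst (map prod.swap w)) = length (filter snd w)"
  "length (filter snd (map prod.swap w)) = length (filter fst w)"
  "(False, False) \<in> set (map prod.swap w) \<longleftrightarrow> (False, False) \<in> set w"
  by (induction w) auto

text \<open>The lift of a chain of the quotient by the paths with diagonal first step:
  \<open>f\<close> becomes the east part, antisymmetry dictates the north part, and the diagonal
  part is zero.\<close>

definition alternate :: "(step list \<Rightarrow> int) \<Rightarrow> step list \<Rightarrow> int" where
  "alternate f = (\<lambda>w. prepend east f w - prepend north (\<lambda>u. f (map prod.swap u)) w)"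

lemma alternate_chains: "f \<in> path_chains n (Suc n) q \<Longrightarrow> alternate f \<in> alt_chains (Suc n) (Suc q)"
proof -
  assume f: "f \<in> path_chains n (Suc n) q"
  have s: "(\<lambda>u. f (map prod.swap u)) \<in> path_chains (Suc n) n q"
    unfolding path_chains_def mem_Collect_eq
  proof (intro allI impI)
    fix w assume "f (map prod.swap w) \<noteq> 0"
    from path_chainsD[OF f this] show "length w = q \<and> (False, False) \<notin> set w \<and>
      length (filter fst w) = Suc n \<and> length (filter snd w) = n"
      unfolding swap_path length_map by blast
  qed
  have "alternate f (map prod.swap w) = - alternate f w" for w
  proof (cases w)
    case (Cons x u)
    then show ?thesis by (cases x rule: step_cases) (auto simp: alternate_def comp_def)
  qed (simp add: alternate_def)
  then show ?thesis
    using path_chains_lin(4)[OF path_chains_prepend(1)[OF f] path_chains_prepend(2)[OF s]]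
    by (auto simp: alt_chains_def alternate_def)
qed

text \<open>The class of degree \<open>n + k\<close> is carried by \<open>m = n - k\<close> diagonal steps followed by the
  antisymmetrised shuffles of \<open>k\<close> steps in each direction.\<close>

primrec eta_cycle :: "nat \<Rightarrow> nat \<Rightarrow> step list \<Rightarrow> int" where
  "eta_cycle 0 k = alternate (\<lambda>w. shuffle w (k - 1) k)"
| "eta_cycle (Suc m) k = prepend diagonal (eta_cycle m k)"

lemma eta_cycle_chains: "k > 0 \<Longrightarrow> eta_cycle m k \<in> alt_chains (m + k) (m + 2 * k)"
proof (induction m)
  case 0
  have "(\<lambda>w. shuffle w (k - 1) k) \<in> path_chains (k - 1) (Suc (k - 1)) (2 * k - 1)"
    using shuffle_chains[of "k - 1" k] 0 by (simp add: mult_2)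
  from alternate_chains[OF this] 0 show ?case by simp
next
  case (Suc m)
  then show ?case using alt_chains_prepend by simp
qed

lemma eta_cycle_nonzero: "k > 0 \<Longrightarrow> \<exists>w. eta_cycle m k w \<noteq> 0"
proof (induction m)
  case 0
  obtain w where "shuffle w (k - 1) k \<noteq> 0" using shuffle_nonzero by blast
  then have "eta_cycle 0 k (east # w) \<noteq> 0" by (simp add: alternate_def)
  then show ?case by blast
next
  case (Suc m)
  then obtain w where "eta_cycle m k w \<noteq> 0" by blast
  then have "eta_cycle (Suc m) k (diagonal # w) \<noteq> 0" by simp
  then show ?case by blast
qed

text \<open>For odd \<open>k\<close> the full shuffle product is already antisymmetric, so
  antisymmetrising its east part gives it back.\<close>

lemma shuffle_eq_eta_cycle: "odd k \<Longrightarrow> shuffle w k k = eta_cycle 0 k w"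
proof -
  assume k: "odd k"
  then have "k > 0" "(-1) ^ k = (-1 :: int)" "(-1) ^ ((k - 1) * k) = (1 :: int)"
    by (simp_all add: odd_pos)
  then show ?thesis
    by (cases w) (auto simp: alternate_def shuffle_swap)
qed

lemma path_bd_prepend_diagonal: "path_bd w (prepend diagonal f) = - prepend diagonal (\<lambda>u. path_bd u f) w"
  by (cases w) auto

text \<open>This computes the connecting map. For \<open>m = 0\<close> and \<open>k = Suc j\<close>,
  the coefficient at \<open>diagonal # u\<close> is \<open>(1 - (-1) ^ j) * shuffle u j j\<close>,
  and for odd \<open>j\<close> the shuffle is \<open>eta_cycle 0 j\<close>. Each further diagonal
  step in front contributes one sign.\<close>

lemma path_bd_eta_cycle:
  assumes "k > 0"
  shows "path_bd w (eta_cycle m k) = (if odd k then 0 else (-1) ^ m * 2 * eta_cycle (Suc m) (k - 1) w)"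
proof (induction m arbitrary: w)
  case 0
  obtain j where k: "k = Suc j" using assms by (cases k) auto
  have sw: "(\<lambda>u. shuffle (map prod.swap u) j k) = (\<lambda>u. shuffle u k j)"
    by (simp add: shuffle_swap k)
  have "path_bd w (eta_cycle 0 k) = prepend diagonal (\<lambda>u. (1 - (-1) ^ j) * shuffle u j j) w"
  proof (cases w)
    case (Cons x u)
    then show ?thesis
      by (cases x rule: step_cases)
       (auto simp: alternate_def k sw[unfolded k] path_bd_linear path_bd_shuffle algebra_simps simp del: map_map map_eq_Cons_conv)
  qed (simp add: alternate_def)
  then show ?case using k by (cases w) (auto simp: shuffle_eq_eta_cycle)
next
  case (Suc m)
  then show ?case by (cases w) (auto simp: path_bd_prepend_diagonal)
qed

text \<open>The exact sequence of the filtration, phrased for a single chain. Only the east part has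
  to be a cycle, so this applies to cycles and also to chains whose boundary is supported on paths
  that start diagonally. The bound \<open>Suc (2 * n)\<close> is the dimension of the smash product
  of spheres of dimensions \<open>n\<close> and \<open>n + 1\<close>.\<close>

lemma alt_reduce:
  assumes f: "f \<in> alt_chains (Suc n) (Suc q)" and c: "\<And>w. path_bd w (\<lambda>u. f (east # u)) = 0"
  shows "q < Suc (2 * n) \<Longrightarrow> \<exists>G\<in>alt_chains (Suc n) (Suc (Suc q)). \<exists>h\<in>alt_chains n q.
      \<forall>w. f w + path_bd w G = prepend diagonal h w"
    and "q = Suc (2 * n) \<Longrightarrow> \<exists>c. \<forall>w. f w = c * eta_cycle 0 (Suc n) w"
proof -
  have fE: "(\<lambda>w. f (east # w)) \<in> path_chains n (Suc n) q"
    using f path_chains_tail(1)[of f "Suc n" "Suc n" q] by (simp add: alt_chains_def)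
  \<comment> \<open>By antisymmetry the north part vanishes together with the east part, so only the
    diagonal part remains.\<close>
  have ext: "H w = prepend diagonal (\<lambda>u. H (diagonal # u)) w"
    if "H \<in> alt_chains (Suc n) (Suc q)" "\<And>w. H (east # w) = 0" for H w
  proof (cases w)
    case Nil
    then show ?thesis using that(1) path_chains_outside(2) by (fastforce simp: alt_chains_def)
  next
    case (Cons x u)
    then show ?thesis using that(2) alt_chains_north[OF that(1)] that(1) path_chains_outside(1)
      by (cases x rule: step_cases) (auto simp: alt_chains_def)
  qed
  show "\<exists>G\<in>alt_chains (Suc n) (Suc (Suc q)). \<exists>h\<in>alt_chains n q.
      \<forall>w. f w + path_bd w G = prepend diagonal h w" if q: "q < Suc (2 * n)"
  proof -
    obtain g where g: "g \<in> path_chains n (Suc n) (Suc q)" "\<And>w. f (east # w) = path_bd w g"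
      using path_cycle[OF fE c] q by auto
    note G = alternate_chains[OF g(1)]
    let ?H = "\<lambda>w. f w + path_bd w (alternate g)"
    have H: "?H \<in> alt_chains (Suc n) (Suc q)" by (rule alt_chains_lin(1)[OF f alt_chains_bd[OF G]])
    have "?H (east # w) = 0" for w by (simp add: g(2) alternate_def)
    from ext[OF H this] show ?thesis using G alt_chains_tail[OF H] by blast
  qed
  show "\<exists>c. \<forall>w. f w = c * eta_cycle 0 (Suc n) w" if q: "q = Suc (2 * n)"
  proof -
    obtain d where d: "\<And>w. f (east # w) = d * shuffle w n (Suc n)"
      using path_cycle[OF fE c] q by auto
    have e: "eta_cycle 0 (Suc n) \<in> alt_chains (Suc n) (Suc q)"
      using eta_cycle_chains[of "Suc n" 0] q by simp
    let ?H = "\<lambda>w. f w - d * eta_cycle 0 (Suc n) w"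
    have H: "?H \<in> alt_chains (Suc n) (Suc q)"
      by (rule alt_chains_lin(4)[OF f alt_chains_lin(2)[OF e e]])
    have "?H (east # w) = 0" for w by (simp add: d alternate_def)
    from ext[OF H this] have *: "?H w = prepend diagonal (\<lambda>u. ?H (diagonal # u)) w" for w .
    \<comment> \<open>After the diagonal step at most \<open>2 * n\<close> steps can follow, which
      is less than \<open>q\<close>.\<close>
    have "?H (diagonal # u) = 0" for u
      using alt_chains_long[OF alt_chains_tail[OF H]] q by simp
    then have "?H w = 0" for w using *[of w] by (cases w) (auto simp del: eta_cycle.simps)
    then have "f w = d * eta_cycle 0 (Suc n) w" for w by simp
    then show ?thesis by blast
  qed
qed

text \<open>Induction on \<open>n\<close> with \<open>k\<close> fixed. Below the top degree
  \<open>alt_reduce\<close> leaves a diagonal step followed by a cycle for the smaller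
  \<open>n\<close>. In the top degree the chain is a multiple of \<open>eta_cycle 0 k\<close>, and
  the boundary of that chain decides whether a nonzero multiple can be a cycle.\<close>

theorem alt_cycle:
  assumes "k > 0" "f \<in> alt_chains n (n + k)" "\<And>w. path_bd w f = 0"
  shows "\<exists>c. \<exists>g\<in>alt_chains n (Suc (n + k)).
    \<forall>w. f w = (if odd k \<and> k \<le> n then c * eta_cycle (n - k) k w else 0) + path_bd w g"
  using assms
proof (induction n arbitrary: f)
  case 0
  then have "f w = 0" for w using alt_chains_long[of f 0 k] by simp
  then show ?case using 0 alt_chains_zero by (intro exI[of _ 0] bexI[of _ "\<lambda>w. 0"]) auto
next
  case (Suc n)
  note f = Suc.prems(2)[unfolded add_Suc] and z = alt_chains_zero[of "Suc n" "Suc (Suc n + k)"]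
  have c: "path_bd w (\<lambda>u. f (east # u)) = 0" for w using Suc.prems(3)[of "east # w"] by simp
  consider "k > Suc n" | "k = Suc n" | "k \<le> n" by linarith
  then show ?case
  proof cases
    case 1
    then have "f w = 0" for w using alt_chains_long[OF f] by simp
    then show ?thesis using 1 z by (intro exI[of _ 0] bexI[of _ "\<lambda>w. 0"]) auto
  next
    case 2
    then obtain d where d: "\<And>w. f w = d * eta_cycle 0 k w" using alt_reduce(2)[OF f c] by auto
    show ?thesis
    proof (cases "odd k")
      case True
      then show ?thesis using 2 z d by (intro exI[of _ d] bexI[of _ "\<lambda>w. 0"]) auto
    next
      case False
      \<comment> \<open>A positive even \<open>k\<close> is at least 2, so
        \<open>eta_cycle 1 (k - 1)\<close> is nonzero and a vanishing boundary forces
        \<open>d = 0\<close>.\<close>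
      then have "k - 1 > 0" using Suc.prems(1) by (cases k) (auto elim: oddE)
      then obtain w where w: "eta_cycle 1 (k - 1) w \<noteq> 0" using eta_cycle_nonzero by blast
      have "f = (\<lambda>w. d * eta_cycle 0 k w)" using d by blast
      then have "path_bd w f = d * (2 * eta_cycle 1 (k - 1) w)"
        using path_bd_eta_cycle[OF Suc.prems(1), of w 0] False by (simp add: path_bd_mult del: eta_cycle.simps)
      then have "d = 0" using Suc.prems(3)[of w] w by simp
      then show ?thesis using d False z by (intro exI[of _ 0] bexI[of _ "\<lambda>w. 0"]) auto
    qed
  next
    case 3
    then obtain G h where G: "G \<in> alt_chains (Suc n) (Suc (Suc (n + k)))" and h: "h \<in> alt_chains n (n + k)"
      and e: "\<And>w. f w + path_bd w G = prepend diagonal h w"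
      using alt_reduce(1)[OF f c] by auto
    have "path_bd w h = 0" for w
    proof -
      have "path_bd w' (\<lambda>w. f w + path_bd w G) = 0" for w' using Suc.prems(3) by (simp add: path_bd_add path_bd_bd)
      then have "path_bd (diagonal # w) (prepend diagonal h) = 0" by (simp only: e)
      then show ?thesis by simp
    qed
    from Suc.IH[OF Suc.prems(1) h this] obtain c g where g: "g \<in> alt_chains n (Suc (n + k))"
      and hg: "\<And>w. h w = (if odd k \<and> k \<le> n then c * eta_cycle (n - k) k w else 0) + path_bd w g" by blast
    \<comment> \<open>The sign is needed because putting a diagonal step in front anticommutes with
      the boundary.\<close>
    let ?g = "\<lambda>w. - prepend diagonal g w - G w"
    have "?g \<in> alt_chains (Suc n) (Suc (Suc n + k))"
      using alt_chains_lin(4)[OF alt_chains_lin(3)] alt_chains_prepend[OF g] G by simp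
    moreover have "f w = (if odd k \<and> k \<le> Suc n then c * eta_cycle (Suc n - k) k w else 0) + path_bd w ?g" for w
    proof -
      have "f w = prepend diagonal h w - path_bd w G" using e[of w] by simp
      also have "prepend diagonal h w =
        (if odd k \<and> k \<le> Suc n then c * eta_cycle (Suc n - k) k w else 0) + prepend diagonal (\<lambda>u. path_bd u g) w"
        using 3 by (cases w) (auto simp: hg Suc_diff_le)
      finally show ?thesis by (simp add: path_bd_linear path_bd_prepend_diagonal)
    qed
    ultimately show ?thesis by blast
  qed
qed

text \<open>For \<open>k = n\<close> there are no chains above the top degree. For
  \<open>k < n\<close> the cycle starts with a diagonal step, so the east part of \<open>g\<close>
  is a cycle and \<open>g\<close> can be reduced until \<open>n = k + 1\<close>. There
  \<open>g\<close> has top degree and is a multiple of \<open>eta_cycle 0 (k + 1)\<close>, whose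
  boundary is twice the generator.\<close>

theorem eta_cycle_boundary:
  assumes "odd k" "k \<le> n" "g \<in> alt_chains n (Suc (n + k))" "\<And>w. c * eta_cycle (n - k) k w = path_bd w g"
  shows "if k = n then c = 0 else even c"
proof -
  have k: "k > 0" using assms(1) by (cases k) auto
  show ?thesis
  proof (cases "k = n")
    case True
    then have "g = (\<lambda>w. 0)" using alt_chains_long[OF assms(3)] by auto
    then have "c * eta_cycle (n - k) k w = 0" for w using assms(4)[of w] by simp
    moreover obtain w where "eta_cycle (n - k) k w \<noteq> 0" using eta_cycle_nonzero[OF k] by blast
    ultimately show ?thesis using True by auto
  next
    case False
    then have "k < n" using assms(2) by simp
    then have "even c" using assms(3,4)
    proof (induction n arbitrary: g c)
      case (Suc n)
      have E: "path_bd w (\<lambda>u. g (east # u)) = 0" for w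
        using Suc.prems(1) Suc.prems(3)[of "east # w"] by (simp add: Suc_diff_le)
      note g = Suc.prems(2)[unfolded add_Suc]
      show ?case
      proof (cases "k = n")
        case True
        then obtain d where d: "\<And>w. g w = d * eta_cycle 0 (Suc n) w" using alt_reduce(2)[OF g E] by auto
        then have "g = (\<lambda>w. d * eta_cycle 0 (Suc n) w)" by blast
        then have "path_bd w g = d * (2 * eta_cycle 1 n w)" for w
          using path_bd_eta_cycle[of "Suc n" w 0] True assms(1) by (simp add: path_bd_mult del: eta_cycle.simps)
        then have *: "(c - 2 * d) * eta_cycle 1 n w = 0" for w
          using Suc.prems(3)[of w] True by (simp add: algebra_simps)
        obtain w where "eta_cycle 1 n w \<noteq> 0" using eta_cycle_nonzero[of n 1] k True by blast
        then have "c = 2 * d" using *[of w] by simp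
        then show ?thesis by simp
      next
        case False
        then have kn: "k < n" using Suc.prems(1) by simp
        then obtain G h where h: "h \<in> alt_chains n (Suc (n + k))"
          and e: "\<And>w. g w + path_bd w G = prepend diagonal h w"
          using alt_reduce(1)[OF g E] by auto
        have "c * eta_cycle (n - k) k w = path_bd w (\<lambda>w. - h w)" for w
        proof -
          have "path_bd (diagonal # w) g = path_bd (diagonal # w) (\<lambda>w. g w + path_bd w G)" by (simp only: path_bd_add path_bd_bd add_0_right)
          also have "\<dots> = - path_bd w h" by (simp only: e) simp
          finally show ?thesis using Suc.prems(3)[of "diagonal # w"] kn by (simp add: Suc_diff_le path_bd_uminus)
        qed
        then show ?thesis using Suc.IH[OF kn] alt_chains_lin(3)[OF h h] by blast
      qed
    qed simp
    then show ?thesis using False by simp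
  qed
qed

section \<open>Moore normalisation of the chains on pairs of simplices\<close>

text \<open>The additive analogue of \<open>free_map\<close>: values outside \<open>B\<close> stand
  for the base point and are sent to zero.\<close>

definition push :: "'b set \<Rightarrow> ('a \<Rightarrow> 'b) \<Rightarrow> ('a \<Rightarrow>\<^sub>0 int) \<Rightarrow> ('b \<Rightarrow>\<^sub>0 int)" where
  "push B f = frag_extend (\<lambda>x. if f x \<in> B then frag_of (f x) else 0)"

lemma push_0 [simp]: "push B f 0 = 0"
  and push_of [simp]: "push B f (frag_of x) = (if f x \<in> B then frag_of (f x) else 0)"
  and push_add: "push B f (a + b) = push B f a + push B f b"
  and push_diff: "push B f (a - b) = push B f a - push B f b"
  and push_uminus: "push B f (- a) = - push B f a"
  and push_cmul: "push B f (frag_cmul k a) = frag_cmul k (push B f a)"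
  by (simp_all add: push_def frag_extend_add frag_extend_diff frag_extend_minus frag_extend_cmul)

lemma push_sum: "finite I \<Longrightarrow> push B f (\<Sum>i\<in>I. g i) = (\<Sum>i\<in>I. push B f (g i))"
  by (simp add: push_def frag_extend_sum comp_def)

lemma keys_push: "Poly_Mapping.keys (push B f c) \<subseteq> f ` Poly_Mapping.keys c \<inter> B"
  unfolding push_def using keys_frag_extend[of "\<lambda>x. if f x \<in> B then frag_of (f x) else 0" c]
  by (fastforce split: if_splits)

lemma keys_push_subset: "Poly_Mapping.keys (push B f c) \<subseteq> B"
  using keys_push by fast

lemma push_push:
  assumes "Poly_Mapping.keys c \<subseteq> A" "\<And>x. x \<in> A \<Longrightarrow> f x \<notin> B \<Longrightarrow> g (f x) \<notin> C"
  shows "push C g (push B f c) = push C (\<lambda>x. g (f x)) c"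
  using assms(1) by (induction rule: frag_induction) (auto simp: push_diff dest: assms(2))

lemma push_cong:
  assumes "Poly_Mapping.keys c \<subseteq> A" "\<And>x. x \<in> A \<Longrightarrow> f x = g x"
  shows "push B f c = push B g c"
  using assms(1) by (induction rule: frag_induction) (auto simp: push_diff dest: assms(2))

lemma push_id: "Poly_Mapping.keys c \<subseteq> B \<Longrightarrow> push B (\<lambda>x. x) c = c"
  by (induction rule: frag_induction) (auto simp: push_diff)

lemma keys_sum_subset:
  "(\<And>i. i \<in> I \<Longrightarrow> Poly_Mapping.keys (f i) \<subseteq> S) \<Longrightarrow> Poly_Mapping.keys (\<Sum>i\<in>I. f i) \<subseteq> S"
  for f :: "'i \<Rightarrow> 'a \<Rightarrow>\<^sub>0 int"
  using sum_closed_free_Abelian_group[of I f S] by simp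

lemma keys_diff_subset:
  "Poly_Mapping.keys a \<subseteq> S \<Longrightarrow> Poly_Mapping.keys b \<subseteq> S \<Longrightarrow> Poly_Mapping.keys (a - b) \<subseteq> S"
  for a :: "'a \<Rightarrow>\<^sub>0 int"
  using keys_diff[of a b] by blast

definition sphere_pairs :: "nat \<Rightarrow> nat \<Rightarrow> (nat list \<times> nat list) set" where
  "sphere_pairs n q = sphere_simplices n q \<times> sphere_simplices n q"

definition pair_face :: "nat \<Rightarrow> nat \<Rightarrow> nat \<Rightarrow> (nat list \<times> nat list \<Rightarrow>\<^sub>0 int) \<Rightarrow> (nat list \<times> nat list \<Rightarrow>\<^sub>0 int)" where
  "pair_face n q i = push (sphere_pairs n q) (map_prod (del_vertex i) (del_vertex i))"

definition pair_degen :: "nat \<Rightarrow> nat \<Rightarrow> nat \<Rightarrow> (nat list \<times> nat list \<Rightarrow>\<^sub>0 int) \<Rightarrow> (nat list \<times> nat list \<Rightarrow>\<^sub>0 int)" where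
  "pair_degen n q i = push (sphere_pairs n (Suc q)) (map_prod (dup_vertex i) (dup_vertex i))"

lemmas pair_linear = push_add push_diff push_uminus push_cmul push_sum

lemma keys_pair_face: "Poly_Mapping.keys (pair_face n q i c) \<subseteq> sphere_pairs n q"
  and keys_pair_degen: "Poly_Mapping.keys (pair_degen n q i c) \<subseteq> sphere_pairs n (Suc q)"
  unfolding pair_face_def pair_degen_def by (rule keys_push_subset)+

lemma pair_face_comp:
  assumes "Poly_Mapping.keys c \<subseteq> sphere_pairs n (Suc q)" "i \<le> Suc q" "\<And>w. set (g w) \<subseteq> set w"
  shows "push (sphere_pairs n p) (map_prod g g) (pair_face n q i c)
    = push (sphere_pairs n p) (map_prod (\<lambda>v. g (del_vertex i v)) (\<lambda>v. g (del_vertex i v))) c"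
proof -
  have "push (sphere_pairs n p) (map_prod g g) (pair_face n q i c)
    = push (sphere_pairs n p) (\<lambda>x. map_prod g g (map_prod (del_vertex i) (del_vertex i) x)) c"
    unfolding pair_face_def
    by (rule push_push[OF assms(1)])
      (auto simp: sphere_pairs_def dest: sphere_del_outside[OF _ assms(2) _ assms(3)])
  also have "(\<lambda>x. map_prod g g (map_prod (del_vertex i) (del_vertex i) x))
    = map_prod (\<lambda>v. g (del_vertex i v)) (\<lambda>v. g (del_vertex i v))" by auto
  finally show ?thesis .
qed

lemma pair_degen_comp:
  assumes "Poly_Mapping.keys c \<subseteq> sphere_pairs n q" "i \<le> q"
  shows "push B (map_prod g g) (pair_degen n q i c)
    = push B (map_prod (\<lambda>v. g (dup_vertex i v)) (\<lambda>v. g (dup_vertex i v))) c"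
proof -
  have "push B (map_prod g g) (pair_degen n q i c)
    = push B (\<lambda>x. map_prod g g (map_prod (dup_vertex i) (dup_vertex i) x)) c"
    unfolding pair_degen_def
    by (rule push_push[OF assms(1)])
      (use sphere_simplices_dup[OF _ assms(2)] in \<open>auto simp: sphere_pairs_def\<close>)
  also have "(\<lambda>x. map_prod g g (map_prod (dup_vertex i) (dup_vertex i) x))
    = map_prod (\<lambda>v. g (dup_vertex i v)) (\<lambda>v. g (dup_vertex i v))" by auto
  finally show ?thesis .
qed

lemma push_pair_cong:
  assumes "Poly_Mapping.keys c \<subseteq> sphere_pairs n q"
    and "\<And>v. v \<in> sphere_simplices n q \<Longrightarrow> length v = Suc q \<Longrightarrow> f v = g v"
  shows "push B (map_prod f f) c = push B (map_prod g g) c"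
  by (rule push_cong[OF assms(1)]) (auto simp: sphere_pairs_def sphere_simplices_def assms(2))

lemmas pair_comp = pair_face_comp[OF _ _ set_del_vertex] pair_degen_comp
  pair_face_comp[OF _ _ equalityD1[OF set_dup_vertex]]

lemma pair_face_face:
  assumes "Poly_Mapping.keys c \<subseteq> sphere_pairs n (Suc (Suc q))" "i < j" "j \<le> Suc (Suc q)"
  shows "pair_face n q i (pair_face n (Suc q) j c) = pair_face n q (j - 1) (pair_face n (Suc q) i c)"
proof -
  have "i \<le> Suc (Suc q)" using assms by simp
  then show ?thesis
    using assms unfolding pair_face_def[of n q]
    by (simp add: pair_comp) (rule push_pair_cong, assumption, simp add: del_del_vertex)
qed

lemma pair_face_degen_greater:
  assumes "Poly_Mapping.keys c \<subseteq> sphere_pairs n (Suc q)" "j \<le> Suc q" "Suc j < i" "i \<le> Suc (Suc q)"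
  shows "pair_face n (Suc q) i (pair_degen n (Suc q) j c) = pair_degen n q j (pair_face n q (i - 1) c)"
proof -
  have "i - 1 \<le> Suc q" using assms by simp
  then show ?thesis
    using assms unfolding pair_face_def[of n "Suc q"] pair_degen_def[of n q]
    by (simp add: pair_comp) (rule push_pair_cong, assumption, simp add: del_dup_vertex_greater)
qed

lemma pair_face_degen_same:
  assumes "Poly_Mapping.keys c \<subseteq> sphere_pairs n q" "j \<le> q" "i = j \<or> i = Suc j"
  shows "pair_face n q i (pair_degen n q j c) = c"
proof -
  have "pair_face n q i (pair_degen n q j c) = push (sphere_pairs n q) (map_prod (\<lambda>v. v) (\<lambda>v. v)) c"
    using assms unfolding pair_face_def
    by (simp add: pair_comp del: map_prod_ident) (rule push_pair_cong, assumption, auto simp: del_dup_vertex_same)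
  then show ?thesis using push_id[OF assms(1)] by simp
qed

lemma pair_degen_degen:
  assumes "Poly_Mapping.keys c \<subseteq> sphere_pairs n q" "i \<le> j" "j \<le> q"
  shows "pair_degen n (Suc q) i (pair_degen n q j c) = pair_degen n (Suc q) (Suc j) (pair_degen n q i c)"
proof -
  have "i \<le> q" using assms by simp
  then show ?thesis
    using assms unfolding pair_degen_def[of n "Suc q"]
    by (simp add: pair_comp) (rule push_pair_cong, assumption, simp add: dup_dup_vertex)
qed

definition pair_moore :: "nat \<Rightarrow> nat \<Rightarrow> (nat list \<times> nat list \<Rightarrow>\<^sub>0 int) set" where
  "pair_moore n q = {t. Poly_Mapping.keys t \<subseteq> sphere_pairs n q \<and>
    (\<forall>i. 0 < i \<and> i \<le> q \<longrightarrow> pair_face n (q - 1) i t = 0)}"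

text \<open>Each component may be degenerate on its own; only a repetition at a common place makes
  the pair a degenerate simplex of the product.\<close>

definition degenerate_pairs :: "nat \<Rightarrow> nat \<Rightarrow> (nat list \<times> nat list) set" where
  "degenerate_pairs n q = {(u, v) \<in> sphere_pairs n q. \<exists>j<q. u ! j = u ! Suc j \<and> v ! j = v ! Suc j}"

lemma degenerate_pairE:
  assumes "p \<in> degenerate_pairs n (Suc r)"
  obtains j p' where "j \<le> r" "p' \<in> sphere_pairs n r" "p = map_prod (dup_vertex j) (dup_vertex j) p'"
proof -
  obtain u v j where p: "p = (u, v)" "u \<in> sphere_simplices n (Suc r)" "v \<in> sphere_simplices n (Suc r)"
    and j: "j \<le> r" "u ! j = u ! Suc j" "v ! j = v ! Suc j"
    using assms by (auto simp: degenerate_pairs_def sphere_pairs_def less_Suc_eq_le)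
  note u = sphere_del_repeat[OF p(2) j(1,2)] and v = sphere_del_repeat[OF p(3) j(1,3)]
  show ?thesis
    by (rule that[OF j(1), of "(del_vertex j u, del_vertex j v)"]) (simp_all add: p(1) u v sphere_pairs_def)
qed

lemma dup_degenerate:
  assumes "p \<in> sphere_pairs n r" "j \<le> r"
  shows "map_prod (dup_vertex j) (dup_vertex j) p \<in> degenerate_pairs n (Suc r)"
  using assms sphere_simplices_dup[OF _ assms(2)]
  by (auto simp: degenerate_pairs_def sphere_pairs_def sphere_simplices_def nth_dup_vertex intro!: exI[of _ j])

lemma keys_pair_degen_degenerate:
  assumes "Poly_Mapping.keys c \<subseteq> sphere_pairs n r" "j \<le> r"
  shows "Poly_Mapping.keys (pair_degen n r j c) \<subseteq> degenerate_pairs n (Suc r)"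
proof -
  have "map_prod (dup_vertex j) (dup_vertex j) ` Poly_Mapping.keys c \<subseteq> degenerate_pairs n (Suc r)"
    by (rule image_subsetI) (rule dup_degenerate[OF subsetD[OF assms(1)] assms(2)])
  then show ?thesis unfolding pair_degen_def using keys_push by fast
qed

lemma degenerate_sum:
  assumes "Poly_Mapping.keys t \<subseteq> degenerate_pairs n (Suc r)"
  shows "\<exists>y. (\<forall>j. Poly_Mapping.keys (y j) \<subseteq> sphere_pairs n r) \<and> t = (\<Sum>j\<le>r. pair_degen n r j (y j))"
  using assms
proof (induction rule: frag_induction)
  case zero
  then show ?case by (intro exI[of _ "\<lambda>_. 0"]) (simp add: pair_degen_def)
next
  case (one p)
  then obtain j p' where j: "j \<le> r" "p' \<in> sphere_pairs n r" "p = map_prod (dup_vertex j) (dup_vertex j) p'"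
    by (rule degenerate_pairE)
  let ?y = "\<lambda>i. if i = j then frag_of p' else 0"
  have "(\<Sum>i\<le>r. pair_degen n r i (?y i)) = (\<Sum>i\<le>r. if i = j then frag_of p else 0)"
    using j dup_degenerate[OF j(2,1)]
    by (intro sum.cong) (auto simp: pair_degen_def degenerate_pairs_def)
  also have "\<dots> = frag_of p" using j(1) by simp
  finally show ?case using j(2) by (intro exI[of _ ?y]) auto
next
  case (diff a b)
  then obtain y z where yz: "\<forall>j. Poly_Mapping.keys (y j) \<subseteq> sphere_pairs n r"
      "\<forall>j. Poly_Mapping.keys (z j) \<subseteq> sphere_pairs n r"
    and ab: "a = (\<Sum>j\<le>r. pair_degen n r j (y j))" "b = (\<Sum>j\<le>r. pair_degen n r j (z j))" by blast
  have "a - b = (\<Sum>j\<le>r. pair_degen n r j (y j - z j))"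
    unfolding ab by (simp add: pair_degen_def push_diff sum_subtractf)
  moreover have "\<forall>j. Poly_Mapping.keys (y j - z j) \<subseteq> sphere_pairs n r"
    using keys_diff_subset yz by metis
  ultimately show ?case by (intro exI[of _ "\<lambda>j. y j - z j"]) simp
qed

text \<open>The largest index of a degeneracy can be lowered. Applying the face \<open>m + 1\<close>
  expresses \<open>y m\<close> by the other terms; then \<open>d_(m+1) s_j = s_j d_m\<close> and
  \<open>s_m s_j = s_j s_(m-1)\<close> for \<open>j < m\<close> turn the last summand into a
  combination of degeneracies with smaller index.\<close>

lemma moore_degenerate_sum:
  assumes "\<And>i. 0 < i \<Longrightarrow> i \<le> Suc r \<Longrightarrow> pair_face n r i t = 0" "m \<le> Suc r"
    and "t = (\<Sum>j<m. pair_degen n r j (y j))" "\<And>j. Poly_Mapping.keys (y j) \<subseteq> sphere_pairs n r"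
  shows "t = 0"
  using assms(2-)
proof (induction m arbitrary: y)
  case (Suc m)
  have *: "pair_face n r (Suc m) (pair_degen n r m (y m)) = y m"
    using Suc.prems by (intro pair_face_degen_same) auto
  have "pair_face n r (Suc m) t = 0" using assms(1) Suc.prems by simp
  then have ym: "y m = - (\<Sum>j<m. pair_face n r (Suc m) (pair_degen n r j (y j)))"
    unfolding Suc.prems(2) using * by (simp add: pair_face_def pair_linear eq_neg_iff_add_eq_0 add.commute)
  show ?case
  proof (cases r)
    case 0
    then have "m = 0" using Suc.prems by simp
    then show ?thesis using ym Suc.prems(2) by (simp add: pair_degen_def)
  next
    case (Suc r')
    have keys: "Poly_Mapping.keys (pair_face n r' m (y j)) \<subseteq> sphere_pairs n r'" for j by (rule keys_pair_face)
    have "pair_degen n r m (y m) =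
      - (\<Sum>j<m. pair_degen n r m (pair_face n r (Suc m) (pair_degen n r j (y j))))"
      by (subst ym) (simp add: pair_degen_def pair_linear)
    also have "(\<Sum>j<m. pair_degen n r m (pair_face n r (Suc m) (pair_degen n r j (y j)))) =
      (\<Sum>j<m. pair_degen n r j (pair_degen n r' (m - 1) (pair_face n r' m (y j))))"
    proof (rule sum.cong[OF refl])
      fix j assume "j \<in> {..<m}"
      then have j: "j < m" by simp
      have "pair_face n r (Suc m) (pair_degen n r j (y j)) = pair_degen n r' j (pair_face n r' m (y j))"
        using pair_face_degen_greater[of "y j" n r' j "Suc m"] Suc Suc.prems j by simp
      moreover have "pair_degen n r m (pair_degen n r' j (pair_face n r' m (y j))) =
          pair_degen n r j (pair_degen n r' (m - 1) (pair_face n r' m (y j)))"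
        using pair_degen_degen[OF keys[of j], of j "m - 1"] Suc Suc.prems(1) j by simp
      ultimately show "pair_degen n r m (pair_face n r (Suc m) (pair_degen n r j (y j))) =
          pair_degen n r j (pair_degen n r' (m - 1) (pair_face n r' m (y j)))" by simp
    qed
    finally have "t = (\<Sum>j<m. pair_degen n r j (y j - pair_degen n r' (m - 1) (pair_face n r' m (y j))))"
      unfolding Suc.prems(2) by (simp add: pair_degen_def pair_linear sum_subtractf)
    then show ?thesis
      using Suc.IH[of "\<lambda>j. y j - pair_degen n r' (m - 1) (pair_face n r' m (y j))"] Suc.prems
        keys_pair_degen[of n r'] Suc by (simp add: keys_diff_subset)
  qed
qed simp

lemma moore_degenerate_zero:
  assumes "t \<in> pair_moore n (Suc r)" "Poly_Mapping.keys t \<subseteq> degenerate_pairs n (Suc r)"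
  shows "t = 0"
proof -
  obtain y where "\<And>j. Poly_Mapping.keys (y j) \<subseteq> sphere_pairs n r" "t = (\<Sum>j<Suc r. pair_degen n r j (y j))"
    using degenerate_sum[OF assms(2)] by (metis lessThan_Suc_atMost)
  then show ?thesis using moore_degenerate_sum[where m = "Suc r" and y = y] assms(1) by (simp add: pair_moore_def)
qed

text \<open>The classical projection to the Moore complex: for \<open>m\<close> from
  \<open>r\<close> down to 0, subtracting \<open>s_m d_(m+1) t\<close> from \<open>t\<close> kills
  the face \<open>m + 1\<close>, keeps the higher faces zero and changes the chain only by
  degenerate pairs.\<close>

lemma moore_representative:
  assumes "Poly_Mapping.keys c \<subseteq> sphere_pairs n (Suc r)"
  shows "\<exists>t\<in>pair_moore n (Suc r). Poly_Mapping.keys (t - c) \<subseteq> degenerate_pairs n (Suc r)"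
proof -
  have "\<exists>t. Poly_Mapping.keys t \<subseteq> sphere_pairs n (Suc r) \<and>
      Poly_Mapping.keys (t - c) \<subseteq> degenerate_pairs n (Suc r) \<and>
      (\<forall>i. m < i \<and> i \<le> Suc r \<longrightarrow> pair_face n r i t = 0)" if "m \<le> Suc r" for m
    using that
  proof (induction m rule: inc_induct)
    case base
    then show ?case using assms by (intro exI[of _ c]) auto
  next
    case (step m)
    then obtain t where t: "Poly_Mapping.keys t \<subseteq> sphere_pairs n (Suc r)"
      "Poly_Mapping.keys (t - c) \<subseteq> degenerate_pairs n (Suc r)"
      "\<And>i. Suc m < i \<Longrightarrow> i \<le> Suc r \<Longrightarrow> pair_face n r i t = 0" by blast
    have m: "m \<le> r" using step by simp
    let ?d = "pair_degen n r m (pair_face n r (Suc m) t)"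
    have d: "Poly_Mapping.keys ?d \<subseteq> sphere_pairs n (Suc r)"
      "Poly_Mapping.keys ?d \<subseteq> degenerate_pairs n (Suc r)"
      using keys_pair_degen keys_pair_degen_degenerate[OF keys_pair_face m] by blast+
    have "pair_face n r i (t - ?d) = 0" if i: "m < i" "i \<le> Suc r" for i
    proof (cases "i = Suc m")
      case True
      then show ?thesis
        using pair_face_degen_same[OF keys_pair_face[of n r "Suc m" t] m, of "Suc m"]
        by (simp add: pair_face_def push_diff)
    next
      case False
      then obtain r' where r: "r = Suc r'" using i m by (cases r) auto
      have "pair_face n r i ?d = pair_degen n r' m (pair_face n r' (i - 1) (pair_face n r (Suc m) t))"
        using pair_face_degen_greater[OF keys_pair_face[of n "Suc r'" "Suc m" t], of m i] i m False r by simp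
      also have "pair_face n r' (i - 1) (pair_face n r (Suc m) t) = pair_face n r' (Suc m) (pair_face n r i t)"
        using pair_face_face[of t n r' "Suc m" i] t(1) i False r by simp
      also have "pair_face n r i t = 0" using t(3) i False by simp
      finally show ?thesis using t(3) i False by (simp add: pair_face_def pair_degen_def push_diff)
    qed
    moreover have "Poly_Mapping.keys (t - ?d - c) \<subseteq> degenerate_pairs n (Suc r)"
      using keys_diff_subset[OF t(2) d(2)] by (simp add: algebra_simps)
    ultimately show ?case using keys_diff_subset[OF t(1) d(1)] by blast
  qed
  from this[of 0] show ?thesis by (auto simp: pair_moore_def)
qed

section \<open>Nondegenerate pairs as lattice paths\<close>

text \<open>\<open>True\<close> moves on to the next vertex and \<open>False\<close> repeats the
  current one. Words with \<open>n\<close> letters \<open>True\<close> thus encode the monotone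
  surjections onto \<open>{0..n}\<close>.\<close>

primrec visits :: "nat \<Rightarrow> bool list \<Rightarrow> nat list" where
  "visits a [] = [a]"
| "visits a (x # w) = a # visits (if x then Suc a else a) w"

lemma length_visits [simp]: "length (visits a w) = Suc (length w)"
  by (induction w arbitrary: a) auto

lemma set_visits: "set (visits a w) = {a..a + length (filter (\<lambda>x. x) w)}"
  by (induction w arbitrary: a) auto

lemma sorted_visits: "sorted (visits a w)"
  by (induction w arbitrary: a) (auto simp: set_visits)

lemma inj_visits: "visits a w = visits a w' \<Longrightarrow> w = w'"
proof (induction w arbitrary: a w')
  case Nil
  then show ?case by (cases w') (auto dest: arg_cong[of _ _ length])
next
  case (Cons x w)
  show ?case
  proof (cases w')
    case Nil
    then show ?thesis using Cons.prems by (auto dest: arg_cong[of _ _ length])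
  next
    case w': (Cons y u)
    have e: "visits (if x then Suc a else a) w = visits (if y then Suc a else a) u"
      using Cons.prems w' by simp
    have "hd (visits b v) = b" for b v by (cases v) auto
    then have "(if x then Suc a else a) = (if y then Suc a else a)" using e by metis
    then have "x = y" by (auto split: if_splits)
    then show ?thesis using Cons.IH e w' by simp
  qed
qed

lemma nth_visits_eq: "j < length w \<Longrightarrow> visits a w ! j = visits a w ! Suc j \<longleftrightarrow> \<not> w ! j"
proof (induction w arbitrary: a j)
  case (Cons x w)
  have "visits b w ! 0 = b" for b by (cases w) auto
  then show ?case using Cons by (cases j) auto
qed simp

text \<open>A sorted list whose values leave no gap can increase by at most 1 at each place.\<close>

lemma visits_surj: "v \<noteq> [] \<Longrightarrow> sorted v \<Longrightarrow> set v = {hd v..b} \<Longrightarrow> \<exists>w. v = visits (hd v) w"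
proof (induction v)
  case (Cons x v)
  show ?case
  proof (cases v)
    case Nil
    then show ?thesis by (intro exI[of _ "[]"]) simp
  next
    case v: (Cons y u)
    have xy: "x \<le> y" and min: "\<forall>z\<in>set v. y \<le> z" and s: "sorted v" and sv: "insert x (set v) = {x..b}"
      using Cons.prems v by auto
    have yx: "y = x \<or> y = Suc x"
    proof (rule ccontr)
      assume "\<not> ?thesis"
      then have y: "Suc x < y" using xy by simp
      have "y \<in> {x..b}" using sv v by auto
      then have "Suc x \<in> insert x (set v)" using y sv by auto
      then show False using min y by auto
    qed
    have "set v = {y..b}"
      using yx
    proof
      assume "y = x"
      then show ?thesis using sv v by auto
    next
      assume y: "y = Suc x"
      then have "x \<notin> set v" using min by auto
      then have "set v = {x..b} - {x}" using sv by (metis Diff_insert_absorb)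
      moreover have "{x..b} - {x} = {Suc x..b}" by auto
      ultimately show ?thesis using y by simp
    qed
    then obtain w where "v = visits y w" using Cons.IH s v by auto
    then have "x # v = visits x ((y \<noteq> x) # w)" using yx by auto
    then show ?thesis unfolding list.sel by blast
  qed
qed simp

lemma sphere_simplices_visits:
  "visits 0 w \<in> sphere_simplices n q \<longleftrightarrow> length w = q \<and> length (filter (\<lambda>x. x) w) = n"
  by (auto simp: sphere_simplices_def sorted_visits set_visits)

lemma sphere_simplicesE:
  assumes "v \<in> sphere_simplices n q"
  obtains w where "v = visits 0 w" "length w = q" "length (filter (\<lambda>x. x) w) = n"
proof -
  have v: "sorted v" "v \<noteq> []" "set v = {0..n}" using assms by (auto simp: sphere_simplices_def)
  have "0 \<in> set v" using v(3) by simp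
  then have "hd v \<le> 0" using v(1,2) by (cases v) auto
  then have "hd v = 0" by simp
  then obtain w where w: "v = visits 0 w" using visits_surj[OF v(2,1)] v(3) by metis
  then show ?thesis using that assms sphere_simplices_visits by blast
qed

definition walk :: "step list \<Rightarrow> nat list \<times> nat list" where
  "walk w = (visits 0 (map fst w), visits 0 (map snd w))"

lemma inj_walk: "walk w = walk w' \<longleftrightarrow> w = w'"
proof
  assume "walk w = walk w'"
  then have "map fst w = map fst w'" "map snd w = map snd w'" by (auto simp: walk_def dest: inj_visits)
  then show "w = w'" by (metis zip_map_fst_snd)
qed simp

lemma walk_swap: "walk (map prod.swap w) = prod.swap (walk w)"
  by (simp add: walk_def comp_def)

lemma walk_sphere_pairs: "walk w \<in> sphere_pairs n q \<longleftrightarrow>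
    length w = q \<and> length (filter fst w) = n \<and> length (filter snd w) = n"
  by (auto simp: walk_def sphere_pairs_def sphere_simplices_visits filter_map comp_def)

lemma walk_degenerate:
  "walk w \<in> degenerate_pairs n q \<longleftrightarrow> walk w \<in> sphere_pairs n q \<and> (False, False) \<in> set w"
proof -
  have "(\<exists>j<length w. \<not> map fst w ! j \<and> \<not> map snd w ! j) \<longleftrightarrow> (False, False) \<in> set w"
    by (auto simp: in_set_conv_nth prod_eq_iff)
  moreover have "length w = q" if "walk w \<in> sphere_pairs n q" using that walk_sphere_pairs by blast
  ultimately show ?thesis
    by (auto simp: degenerate_pairs_def walk_def nth_visits_eq)
qed

lemma sphere_pairsE:
  assumes "p \<in> sphere_pairs n q"
  obtains w where "p = walk w"
proof -
  obtain x y where "p = (visits 0 x, visits 0 y)" "length x = q" "length y = q"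
    using assms by (auto simp: sphere_pairs_def elim!: sphere_simplicesE)
  then have "p = walk (zip x y)" by (simp add: walk_def)
  then show ?thesis by (rule that)
qed

section \<open>Faces of pairs as merging of steps\<close>

definition join :: "step \<Rightarrow> step \<Rightarrow> step" where
  "join x y = (fst x \<or> fst y, snd x \<or> snd y)"

text \<open>If a coordinate moves in both steps, the vertex between them occurs only once in that
  component; deleting it gives the base point. Two nondegenerate steps are composable only if one is
  east and the other is north.\<close>

definition composable :: "step \<Rightarrow> step \<Rightarrow> bool" where
  "composable x y \<longleftrightarrow> \<not> (fst x \<and> fst y) \<and> \<not> (snd x \<and> snd y)"

fun merge :: "nat \<Rightarrow> step list \<Rightarrow> step list" where
  "merge 0 (x # y # w) = join x y # w"
| "merge (Suc j) (x # w) = x # merge j w"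
| "merge _ w = []"

lemma del_vertex_simps [simp]: "del_vertex 0 (x # v) = v" "del_vertex (Suc i) (x # v) = x # del_vertex i v"
  by (simp_all add: del_vertex_def)

lemma visits_merge:
  assumes "\<And>x y. f (join x y) = (f x \<or> f y)"
  shows "Suc j < length w \<Longrightarrow> \<not> (f (w ! j) \<and> f (w ! Suc j)) \<Longrightarrow>
    del_vertex (Suc j) (visits a (map f w)) = visits a (map f (merge j w))"
proof (induction j w arbitrary: a rule: merge.induct)
  case (1 x y w)
  then show ?case by (auto simp: assms)
qed auto

text \<open>The vertex between two increments occurs only once. The bound \<open>m > a\<close>
  carries the induction: it keeps the lost vertex distinct from the starting vertex put in
  front.\<close>

lemma visits_del_missing:
  "Suc j < length w \<Longrightarrow> w ! j \<Longrightarrow> w ! Suc j \<Longrightarrow>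
    \<exists>m>a. m \<in> set (visits a w) \<and> m \<notin> set (del_vertex (Suc j) (visits a w))"
proof (induction j arbitrary: a w)
  case 0
  then obtain u where "w = True # True # u" by (cases w; cases "tl w") auto
  then show ?case by (intro exI[of _ "Suc a"]) (auto simp: set_visits)
next
  case (Suc j)
  then obtain x u where w: "w = x # u" by (cases w) auto
  obtain m where "m > (if x then Suc a else a)" "m \<in> set (visits (if x then Suc a else a) u)"
    "m \<notin> set (del_vertex (Suc j) (visits (if x then Suc a else a) u))"
    using Suc.IH[of u] Suc.prems w by fastforce
  then show ?case by (intro exI[of _ m]) (auto simp: w split: if_splits)
qed

lemma visits_del_first: "w ! 0 \<Longrightarrow> w \<noteq> [] \<Longrightarrow> a \<notin> set (del_vertex 0 (visits a w))"
  by (cases w) (auto simp: set_visits)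

lemma visits_del_last:
  "w \<noteq> [] \<Longrightarrow> last w \<Longrightarrow> a + length (filter (\<lambda>x. x) w) \<notin> set (del_vertex (length w) (visits a w))"
proof (induction w arbitrary: a)
  case (Cons x w)
  show ?case
  proof (cases w)
    case (Cons y u)
    then have w: "w \<noteq> []" "last w" using Cons.prems by auto
    then have "True \<in> set w" using last_in_set by metis
    then have "0 < length (filter (\<lambda>x. x) w)" by (auto simp: filter_empty_conv)
    then show ?thesis using Cons.IH[of "if x then Suc a else a"] w by auto
  qed (use Cons in auto)
qed simp

text \<open>The first and the last step of a nondegenerate path each move some coordinate, so the
  outer faces lose the vertex 0 or \<open>n\<close> of that component and vanish. An inner face
  merges two successive steps, or loses the vertex between them if they move the same
  coordinate.\<close>

lemma face_walk:
  assumes w: "walk w \<in> sphere_pairs n (Suc q)" "(False, False) \<notin> set w" and i: "i \<le> Suc q"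
  shows "pair_face n q i (frag_of (walk w)) =
    (if 0 < i \<and> i \<le> q \<and> composable (w ! (i - 1)) (w ! i) then frag_of (walk (merge (i - 1) w)) else 0)"
proof -
  have len: "length w = Suc q" and n: "length (filter (\<lambda>x. x) (map fst w)) = n" "length (filter (\<lambda>x. x) (map snd w)) = n"
    using w(1) by (auto simp: walk_sphere_pairs filter_map comp_def)
  define P where "P f \<longleftrightarrow> del_vertex i (visits 0 (map f w)) \<in> sphere_simplices n q" for f :: "step \<Rightarrow> bool"
  have P: "P f \<longleftrightarrow> set (del_vertex i (visits 0 (map f w))) = {0..n}" if "f = fst \<or> f = snd" for f
    unfolding P_def using that w(1) i
    by (intro sphere_simplices_del_iff) (auto simp: walk_def sphere_pairs_def)
  have e: "pair_face n q i (frag_of (walk w)) =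
    (if P fst \<and> P snd then frag_of (map_prod (del_vertex i) (del_vertex i) (walk w)) else 0)"
    by (simp add: pair_face_def P_def walk_def sphere_pairs_def)
  have nz: "fst (w ! j) \<or> snd (w ! j)" if "j < Suc q" for j
    using w(2) len that by (metis nth_mem prod.collapse)
  consider "i = 0" | "i = Suc q" | "0 < i" "i \<le> q" using i by linarith
  then show ?thesis
  proof cases
    case 1
    have "\<not> P f" if "f = fst \<or> f = snd" "f (w ! 0)" for f
      using visits_del_first[of "map f w" 0] that(2) len 1 unfolding P[OF that(1)] by (cases w) auto
    then show ?thesis using e nz[of 0] 1 by auto
  next
    case 2
    have "\<not> P f" if "f = fst \<or> f = snd" "f (w ! q)" for f
    proof -
      have "last (map f w)" using that(2) len by (simp add: last_conv_nth flip: length_greater_0_conv)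
      then have "n \<notin> set (del_vertex i (visits 0 (map f w)))"
        using visits_del_last[of "map f w" 0] len 2 n that(1) by (cases "w = []") auto
      then show ?thesis unfolding P[OF that(1)] by auto
    qed
    then show ?thesis using e nz[of q] 2 by auto
  next
    case 3
    then obtain j where j: "i = Suc j" "Suc j < length w" using len by (cases i) auto
    have "\<not> P f" if f: "f = fst \<or> f = snd" "f (w ! j)" "f (w ! Suc j)" for f
    proof -
      obtain m where m: "m \<in> set (visits 0 (map f w))" "m \<notin> set (del_vertex i (visits 0 (map f w)))"
        using visits_del_missing[of j "map f w" 0] f j by auto
      have "set (visits 0 (map f w)) = {0..n}" using n f(1) by (auto simp: set_visits)
      then show ?thesis using m unfolding P[OF f(1)] by auto
    qed
    then have no: "\<not> composable (w ! j) (w ! Suc j) \<Longrightarrow> \<not> (P fst \<and> P snd)"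
      unfolding composable_def by blast
    show ?thesis
    proof (cases "composable (w ! j) (w ! Suc j)")
      case True
      have d: "del_vertex i (visits 0 (map f w)) = visits 0 (map f (merge j w))" if "f = fst \<or> f = snd" for f
        using that True j unfolding j(1) by (intro visits_merge) (auto simp: join_def composable_def)
      have "set (del_vertex i (visits 0 (map f w))) = {0..n}" if f: "f = fst \<or> f = snd" for f
      proof -
        have c: "f (join x y) = (f x \<or> f y)" for x y using f by (auto simp: join_def)
        have "length (filter f (merge j w)) = length (filter f w)"
          using j(2) True
        proof (induction j w rule: merge.induct)
          case (1 x y w)
          then show ?case using f by (auto simp: c composable_def)
        qed auto
        then show ?thesis using n f unfolding d[OF f] by (auto simp: set_visits filter_map comp_def)
      qed
      then show ?thesis using e P d 3 True j by (simp add: walk_def)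
    qed (use e no 3 j in auto)
  qed
qed

text \<open>Translates the recursion over the target path into an alternating sum over the inner
  faces of the source path. Merging the steps \<open>j\<close> and \<open>j + 1\<close> is the face
  \<open>j + 1\<close>, which explains the exponent \<open>Suc j\<close>.\<close>

lemma path_bd_indicator:
  assumes "(False, False) \<notin> set v"
  shows "path_bd w (\<lambda>u. of_bool (u = v)) =
    (\<Sum>j<length v - 1. (-1) ^ Suc j * of_bool (composable (v ! j) (v ! Suc j) \<and> merge j v = w))"
  using assms
proof (induction w arbitrary: v)
  case Nil
  have "merge j v \<noteq> []" if "j < length v - 1" for j
    using that by (induction j v rule: merge.induct) auto
  then show ?case by simp
next
  case (Cons x w)
  show ?case
  proof (cases v)
    case Nil
    then show ?thesis by simp
  next
    case v: (Cons y u)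
    have h: "path_bd w (\<lambda>t. of_bool (x # t = v)) = of_bool (x = y) * path_bd w (\<lambda>t. of_bool (t = u))"
      by (cases "x = y") (simp_all add: v)
    note IH = Cons.IH[of u]
    show ?thesis
    proof (cases u)
      case Nil
      then show ?thesis using h IH by (simp add: v)
    next
      case u: (Cons z t)
      have s: "(\<Sum>j<length v - 1. (-1) ^ Suc j * of_bool (composable (v ! j) (v ! Suc j) \<and> merge j v = x # w))
        = - of_bool (composable y z \<and> join y z # t = x # w) - of_bool (x = y) *
          (\<Sum>j<length u - 1. (-1) ^ Suc j * of_bool (composable (u ! j) (u ! Suc j) \<and> merge j u = w) :: int)"
        by (auto simp: v u sum.lessThan_Suc_shift sum_negf simp del: sum.lessThan_Suc)
      have d: "(if x = diagonal then of_bool (east # north # w = v) + of_bool (north # east # w = v) else 0)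
          = (of_bool (composable y z \<and> join y z # t = x # w) :: int)"
        using Cons.prems v u
        by (cases y rule: step_cases; cases z rule: step_cases) (auto simp: composable_def join_def)
      have "path_bd w (\<lambda>t. of_bool (t = u)) =
          (\<Sum>j<length u - 1. (-1) ^ Suc j * of_bool (composable (u ! j) (u ! Suc j) \<and> merge j u = w))"
        using IH Cons.prems v by simp
      then show ?thesis unfolding path_bd.simps(2) h d s by simp
    qed
  qed
qed

section \<open>Homology of the antisymmetric chains\<close>

text \<open>The class of a chain modulo degenerate pairs, with nondegenerate pairs named by their
  lattice paths.\<close>

definition coords :: "(nat list \<times> nat list \<Rightarrow>\<^sub>0 int) \<Rightarrow> step list \<Rightarrow> int" where
  "coords t w = (if (False, False) \<in> set w then 0 else Poly_Mapping.lookup t (walk w))"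

lemma coords_linear:
  "coords (s + t) w = coords s w + coords t w" "coords (s - t) w = coords s w - coords t w"
  "coords (- t) w = - coords t w" "coords (frag_cmul c t) w = c * coords t w" "coords 0 w = 0"
  by (simp_all add: coords_def lookup_add lookup_minus)

lemma coords_chains:
  assumes "Poly_Mapping.keys t \<subseteq> sphere_pairs n q"
  shows "coords t \<in> path_chains n n q"
  unfolding path_chains_def mem_Collect_eq
proof (intro allI impI)
  fix w assume "coords t w \<noteq> 0"
  then have "(False, False) \<notin> set w" "walk w \<in> Poly_Mapping.keys t"
    by (auto simp: coords_def in_keys_iff split: if_splits)
  moreover have "walk w \<in> sphere_pairs n q" using assms calculation(2) by blast
  ultimately show "length w = q \<and> (False, False) \<notin> set w \<and>
      length (filter fst w) = n \<and> length (filter snd w) = n"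
    using walk_sphere_pairs by blast
qed

lemma face_degenerate:
  assumes "p \<in> sphere_pairs n (Suc q)" "fst p ! j = fst p ! Suc j" "snd p ! j = snd p ! Suc j"
    and "j \<le> q" "i \<le> Suc q" "i \<noteq> j" "i \<noteq> Suc j"
  shows "Poly_Mapping.keys (pair_face n q i (frag_of p)) \<subseteq> degenerate_pairs n q"
proof -
  \<comment> \<open>Deleting a vertex in front of the repetition moves the repetition one place
    down.\<close>
  define k where "k = (if i < j then j - 1 else j)"
  have "k < q" and k: "Suc k < Suc q" using assms(4-7) by (auto simp: k_def)
  have "del_vertex i u ! k = del_vertex i u ! Suc k" if "length u = Suc (Suc q)" "u ! j = u ! Suc j" for u :: "nat list"
    using that assms(4-7) by (auto simp: k_def nth_del_vertex)
  then show ?thesis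
    using assms(1-3) \<open>k < q\<close>
    by (auto simp: pair_face_def degenerate_pairs_def sphere_pairs_def sphere_simplices_def intro!: exI[of _ k])
qed

text \<open>For a nondegenerate pair \<open>face_walk\<close> computes every face. For a degenerate
  pair the two faces at the repetition are equal and have opposite signs, while all other faces are
  degenerate and do not contain the nondegenerate pair \<open>walk w\<close>.\<close>

lemma alternating_faces:
  assumes "Poly_Mapping.keys t \<subseteq> sphere_pairs n (Suc q)" "(False, False) \<notin> set w"
  shows "(\<Sum>i\<le>Suc q. (-1) ^ i * Poly_Mapping.lookup (pair_face n q i t) (walk w)) = path_bd w (coords t)"
  using assms(1)
proof (induction rule: frag_induction)
  case zero
  have "coords 0 = (\<lambda>u. 0)" by (rule ext) (rule coords_linear)
  then show ?case by (simp add: pair_face_def)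
next
  case (one p)
  then obtain v where v: "p = walk v" by (rule sphere_pairsE)
  have len: "length v = Suc q" using one v walk_sphere_pairs by auto
  have lk: "Poly_Mapping.lookup (frag_of p) (walk u) = of_bool (u = v)" for u
    by (simp add: v inj_walk)
  show ?case
  proof (cases "(False, False) \<in> set v")
    case True
    then have deg: "p \<in> degenerate_pairs n (Suc q)" using one v walk_degenerate by blast
    then obtain j p' where j: "j \<le> q" "p' \<in> sphere_pairs n q" "p = map_prod (dup_vertex j) (dup_vertex j) p'"
      by (rule degenerate_pairE)
    have rep: "fst p ! j = fst p ! Suc j" "snd p ! j = snd p ! Suc j"
      using j by (auto simp: sphere_pairs_def sphere_simplices_def nth_dup_vertex)
    let ?L = "\<lambda>i. Poly_Mapping.lookup (pair_face n q i (frag_of p)) (walk w)"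
    have "?L i = 0" if "i \<le> Suc q" "i \<noteq> j" "i \<noteq> Suc j" for i
      using face_degenerate[OF one rep j(1) that] assms(2) walk_degenerate[of w n q]
      by (metis in_keys_iff subsetD)
    then have "(\<Sum>i\<le>Suc q. (-1) ^ i * ?L i) = (\<Sum>i\<in>{j, Suc j}. (-1) ^ i * ?L i)"
      using j(1) by (intro sum.mono_neutral_right) auto
    moreover have "pair_degen n q j (frag_of p') = frag_of p"
      using j one by (simp add: pair_degen_def)
    then have "pair_face n q i (frag_of p) = frag_of p'" if "i = j \<or> i = Suc j" for i
      using pair_face_degen_same[of "frag_of p'" n q j i] j that by simp
    then have "?L j = ?L (Suc j)" by simp
    moreover have "coords (frag_of p) = (\<lambda>u. 0)"
      using True unfolding coords_def lk by auto
    ultimately show ?thesis by simp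
  next
    case False
    have c: "coords (frag_of p) = (\<lambda>u. of_bool (u = v))"
      using False unfolding coords_def lk by auto
    let ?g = "\<lambda>i. (-1) ^ i * Poly_Mapping.lookup (pair_face n q i (frag_of p)) (walk w)"
    have g: "?g i = (if 0 < i \<and> i \<le> q then
        (-1) ^ i * of_bool (composable (v ! (i - 1)) (v ! i) \<and> merge (i - 1) v = w) else 0)"
      if "i \<le> Suc q" for i
      using face_walk[OF one[unfolded v] False that] by (auto simp: v inj_walk)
    have "sum ?g {..Suc q} = sum ?g {Suc 0..<Suc q}"
      by (rule sum.mono_neutral_right) (auto simp: g)
    also have "\<dots> = (\<Sum>j<q. ?g (Suc j))"
      using sum.shift_bounds_Suc_ivl[of ?g 0 q] by (simp add: atLeast0LessThan)
    also have "\<dots> = (\<Sum>j<q. (-1) ^ Suc j * of_bool (composable (v ! j) (v ! Suc j) \<and> merge j v = w))"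
      by (rule sum.cong[OF refl], subst g) simp_all
    finally show ?thesis using path_bd_indicator[OF False, of w] len by (simp add: c)
  qed
next
  case (diff a b)
  have "coords (a - b) = (\<lambda>u. coords a u - coords b u)" by (rule ext) (rule coords_linear)
  then show ?case using diff
    by (simp only: pair_face_def push_diff lookup_minus right_diff_distrib sum_subtractf path_bd_diff)
qed

text \<open>All faces but the zeroth vanish on the Moore complex, so the alternating sum has a
  single term.\<close>

lemma coords_face:
  assumes "t \<in> pair_moore n (Suc q)"
  shows "coords (pair_face n q 0 t) w = path_bd w (coords t)"
proof -
  have t: "Poly_Mapping.keys t \<subseteq> sphere_pairs n (Suc q)" and 0: "\<And>i. 0 < i \<Longrightarrow> i \<le> Suc q \<Longrightarrow> pair_face n q i t = 0"
    using assms by (auto simp: pair_moore_def)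
  show ?thesis
  proof (cases "(False, False) \<in> set w")
    case True
    then have "path_bd w (coords t) = 0"
      using path_chains_bd[OF coords_chains[OF t]] path_chainsD(2)[of "\<lambda>w. path_bd w (coords t)"] by blast
    then show ?thesis using True by (simp add: coords_def)
  next
    case False
    have "(\<Sum>i\<le>Suc q. (-1) ^ i * Poly_Mapping.lookup (pair_face n q i t) (walk w)) =
      (\<Sum>i\<in>{0}. (-1) ^ i * Poly_Mapping.lookup (pair_face n q i t) (walk w))"
      by (rule sum.mono_neutral_right) (auto simp: 0)
    then show ?thesis using alternating_faces[OF t False] False by (simp add: coords_def)
  qed
qed

lemma pair_moore_diff: "s \<in> pair_moore n q \<Longrightarrow> t \<in> pair_moore n q \<Longrightarrow> s - t \<in> pair_moore n q"
  and pair_moore_uminus: "t \<in> pair_moore n q \<Longrightarrow> - t \<in> pair_moore n q"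
  and pair_moore_cmul: "t \<in> pair_moore n q \<Longrightarrow> frag_cmul c t \<in> pair_moore n q"
  using keys_diff[of s t] keys_cmul[of c t]
  by (auto simp: pair_moore_def pair_face_def pair_linear)

lemma pair_moore_add: "s \<in> pair_moore n q \<Longrightarrow> t \<in> pair_moore n q \<Longrightarrow> s + t \<in> pair_moore n q"
  using pair_moore_diff[OF _ pair_moore_uminus] by force

lemma coords_inject:
  assumes "t \<in> pair_moore n (Suc r)" "\<And>w. coords t w = 0"
  shows "t = 0"
proof (rule moore_degenerate_zero[OF assms(1)], rule subsetI)
  fix p assume p: "p \<in> Poly_Mapping.keys t"
  then have s: "p \<in> sphere_pairs n (Suc r)" using assms(1) by (auto simp: pair_moore_def)
  then obtain w where w: "p = walk w" by (rule sphere_pairsE)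
  then have "(False, False) \<in> set w"
    using p assms(2)[of w] by (auto simp: coords_def in_keys_iff split: if_splits)
  then show "p \<in> degenerate_pairs n (Suc r)" using s w walk_degenerate by blast
qed

text \<open>Together with \<open>coords_inject\<close> this identifies Moore chains with normalised
  chains in positive degrees: the prescribed coefficients define a chain, which degenerate pairs
  complete to a Moore chain.\<close>

lemma coords_surj:
  assumes "f \<in> path_chains n n (Suc r)"
  shows "\<exists>t\<in>pair_moore n (Suc r). coords t = f"
proof -
  let ?W = "{w. f w \<noteq> 0}"
  have "?W \<subseteq> {w. set w \<subseteq> UNIV \<and> length w = Suc r}" using path_chainsD(1)[OF assms] by auto
  then have fin: "finite ?W" using finite_lists_length_eq[of UNIV] finite_subset finite by blast
  define c where "c = (\<Sum>w\<in>?W. frag_cmul (f w) (frag_of (walk w)))"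
  have "Poly_Mapping.keys (frag_cmul (f w) (frag_of (walk w))) \<subseteq> sphere_pairs n (Suc r)" if "w \<in> ?W" for w
    using that path_chainsD[OF assms] by (auto simp: walk_sphere_pairs dest!: subsetD[OF keys_cmul])
  then have c: "Poly_Mapping.keys c \<subseteq> sphere_pairs n (Suc r)"
    unfolding c_def by (rule keys_sum_subset)
  have "Poly_Mapping.lookup c (walk u) = (\<Sum>w\<in>?W. if u = w then f w else 0)" for u
    unfolding c_def by (simp add: lookup_sum inj_walk if_distrib cong: if_cong)
  then have cu: "Poly_Mapping.lookup c (walk u) = f u" for u using fin by (simp add: sum.delta)
  obtain t where t: "t \<in> pair_moore n (Suc r)" "Poly_Mapping.keys (t - c) \<subseteq> degenerate_pairs n (Suc r)"
    using moore_representative[OF c] by blast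
  have "coords t w = f w" for w
  proof (cases "(False, False) \<in> set w")
    case True
    then show ?thesis using path_chainsD(2)[OF assms, of w] by (auto simp: coords_def)
  next
    case False
    then have "walk w \<notin> Poly_Mapping.keys (t - c)" using t(2) walk_degenerate by blast
    then show ?thesis using False cu by (simp add: in_keys_iff coords_def lookup_minus)
  qed
  then show ?thesis using t(1) by blast
qed

section \<open>Antisymmetric tensors in the Moore complex\<close>

abbreviation tensor_swap :: "('a \<times> 'a \<Rightarrow>\<^sub>0 int) \<Rightarrow> ('a \<times> 'a \<Rightarrow>\<^sub>0 int)" where
  "tensor_swap \<equiv> push UNIV prod.swap"

lemma lookup_tensor_swap: "Poly_Mapping.lookup (tensor_swap t) p = Poly_Mapping.lookup t (prod.swap p)"
proof (induction t rule: frag_induction[OF subset_UNIV])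
  case (2 x)
  then show ?case by (cases x; cases p) auto
qed (auto simp: push_diff lookup_minus)

lemma tensor_swap_face: "tensor_swap (pair_face n q i t) = pair_face n q i (tensor_swap t)"
proof (induction t rule: frag_induction[OF subset_UNIV])
  case (2 x)
  then show ?case by (cases x) (auto simp: pair_face_def sphere_pairs_def)
qed (auto simp: pair_face_def push_diff)

lemma coords_swap: "coords (tensor_swap t) w = coords t (map prod.swap w)"
  by (simp add: coords_def lookup_tensor_swap walk_swap swap_path del: set_map)

lemma pair_moore_swap: "t \<in> pair_moore n q \<Longrightarrow> tensor_swap t \<in> pair_moore n q"
proof -
  assume t: "t \<in> pair_moore n q"
  have "p \<in> sphere_pairs n q" if "p \<in> Poly_Mapping.keys (tensor_swap t)" for p
  proof -
    have "prod.swap p \<in> Poly_Mapping.keys t" using that by (simp add: in_keys_iff lookup_tensor_swap)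
    then have "prod.swap p \<in> sphere_pairs n q" using t by (auto simp: pair_moore_def)
    then show ?thesis by (cases p) (simp add: sphere_pairs_def)
  qed
  then show ?thesis using t by (auto simp: pair_moore_def simp flip: tensor_swap_face)
qed

definition alt_moore :: "nat \<Rightarrow> nat \<Rightarrow> (nat list \<times> nat list \<Rightarrow>\<^sub>0 int) set" where
  "alt_moore n q = {t \<in> pair_moore n q. tensor_swap t = - t}"

lemma alt_moore_lin:
  "s \<in> alt_moore n q \<Longrightarrow> t \<in> alt_moore n q \<Longrightarrow> s + t \<in> alt_moore n q"
  "s \<in> alt_moore n q \<Longrightarrow> t \<in> alt_moore n q \<Longrightarrow> s - t \<in> alt_moore n q"
  "t \<in> alt_moore n q \<Longrightarrow> frag_cmul c t \<in> alt_moore n q"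
proof -
  have "frag_cmul c (- t) = - frag_cmul c t" by (rule poly_mapping_eqI) simp
  then show "t \<in> alt_moore n q \<Longrightarrow> frag_cmul c t \<in> alt_moore n q"
    by (auto simp: alt_moore_def pair_moore_cmul push_cmul)
qed (auto simp: alt_moore_def pair_moore_add pair_moore_diff pair_linear)

lemma alt_moore_face:
  assumes "t \<in> alt_moore n (Suc q)"
  shows "pair_face n q 0 t \<in> alt_moore n q"
proof -
  have t: "Poly_Mapping.keys t \<subseteq> sphere_pairs n (Suc q)" "\<And>i. 0 < i \<Longrightarrow> i \<le> Suc q \<Longrightarrow> pair_face n q i t = 0"
    "tensor_swap t = - t" using assms by (auto simp: alt_moore_def pair_moore_def)
  have "pair_face n (q - 1) i (pair_face n q 0 t) = 0" if i: "0 < i" "i \<le> q" for i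
  proof -
    obtain q' where q: "q = Suc q'" using i by (cases q) auto
    have "pair_face n q' 0 (pair_face n q (Suc i) t) = pair_face n q' i (pair_face n q 0 t)"
      using pair_face_face[of t n q' 0 "Suc i"] t(1) i q by simp
    then show ?thesis using t(2)[of "Suc i"] i q by (simp add: pair_face_def)
  qed
  then show ?thesis
    using t(3) keys_pair_face by (simp add: alt_moore_def pair_moore_def tensor_swap_face) (simp add: pair_face_def push_uminus)
qed

lemma coords_alt:
  assumes "t \<in> alt_moore n q"
  shows "coords t \<in> alt_chains n q"
  using assms coords_chains[of t n q] coords_swap[of t] coords_linear(3)[of t]
  by (auto simp: alt_moore_def pair_moore_def alt_chains_def)

text \<open>A Moore chain is determined by its coordinates, so antisymmetry of the coordinates
  passes to the chain.\<close>

lemma coords_alt_surj: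
  assumes "f \<in> alt_chains n (Suc r)"
  shows "\<exists>t\<in>alt_moore n (Suc r). coords t = f"
proof -
  obtain t where t: "t \<in> pair_moore n (Suc r)" "coords t = f"
    using coords_surj[of f n r] assms unfolding alt_chains_def by blast
  have "tensor_swap t + t = 0"
    using assms t by (intro coords_inject[of _ n r] pair_moore_add pair_moore_swap)
      (simp_all add: coords_linear coords_swap alt_chains_def)
  then show ?thesis using t by (auto simp: alt_moore_def eq_neg_iff_add_eq_0)
qed

text \<open>In degree \<open>n\<close> there is a single simplex, so the only pair is fixed by the
  swap, and its integer coefficient equals its own negative.\<close>

lemma alt_moore_bottom: "t \<in> alt_moore n n \<Longrightarrow> t = 0"
proof -
  assume "t \<in> alt_moore n n"
  then have t: "Poly_Mapping.keys t \<subseteq> sphere_pairs n n" "tensor_swap t = - t"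
    by (auto simp: alt_moore_def pair_moore_def)
  have "Poly_Mapping.lookup t p = 0" for p
  proof (cases "p \<in> sphere_pairs n n")
    case True
    then have "prod.swap p = p" by (auto simp: sphere_pairs_def sphere_simplices_same)
    then show ?thesis using lookup_tensor_swap[of t p] t(2) by simp
  qed (use t(1) in \<open>auto simp: in_keys_iff\<close>)
  then show ?thesis by (simp add: poly_mapping_eqI)
qed

lemma alt_moore_inject:
  assumes "t \<in> alt_moore n (n + k)" "\<And>w. coords t w = 0"
  shows "t = 0"
proof (cases "n + k")
  case 0
  then show ?thesis using alt_moore_bottom[of t 0] assms by simp
next
  case (Suc r)
  then show ?thesis using coords_inject[of t n r] assms by (simp add: alt_moore_def)
qed

lemma alt_moore_boundary:
  assumes "k > 0" "t \<in> alt_moore n (n + k)" "pair_face n (n + k - 1) 0 t = 0" "\<not> (odd k \<and> k \<le> n)"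
  shows "\<exists>g\<in>alt_moore n (Suc (n + k)). t = pair_face n (n + k) 0 g"
proof -
  obtain r where r: "n + k = Suc r" using assms(1) by (cases "n + k") auto
  have "path_bd w (coords t) = 0" for w
    using coords_face[of t n r w] assms(2,3) r by (simp add: alt_moore_def coords_linear)
  from alt_cycle[OF assms(1) coords_alt[OF assms(2)] this] assms(4)
  obtain f where f: "f \<in> alt_chains n (Suc (n + k))" "\<And>w. coords t w = path_bd w f" by auto
  obtain g where g: "g \<in> alt_moore n (Suc (n + k))" "coords g = f" using coords_alt_surj[OF f(1)] by blast
  have "t - pair_face n (n + k) 0 g = 0"
    using g f(2) coords_face[of g n "n + k"] alt_moore_face[OF g(1)] assms(2)
    by (intro alt_moore_inject[of _ n k] alt_moore_lin(2)) (auto simp: coords_linear alt_moore_def)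
  then show ?thesis using g(1) by auto
qed

text \<open>The results on lattice paths are transported along \<open>coords\<close>. Divisibility
  by 0 means being 0, so the last clause describes infinite order and order two by one
  formula.\<close>

theorem alt_moore_generator:
  assumes k: "odd k" "k \<le> n"
  shows "\<exists>e\<in>alt_moore n (n + k). pair_face n (n + k - 1) 0 e = 0 \<and>
    (\<forall>t\<in>alt_moore n (n + k). pair_face n (n + k - 1) 0 t = 0 \<longrightarrow>
      (\<exists>c. \<exists>g\<in>alt_moore n (Suc (n + k)). t = frag_cmul c e + pair_face n (n + k) 0 g)) \<and>
    (\<forall>c. (\<exists>g\<in>alt_moore n (Suc (n + k)). frag_cmul c e = pair_face n (n + k) 0 g) \<longleftrightarrow>
      int (if k = n then 0 else 2) dvd c)"
proof -
  have k0: "k > 0" using k(1) by (rule odd_pos)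
  obtain r where r: "n + k = Suc r" using k0 by (cases "n + k") auto
  have "eta_cycle (n - k) k \<in> alt_chains n (n + k)" using eta_cycle_chains[OF k0, of "n - k"] k(2) by (simp add: add.commute)
  then obtain e where e: "e \<in> alt_moore n (n + k)" "coords e = eta_cycle (n - k) k"
    using coords_alt_surj[of _ n r] r by auto
  have zero: "t = s" if "t \<in> alt_moore n (n + k)" "s \<in> alt_moore n (n + k)" "\<And>w. coords t w = coords s w" for t s
    using alt_moore_inject[OF alt_moore_lin(2)[OF that(1,2)]] that(3) by (simp add: coords_linear)
  have face: "coords (pair_face n (n + k) 0 g) w = path_bd w (coords g)" if "g \<in> alt_moore n (Suc (n + k))" for g w
    using that coords_face by (auto simp: alt_moore_def)
  have 0: "pair_face n (n + k - 1) 0 e = 0"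
  proof -
    have "coords (pair_face n (n + k - 1) 0 e) w = 0" for w
      using coords_face[of e n r w] e r path_bd_eta_cycle[OF k0, of w "n - k"] k(1) by (simp add: alt_moore_def)
    moreover have "pair_face n (n + k - 1) 0 e \<in> alt_moore n (n + (k - 1))"
      using alt_moore_face[of e n r] e(1) r k0 by simp
    ultimately show ?thesis using alt_moore_inject by blast
  qed
  have gen: "\<exists>c. \<exists>g\<in>alt_moore n (Suc (n + k)). t = frag_cmul c e + pair_face n (n + k) 0 g"
    if t: "t \<in> alt_moore n (n + k)" "pair_face n (n + k - 1) 0 t = 0" for t
  proof -
    have "path_bd w (coords t) = 0" for w
      using coords_face[of t n r w] t r by (simp add: alt_moore_def coords_linear)
    from alt_cycle[OF k0 coords_alt[OF t(1)] this] k
    obtain c f where f: "f \<in> alt_chains n (Suc (n + k))"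
      and c: "\<And>w. coords t w = c * eta_cycle (n - k) k w + path_bd w f" by auto
    obtain g where g: "g \<in> alt_moore n (Suc (n + k))" "coords g = f" using coords_alt_surj[OF f] by blast
    have "t = frag_cmul c e + pair_face n (n + k) 0 g"
      using t(1) e alt_moore_face[OF g(1)] face[OF g(1)] g(2) c
      by (intro zero) (auto simp: alt_moore_lin coords_linear)
    then show ?thesis using g(1) by blast
  qed
  have bound: "(\<exists>g\<in>alt_moore n (Suc (n + k)). frag_cmul c e = pair_face n (n + k) 0 g) \<longleftrightarrow>
      int (if k = n then 0 else 2) dvd c" for c
  proof
    assume "\<exists>g\<in>alt_moore n (Suc (n + k)). frag_cmul c e = pair_face n (n + k) 0 g"
    then obtain g where g: "g \<in> alt_moore n (Suc (n + k))" "frag_cmul c e = pair_face n (n + k) 0 g" by blast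
    have "c * eta_cycle (n - k) k w = path_bd w (coords g)" for w
      using face[OF g(1), of w] g(2) e(2) by (metis coords_linear(4))
    from eta_cycle_boundary[OF k coords_alt[OF g(1)] this]
    show "int (if k = n then 0 else 2) dvd c" by (auto split: if_splits)
  next
    assume c: "int (if k = n then 0 else 2) dvd c"
    show "\<exists>g\<in>alt_moore n (Suc (n + k)). frag_cmul c e = pair_face n (n + k) 0 g"
    proof (cases "k = n")
      case True
      then show ?thesis using c alt_moore_lin(2)[of 0 n "Suc (n + k)" 0]
        by (intro bexI[of _ 0]) (auto simp: pair_face_def alt_moore_def pair_moore_def)
    next
      case False
      then obtain m where m: "n - k = Suc m" using k(2) by (cases "n - k") auto
      obtain d where d: "c = 2 * d" using c False by (auto elim: dvdE)
      have mk: "m + Suc k = n" "m + 2 * Suc k = Suc (n + k)" using m k(2) by auto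
      have "eta_cycle m (Suc k) \<in> alt_chains n (Suc (n + k))"
        using eta_cycle_chains[of "Suc k" m, OF zero_less_Suc] unfolding mk .
      then obtain g where g: "g \<in> alt_moore n (Suc (n + k))" "coords g = eta_cycle m (Suc k)"
        using coords_alt_surj by blast
      \<comment> \<open>The chain with one diagonal step less and one more step in each direction
        bounds \<open>(-1) ^ m * 2\<close> times the generator. The factor \<open>(-1) ^ m\<close>
        removes this sign, and \<open>d\<close> is half of \<open>c\<close>.\<close>
      let ?g = "frag_cmul ((-1) ^ m * d) g"
      have g': "?g \<in> alt_moore n (Suc (n + k))" by (rule alt_moore_lin(3)[OF g(1)])
      have cg: "coords ?g = (\<lambda>w. ((-1) ^ m * d) * eta_cycle m (Suc k) w)"
        by (rule ext) (simp add: coords_linear g(2))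
      have "path_bd w (coords ?g) = c * eta_cycle (n - k) k w" for w
        unfolding cg path_bd_mult using path_bd_eta_cycle[of "Suc k" w m] k(1)
        by (simp add: m d del: eta_cycle.simps flip: power_add mult.assoc)
      then have "frag_cmul c e = pair_face n (n + k) 0 ?g"
        using e alt_moore_face[OF g'] by (intro zero) (auto simp: alt_moore_lin face[OF g'] coords_linear)
      then show ?thesis using g' by blast
    qed
  qed
  show ?thesis by (intro bexI[OF _ e(1)] conjI ballI impI allI 0 gen bound)
qed

section \<open>The Magnus embedding of free nil groups\<close>

definition tensor :: "('a \<Rightarrow>\<^sub>0 int) \<Rightarrow> ('b \<Rightarrow>\<^sub>0 int) \<Rightarrow> ('a \<times> 'b \<Rightarrow>\<^sub>0 int)" where
  "tensor a b = frag_extend (\<lambda>u. push UNIV (Pair u) b) a"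

lemma tensor_left: "tensor (a + a') b = tensor a b + tensor a' b" "tensor (a - a') b = tensor a b - tensor a' b"
    "tensor (- a) b = - tensor a b" "tensor 0 b = 0"
  by (simp_all add: tensor_def frag_extend_add frag_extend_diff frag_extend_minus)

lemma tensor_diff_right: "tensor a (b - b') = tensor a b - tensor a b'"
  unfolding tensor_def
  by (induction a rule: frag_induction[OF subset_UNIV]) (simp_all add: frag_extend_diff push_diff)

lemma tensor_zero_right: "tensor a 0 = 0"
  using tensor_diff_right[of a 0 0] by simp

lemma tensor_minus_right: "tensor a (- b) = - tensor a b"
  using tensor_diff_right[of a 0 b] by (simp add: tensor_zero_right)

lemma tensor_add_right: "tensor a (b + b') = tensor a b + tensor a b'"
  using tensor_diff_right[of a b "- b'"] by (simp add: tensor_minus_right)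

lemmas tensor_linear = tensor_left tensor_diff_right tensor_zero_right tensor_minus_right tensor_add_right

lemma tensor_of [simp]: "tensor (frag_of u) (frag_of v) = frag_of (u, v)"
  by (simp add: tensor_def)

lemma push_tensor: "push (B \<times> B) (map_prod f f) (tensor a b) = tensor (push B f a) (push B f b)"
proof (induction a rule: frag_induction[OF subset_UNIV])
  case (2 u)
  show ?case
    by (induction b rule: frag_induction[OF subset_UNIV]) (auto simp: tensor_linear push_diff)
qed (simp_all add: tensor_linear push_diff)

text \<open>The units \<open>1 + a + s\<close> of the tensor algebra on \<open>\<int>[A]\<close> truncated in degree two.\<close>

definition magnus :: "'a set \<Rightarrow> (('a \<Rightarrow>\<^sub>0 int) \<times> ('a \<times> 'a \<Rightarrow>\<^sub>0 int)) monoid" where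
  "magnus A = \<lparr>carrier = {(a, s). Poly_Mapping.keys a \<subseteq> A},
    monoid.mult = (\<lambda>(a, s) (b, t). (a + b, s + t + tensor a b)), one = (0, 0)\<rparr>"

lemma magnus_simps [simp]:
  "(a, s) \<in> carrier (magnus A) \<longleftrightarrow> Poly_Mapping.keys a \<subseteq> A"
  "(a, s) \<otimes>\<^bsub>magnus A\<^esub> (b, t) = (a + b, s + t + tensor a b)"
  "\<one>\<^bsub>magnus A\<^esub> = (0, 0)"
  by (simp_all add: magnus_def)

lemma keys_add_subset:
  "Poly_Mapping.keys a \<subseteq> S \<Longrightarrow> Poly_Mapping.keys b \<subseteq> S \<Longrightarrow> Poly_Mapping.keys (a + b) \<subseteq> S"
  for a :: "'a \<Rightarrow>\<^sub>0 int"
  using Poly_Mapping.keys_add[of a b] by blast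

lemma group_magnus: "group (magnus A)"
proof (rule groupI)
  fix x y assume "x \<in> carrier (magnus A)" "y \<in> carrier (magnus A)"
  then show "x \<otimes>\<^bsub>magnus A\<^esub> y \<in> carrier (magnus A)"
    by (cases x; cases y) (simp add: keys_add_subset)
next
  fix x y z assume "x \<in> carrier (magnus A)" "y \<in> carrier (magnus A)" "z \<in> carrier (magnus A)"
  then show "x \<otimes>\<^bsub>magnus A\<^esub> y \<otimes>\<^bsub>magnus A\<^esub> z = x \<otimes>\<^bsub>magnus A\<^esub> (y \<otimes>\<^bsub>magnus A\<^esub> z)"
    by (cases x; cases y; cases z) (simp add: tensor_linear)
next
  fix x assume "x \<in> carrier (magnus A)"
  then show "\<exists>y\<in>carrier (magnus A). y \<otimes>\<^bsub>magnus A\<^esub> x = \<one>\<^bsub>magnus A\<^esub>"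
  proof (cases x)
    case (Pair a s)
    then show ?thesis using \<open>x \<in> carrier (magnus A)\<close>
      by (intro bexI[of _ "(- a, - s + tensor a a)"]) (simp_all add: tensor_linear)
  qed
  show "\<one>\<^bsub>magnus A\<^esub> \<otimes>\<^bsub>magnus A\<^esub> x = x" by (cases x) (simp add: tensor_linear)
qed simp

lemma inv_magnus:
  "Poly_Mapping.keys a \<subseteq> A \<Longrightarrow> inv\<^bsub>magnus A\<^esub> (a, s) = (- a, - s + tensor a a)"
  by (rule group.inv_equality[OF group_magnus]) (auto simp: tensor_linear)

text \<open>Exchanging two factors changes only the term \<open>tensor a b\<close> of their product.
  The commutator therefore depends only on the degree one parts, and having none itself it is
  central.\<close>

lemma comm_magnus:
  assumes "Poly_Mapping.keys a \<subseteq> A" "Poly_Mapping.keys b \<subseteq> A"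
  shows "group_comm (magnus A) (a, s) (b, t) = (0, tensor a b - tensor b a)"
  using assms by (simp add: group_comm_def inv_magnus tensor_linear algebra_simps)

lemma nil_group_magnus: "nil_group (magnus A)"
proof (rule group.nil_groupI[OF group_magnus])
  fix x y z assume "x \<in> carrier (magnus A)" "y \<in> carrier (magnus A)" "z \<in> carrier (magnus A)"
  then show "group_comm (magnus A) (group_comm (magnus A) x y) z = \<one>\<^bsub>magnus A\<^esub>"
    by (cases x; cases y; cases z) (auto simp: comm_magnus tensor_linear)
qed

definition magnus_map :: "'a set \<Rightarrow> 'a word set \<Rightarrow> ('a \<Rightarrow>\<^sub>0 int) \<times> ('a \<times> 'a \<Rightarrow>\<^sub>0 int)" where
  "magnus_map A = free_lift (magnus A) (\<lambda>u. (frag_of u, 0))"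

lemma magnus_map_hom: "magnus_map A \<in> hom (free_nil A) (magnus A)"
  unfolding magnus_map_def by (rule free_lift_hom[OF nil_group_magnus]) simp

lemma magnus_map_gen: "u \<in> A \<Longrightarrow> magnus_map A (free_gen A u) = (frag_of u, 0)"
  unfolding magnus_map_def by (rule free_lift_gen[OF nil_group_magnus]) simp_all

lemma group_hom_magnus_map: "group_hom (free_nil A) (magnus A) (magnus_map A)"
  by (simp add: group_hom_def group_hom_axioms_def group_free_nil group_magnus magnus_map_hom)

text \<open>Naturality of the Magnus map: faces of \<open>S(n)\<close> can be computed on the degree
  one and degree two parts separately.\<close>

lemma magnus_map_free_map:
  assumes "c \<in> carrier (free_nil A)"
  shows "magnus_map B (free_map A B f c)
    = map_prod (push B f) (push (B \<times> B) (map_prod f f)) (magnus_map A c)"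
proof -
  let ?p = "map_prod (push B f) (push (B \<times> B) (map_prod f f))"
  have p: "?p \<in> hom (magnus A) (magnus B)"
    by (rule homI) (auto simp: push_add push_tensor dest: subsetD[OF keys_push_subset])
  have "(magnus_map B \<circ> free_map A B f) c = (?p \<circ> magnus_map A) c"
  proof (rule free_nil_hom_eqI[OF group_magnus hom_compose[OF free_map_hom magnus_map_hom]
        hom_compose[OF magnus_map_hom p] _ assms])
    fix u assume "u \<in> A"
    then show "(magnus_map B \<circ> free_map A B f) (free_gen A u) = (?p \<circ> magnus_map A) (free_gen A u)"
      using group_hom.hom_one[OF group_hom_magnus_map[of B]]
      by (simp add: free_map_gen magnus_map_gen)
  qed
  then show ?thesis by simp
qed

text \<open>A strict total order \<open>R\<close> on \<open>A\<close> selects one commutator from each pair \<open>[u, v]\<close>, \<open>[v, u]\<close>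
  of inverse ones.\<close>

lemma strict_total_order:
  "\<exists>R. R \<subseteq> A \<times> A \<and> (\<forall>u v. (u, v) \<in> R \<longrightarrow> (v, u) \<notin> R) \<and>
    (\<forall>u\<in>A. \<forall>v\<in>A. u \<noteq> v \<longrightarrow> (u, v) \<in> R \<or> (v, u) \<in> R)"
proof -
  obtain r :: "'a rel" where r: "Well_order r" "Field r = UNIV" using well_ordering by (elim exE conjE)
  have total: "(u, v) \<in> r \<or> (v, u) \<in> r" if "u \<noteq> v" for u v
    using r that unfolding order_on_defs total_on_def by (metis UNIV_I)
  have antisym: "u = v" if "(u, v) \<in> r" "(v, u) \<in> r" for u v
    using r(1) that unfolding order_on_defs antisym_def by blast
  let ?R = "{(u, v) \<in> A \<times> A. u \<noteq> v \<and> (u, v) \<in> r}"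
  have "(u, v) \<in> ?R \<or> (v, u) \<in> ?R" if "u \<in> A" "v \<in> A" "u \<noteq> v" for u v
    using that total[of u v] by simp
  moreover have "(v, u) \<notin> ?R" if "(u, v) \<in> ?R" for u v
    using that antisym[of u v] by auto
  ultimately show ?thesis by (intro exI[of _ ?R]) blast
qed

lemma (in group) inv_group_comm:
  "a \<in> carrier G \<Longrightarrow> b \<in> carrier G \<Longrightarrow> inv (group_comm G a b) = group_comm G b a"
  by (simp add: group_comm_def inv_mult_group m_assoc)

lemma (in group_hom) hom_group_comm:
  "a \<in> carrier G \<Longrightarrow> b \<in> carrier G \<Longrightarrow> h (group_comm G a b) = group_comm H (h a) (h b)"
  by (simp add: group_comm_def)

lemma (in group) conj_hom: "q \<in> carrier G \<Longrightarrow> (\<lambda>x. q \<otimes> x \<otimes> inv q) \<in> hom G G"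
proof (rule homI)
  fix a b assume *: "q \<in> carrier G" "a \<in> carrier G" "b \<in> carrier G"
  have "inv q \<otimes> (q \<otimes> (b \<otimes> inv q)) = b \<otimes> inv q" using * by (simp flip: m_assoc)
  then show "q \<otimes> (a \<otimes> b) \<otimes> inv q = q \<otimes> a \<otimes> inv q \<otimes> (q \<otimes> b \<otimes> inv q)"
    using * by (simp add: m_assoc)
qed simp

lemma (in group) conj_eq_iff:
  "q \<in> carrier G \<Longrightarrow> x \<in> carrier G \<Longrightarrow> q \<otimes> x \<otimes> inv q = x \<longleftrightarrow> q \<otimes> x = x \<otimes> q"
  using inv_solve_right[of x "q \<otimes> x" q] by auto

lemma (in group) subgroup_center: "subgroup {z \<in> carrier G. \<forall>c\<in>carrier G. z \<otimes> c = c \<otimes> z} G"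
  (is "subgroup ?Z G")
proof (rule subgroupI)
  have c: "z \<in> carrier G" "\<And>c. c \<in> carrier G \<Longrightarrow> z \<otimes> c = c \<otimes> z" if "z \<in> ?Z" for z
    using that by blast+
  show "?Z \<subseteq> carrier G" by blast
  have "\<one> \<in> ?Z" by simp
  then show "?Z \<noteq> {}" by blast
  fix z assume z: "z \<in> ?Z"
  have "inv z \<otimes> d = d \<otimes> inv z" if d: "d \<in> carrier G" for d
  proof -
    have "inv z \<otimes> d = inv z \<otimes> (d \<otimes> z) \<otimes> inv z" using d c(1)[OF z] by (simp add: m_assoc)
    also have "d \<otimes> z = z \<otimes> d" using c(2)[OF z d] by simp
    also have "inv z \<otimes> (z \<otimes> d) \<otimes> inv z = d \<otimes> inv z" using d c(1)[OF z] by (simp flip: m_assoc)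
    finally show ?thesis .
  qed
  then show "inv z \<in> ?Z" using inv_closed[OF c(1)[OF z]] by blast
  fix w assume w: "w \<in> ?Z"
  have "z \<otimes> w \<otimes> d = d \<otimes> (z \<otimes> w)" if d: "d \<in> carrier G" for d
  proof -
    have "z \<otimes> w \<otimes> d = z \<otimes> (w \<otimes> d)" using c(1)[OF z] c(1)[OF w] d by (simp add: m_assoc)
    also have "w \<otimes> d = d \<otimes> w" by (rule c(2)[OF w d])
    also have "z \<otimes> (d \<otimes> w) = z \<otimes> d \<otimes> w" using c(1)[OF z] c(1)[OF w] d by (simp add: m_assoc)
    also have "z \<otimes> d = d \<otimes> z" by (rule c(2)[OF z d])
    finally show ?thesis using c(1)[OF z] c(1)[OF w] d by (simp add: m_assoc)
  qed
  then show "z \<otimes> w \<in> ?Z" using m_closed[OF c(1)[OF z] c(1)[OF w]] by blast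
qed

lemma free_Abelian_group_extension:
  assumes "comm_group G" "\<forall>x\<in>S. f x \<in> carrier G"
  shows "\<exists>h. h \<in> hom (free_Abelian_group S) G \<and> (\<forall>x\<in>S. h (frag_of x) = f x)"
proof -
  have "f ` S \<subseteq> carrier G" using assms(2) by blast
  then show ?thesis by (metis comm_group.free_Abelian_group_universal[OF assms(1)])
qed

text \<open>Triple commutators are trivial, so commutators are central, and the extension from the
  free abelian group takes place inside the centre \<open>K\<close>.\<close>

lemma commutator_hom:
  assumes R: "R \<subseteq> A \<times> A"
  obtains \<psi> where "\<psi> \<in> hom (free_Abelian_group R) (free_nil A)"
    "\<And>u v. (u, v) \<in> R \<Longrightarrow> \<psi> (frag_of (u, v)) = group_comm (free_nil A) (free_gen A u) (free_gen A v)"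
    "\<And>m c. Poly_Mapping.keys m \<subseteq> R \<Longrightarrow> c \<in> carrier (free_nil A) \<Longrightarrow>
      \<psi> m \<otimes>\<^bsub>free_nil A\<^esub> c = c \<otimes>\<^bsub>free_nil A\<^esub> \<psi> m"
    "\<And>m. Poly_Mapping.keys m \<subseteq> R \<Longrightarrow> magnus_map A (\<psi> m) = (0, m - tensor_swap m)"
proof -
  let ?N = "free_nil A"
  interpret N: group ?N by (rule group_free_nil)
  interpret M: group_hom ?N "magnus A" "magnus_map A" by (rule group_hom_magnus_map)
  define K where "K = {z \<in> carrier ?N. \<forall>c\<in>carrier ?N. z \<otimes>\<^bsub>?N\<^esub> c = c \<otimes>\<^bsub>?N\<^esub> z}"
  have K: "subgroup K ?N" unfolding K_def by (rule N.subgroup_center)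
  have comm: "z \<otimes>\<^bsub>?N\<^esub> c = c \<otimes>\<^bsub>?N\<^esub> z" if "z \<in> K" "c \<in> carrier ?N" for z c
    using that unfolding K_def by blast
  have K_comm: "comm_group (?N\<lparr>carrier := K\<rparr>)"
  proof (rule group.group_comm_groupI[OF N.subgroup_imp_group[OF K]])
    fix z w assume "z \<in> carrier (?N\<lparr>carrier := K\<rparr>)" "w \<in> carrier (?N\<lparr>carrier := K\<rparr>)"
    then have "z \<in> K" "w \<in> carrier ?N" using subgroup.subset[OF K] by auto
    then have "z \<otimes>\<^bsub>?N\<^esub> w = w \<otimes>\<^bsub>?N\<^esub> z" by (rule comm)
    then show "z \<otimes>\<^bsub>?N\<lparr>carrier := K\<rparr>\<^esub> w = w \<otimes>\<^bsub>?N\<lparr>carrier := K\<rparr>\<^esub> z" by simp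
  qed
  let ?c = "\<lambda>(u, v). group_comm ?N (free_gen A u) (free_gen A v)"
  have "group_comm ?N (free_gen A u) (free_gen A v) \<in> K" if "u \<in> A" "v \<in> A" for u v
  proof -
    have g: "free_gen A u \<in> carrier ?N" "free_gen A v \<in> carrier ?N" using that by (simp_all add: free_gen_closed)
    then have c: "group_comm ?N (free_gen A u) (free_gen A v) \<in> carrier ?N" by (simp add: group_comm_def)
    show ?thesis unfolding K_def mem_Collect_eq
      using c nil_group_comm[OF nil_group_free_nil g] N.commute_if_comm_one[OF c] by simp
  qed
  then have "\<forall>p\<in>R. ?c p \<in> carrier (?N\<lparr>carrier := K\<rparr>)"
    using R by auto
  from free_Abelian_group_extension[OF K_comm this] obtain \<psi>
    where \<psi>: "\<psi> \<in> hom (free_Abelian_group R) (?N\<lparr>carrier := K\<rparr>)"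
      and \<psi>_gen: "\<forall>p\<in>R. \<psi> (frag_of p) = ?c p" by (elim exE conjE)
  have gen: "\<psi> (frag_of (u, v)) = group_comm ?N (free_gen A u) (free_gen A v)" if "(u, v) \<in> R" for u v
    using bspec[OF \<psi>_gen that] by simp
  have in_K: "\<psi> m \<in> K" if "Poly_Mapping.keys m \<subseteq> R" for m
    using hom_in_carrier[OF \<psi>] that by simp
  have hom: "\<psi> \<in> hom (free_Abelian_group R) ?N"
    using \<psi> subgroup.subset[OF K] by (auto simp: hom_def)
  interpret \<psi>: group_hom "free_Abelian_group R" ?N \<psi>
    using hom by (simp add: group_hom_def group_hom_axioms_def N.is_group)
  have "magnus_map A (\<psi> m) = (0, m - tensor_swap m)" if "Poly_Mapping.keys m \<subseteq> R" for m
  proof (induction rule: free_Abelian_group_induct[OF that])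
    case 1
    then show ?case using \<psi>.hom_one M.hom_one by simp
  next
    case (2 x y)
    have "\<psi> (x - y) = \<psi> x \<otimes>\<^bsub>?N\<^esub> inv\<^bsub>?N\<^esub> \<psi> y"
      using \<psi>.hom_mult[of x "- y"] \<psi>.hom_inv[of y] 2 by simp
    moreover have "\<psi> x \<in> carrier ?N" "\<psi> y \<in> carrier ?N" using \<psi>.hom_closed 2 by auto
    ultimately show ?case using 2
      by (simp add: M.hom_mult M.hom_inv inv_magnus tensor_linear push_diff)
  next
    case (3 p)
    then obtain u v where p: "p = (u, v)" "u \<in> A" "v \<in> A" using R by auto
    have "magnus_map A (\<psi> (frag_of p)) =
        group_comm (magnus A) (magnus_map A (free_gen A u)) (magnus_map A (free_gen A v))"
      using p 3 gen M.hom_group_comm by (simp add: free_gen_closed)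
    then show ?case using p by (simp add: magnus_map_gen comm_magnus)
  qed
  then show ?thesis
    using in_K comm by (intro that[of \<psi>] hom) (simp_all add: gen)
qed

text \<open>Modulo the image \<open>?Z\<close> of \<open>\<psi>\<close> the generators commute, so
  the quotient is abelian and the projection to it factors through the degree one part of the Magnus
  map. An element with zero degree one part is thus trivial in the quotient and lies in
  \<open>?Z\<close>.\<close>

lemma magnus_map_kernel:
  assumes R: "R \<subseteq> A \<times> A" "\<And>u v. u \<in> A \<Longrightarrow> v \<in> A \<Longrightarrow> u \<noteq> v \<Longrightarrow> (u, v) \<in> R \<or> (v, u) \<in> R"
    and \<psi>: "\<psi> \<in> hom (free_Abelian_group R) (free_nil A)"
    "\<And>u v. (u, v) \<in> R \<Longrightarrow> \<psi> (frag_of (u, v)) = group_comm (free_nil A) (free_gen A u) (free_gen A v)"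
    "\<And>m c. Poly_Mapping.keys m \<subseteq> R \<Longrightarrow> c \<in> carrier (free_nil A) \<Longrightarrow>
      \<psi> m \<otimes>\<^bsub>free_nil A\<^esub> c = c \<otimes>\<^bsub>free_nil A\<^esub> \<psi> m"
    and x: "x \<in> carrier (free_nil A)" "fst (magnus_map A x) = 0"
  obtains m where "Poly_Mapping.keys m \<subseteq> R" "x = \<psi> m"
proof -
  let ?N = "free_nil A"
  interpret N: group ?N by (rule group_free_nil)
  interpret \<psi>: group_hom "free_Abelian_group R" ?N \<psi>
    using \<psi>(1) by (simp add: group_hom_def group_hom_axioms_def N.is_group)
  let ?Z = "\<psi> ` carrier (free_Abelian_group R)"
  have Zsub: "subgroup ?Z ?N" by (rule \<psi>.img_is_subgroup)
  have central: "z \<otimes>\<^bsub>?N\<^esub> c = c \<otimes>\<^bsub>?N\<^esub> z" if "z \<in> ?Z" "c \<in> carrier ?N" for z c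
    using that \<psi>(3) by auto
  have "?Z \<lhd> ?N"
  proof (rule N.normal_invI[OF Zsub])
    fix c z assume *: "c \<in> carrier ?N" "z \<in> ?Z"
    then have z: "z \<in> carrier ?N" by auto
    have "c \<otimes>\<^bsub>?N\<^esub> z \<otimes>\<^bsub>?N\<^esub> inv\<^bsub>?N\<^esub> c = z"
      using N.conj_eq_iff[OF *(1) z] central[OF *(2,1)] by (simp only:)
    then show "c \<otimes>\<^bsub>?N\<^esub> z \<otimes>\<^bsub>?N\<^esub> inv\<^bsub>?N\<^esub> c \<in> ?Z" using * by simp
  qed
  then interpret Z: normal ?Z ?N .
  let ?Q = "?N Mod ?Z" and ?\<pi> = "\<lambda>c. ?Z #>\<^bsub>?N\<^esub> c"
  interpret Q: group ?Q by (rule Z.factorgroup_is_group)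
  have \<pi>: "?\<pi> \<in> hom ?N ?Q" by (rule Z.r_coset_hom_Mod)
  interpret \<pi>: group_hom ?N ?Q ?\<pi>
    using \<pi> by (simp add: group_hom_def group_hom_axioms_def N.is_group Q.is_group)
  note g = free_gen_closed
  have comm_Z: "group_comm ?N (free_gen A u) (free_gen A v) \<in> ?Z" if uv: "u \<in> A" "v \<in> A" for u v
  proof -
    have in_Z: "group_comm ?N (free_gen A u) (free_gen A v) \<in> ?Z" if "(u, v) \<in> R" for u v
      using that by (intro image_eqI[of _ _ "frag_of (u, v)"]) (simp_all add: \<psi>(2))
    consider "u = v" | "(u, v) \<in> R" | "(v, u) \<in> R" using R(2) uv by blast
    then show ?thesis
    proof cases
      case 1
      then have "group_comm ?N (free_gen A u) (free_gen A v) = \<one>\<^bsub>?N\<^esub>"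
        using g uv by (intro N.group_comm_eq_one) auto
      then show ?thesis using subgroup.one_closed[OF Zsub] by simp
    next
      case 3
      then show ?thesis using subgroup.m_inv_closed[OF Zsub in_Z[OF 3]] N.inv_group_comm[OF g[OF uv(2)] g[OF uv(1)]] by simp
    qed (rule in_Z)
  qed
  have gen_comm: "?\<pi> (free_gen A u) \<otimes>\<^bsub>?Q\<^esub> ?\<pi> (free_gen A v) = ?\<pi> (free_gen A v) \<otimes>\<^bsub>?Q\<^esub> ?\<pi> (free_gen A u)"
    if "u \<in> A" "v \<in> A" for u v
  proof (rule Q.commute_if_comm_one)
    have "group_comm ?Q (?\<pi> (free_gen A u)) (?\<pi> (free_gen A v)) = ?\<pi> (group_comm ?N (free_gen A u) (free_gen A v))"
      by (rule \<pi>.hom_group_comm[OF g[OF that(1)] g[OF that(2)], symmetric])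
    also have "\<dots> = \<one>\<^bsub>?Q\<^esub>"
      using N.coset_join2[OF _ Zsub comm_Z[OF that]] comm_Z[OF that] subgroup.subset[OF Zsub] by (metis one_FactGroup subsetD)
    finally show "group_comm ?Q (?\<pi> (free_gen A u)) (?\<pi> (free_gen A v)) = \<one>\<^bsub>?Q\<^esub>" .
  qed (rule \<pi>.hom_closed[OF g[OF that(1)]], rule \<pi>.hom_closed[OF g[OF that(2)]])
  \<comment> \<open>Conjugation by \<open>q\<close> fixes the image of \<open>N\<close> as soon as it fixes the images of the generators.\<close>
  have conj: "q \<otimes>\<^bsub>?Q\<^esub> ?\<pi> c = ?\<pi> c \<otimes>\<^bsub>?Q\<^esub> q"
    if q: "q \<in> carrier ?Q" and comm: "\<And>u. u \<in> A \<Longrightarrow> q \<otimes>\<^bsub>?Q\<^esub> ?\<pi> (free_gen A u) = ?\<pi> (free_gen A u) \<otimes>\<^bsub>?Q\<^esub> q"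
      and c: "c \<in> carrier ?N" for q c
  proof -
    let ?k = "(\<lambda>x. q \<otimes>\<^bsub>?Q\<^esub> x \<otimes>\<^bsub>?Q\<^esub> inv\<^bsub>?Q\<^esub> q) \<circ> ?\<pi>"
    have "?k c = ?\<pi> c"
    proof (rule free_nil_hom_eqI[OF Q.is_group hom_compose[OF \<pi> Q.conj_hom[OF q]] \<pi> _ c])
      fix u assume u: "u \<in> A"
      show "?k (free_gen A u) = ?\<pi> (free_gen A u)"
        using Q.conj_eq_iff[OF q \<pi>.hom_closed[OF g[OF u]]] comm[OF u] by (simp only: comp_apply)
    qed
    then show ?thesis using Q.conj_eq_iff[OF q \<pi>.hom_closed[OF c]] by (simp only: comp_apply)
  qed
  have "?\<pi> c \<otimes>\<^bsub>?Q\<^esub> ?\<pi> d = ?\<pi> d \<otimes>\<^bsub>?Q\<^esub> ?\<pi> c" if "c \<in> carrier ?N" "d \<in> carrier ?N" for c d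
    by (rule conj[OF \<pi>.hom_closed[OF that(1)] _ that(2)])
      (rule conj[OF \<pi>.hom_closed[OF g] gen_comm that(1), symmetric])
  then have Q_comm: "comm_group ?Q"
    by (intro group.group_comm_groupI Q.is_group) (auto simp: carrier_FactGroup)
  have "\<forall>u\<in>A. ?\<pi> (free_gen A u) \<in> carrier ?Q" by (rule ballI) (rule \<pi>.hom_closed[OF g])
  \<comment> \<open>This is the factorisation: \<open>\<theta>\<close> after the degree one part
    agrees with the projection on the generators, hence everywhere.\<close>
  from free_Abelian_group_extension[OF Q_comm this] obtain \<theta>
    where \<theta>: "\<theta> \<in> hom (free_Abelian_group A) ?Q" "\<forall>u\<in>A. \<theta> (frag_of u) = ?\<pi> (free_gen A u)"
    by (elim exE conjE)
  have "fst \<in> hom (magnus A) (free_Abelian_group A)" by (auto simp: hom_def)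
  then have h: "\<theta> \<circ> (fst \<circ> magnus_map A) \<in> hom ?N ?Q" by (intro hom_compose[OF _ \<theta>(1)] hom_compose[OF magnus_map_hom])
  have "(\<theta> \<circ> (fst \<circ> magnus_map A)) x = ?\<pi> x"
    by (rule free_nil_hom_eqI[OF Q.is_group h \<pi> _ x(1)]) (simp add: magnus_map_gen \<theta>(2))
  then have "?\<pi> x = \<theta> 0" using x(2) by simp
  also have "\<theta> 0 = \<one>\<^bsub>?Q\<^esub>" using hom_one[OF \<theta>(1) _ Q.is_group] by simp
  finally have "x \<in> ?Z" using N.coset_join1[OF _ x(1) Zsub] by simp
  then show ?thesis using that by auto
qed

lemma commutator_parametrization:
  "\<exists>R \<psi>. R \<subseteq> A \<times> A \<and> (\<forall>u v. (u, v) \<in> R \<longrightarrow> (v, u) \<notin> R) \<and>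
    (\<forall>u\<in>A. \<forall>v\<in>A. u \<noteq> v \<longrightarrow> (u, v) \<in> R \<or> (v, u) \<in> R) \<and>
    \<psi> \<in> hom (free_Abelian_group R) (free_nil A) \<and>
    (\<forall>m. Poly_Mapping.keys m \<subseteq> R \<longrightarrow> magnus_map A (\<psi> m) = (0, m - tensor_swap m)) \<and>
    (\<forall>x\<in>carrier (free_nil A). fst (magnus_map A x) = 0 \<longrightarrow> (\<exists>m. Poly_Mapping.keys m \<subseteq> R \<and> x = \<psi> m))"
proof -
  obtain R where R: "R \<subseteq> A \<times> A" "\<forall>u v. (u, v) \<in> R \<longrightarrow> (v, u) \<notin> R"
    "\<forall>u\<in>A. \<forall>v\<in>A. u \<noteq> v \<longrightarrow> (u, v) \<in> R \<or> (v, u) \<in> R"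
    using strict_total_order[of A] by (elim exE conjE)
  show ?thesis
  proof (rule commutator_hom[OF R(1)], goal_cases)
    case (1 \<psi>)
    have "\<exists>m. Poly_Mapping.keys m \<subseteq> R \<and> x = \<psi> m"
      if x: "x \<in> carrier (free_nil A)" "fst (magnus_map A x) = 0" for x
      by (rule magnus_map_kernel[OF R(1) _ 1(1-3) x]) (use R(3) in blast)+
    then show ?case using R 1(1,4) by (intro exI[of _ R] exI[of _ \<psi>]) simp
  qed
qed

text \<open>An element of the kernel is some \<open>\<psi> m\<close> with
  \<open>m = tensor_swap m\<close>. As \<open>R\<close> never contains a pair together with its
  reverse, the supports of \<open>m\<close> and \<open>tensor_swap m\<close> are disjoint and
  \<open>m = 0\<close>.\<close>

theorem magnus_map_inject:
  assumes "x \<in> carrier (free_nil A)" "y \<in> carrier (free_nil A)" "magnus_map A x = magnus_map A y"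
  shows "x = y"
proof -
  interpret M: group_hom "free_nil A" "magnus A" "magnus_map A" by (rule group_hom_magnus_map)
  obtain R \<psi> where R: "\<forall>u v. (u, v) \<in> R \<longrightarrow> (v, u) \<notin> R"
    and \<psi>: "\<psi> \<in> hom (free_Abelian_group R) (free_nil A)"
    and mag: "\<forall>m. Poly_Mapping.keys m \<subseteq> R \<longrightarrow> magnus_map A (\<psi> m) = (0, m - tensor_swap m)"
    and ker: "\<forall>x\<in>carrier (free_nil A). fst (magnus_map A x) = 0 \<longrightarrow> (\<exists>m. Poly_Mapping.keys m \<subseteq> R \<and> x = \<psi> m)"
    using commutator_parametrization[of A] by (elim exE conjE)
  let ?z = "x \<otimes>\<^bsub>free_nil A\<^esub> inv\<^bsub>free_nil A\<^esub> y"
  have z: "?z \<in> carrier (free_nil A)" using assms by simp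
  have "magnus_map A ?z = magnus_map A y \<otimes>\<^bsub>magnus A\<^esub> inv\<^bsub>magnus A\<^esub> magnus_map A y"
    using assms by simp
  also have "\<dots> = (0, 0)" using M.H.r_inv[OF M.hom_closed[OF assms(2)]] by simp
  finally have 1: "magnus_map A ?z = (0, 0)" .
  then obtain m where m: "Poly_Mapping.keys m \<subseteq> R" "?z = \<psi> m" using bspec[OF ker z] by auto
  then have "m - tensor_swap m = 0" using mag 1 by simp
  then have "Poly_Mapping.lookup m p = Poly_Mapping.lookup m (prod.swap p)" for p
    by (metis lookup_tensor_swap right_minus_eq)
  then have "p \<notin> Poly_Mapping.keys m" for p
    using m(1) R by (cases p) (metis in_keys_iff subsetD swap_simp)
  then have "m = 0" by (metis keys_eq_empty all_not_in_conv)
  then have "?z = \<one>\<^bsub>free_nil A\<^esub>"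
    using m(2) hom_one[OF \<psi> _ group_free_nil] by simp
  then show ?thesis using assms(1,2) M.G.inv_equality[of x "inv\<^bsub>free_nil A\<^esub> y"] by simp
qed

theorem magnus_map_ker:
  assumes "x \<in> carrier (free_nil A)" "magnus_map A x = (0, s)"
  shows "Poly_Mapping.keys s \<subseteq> A \<times> A" "tensor_swap s = - s"
proof -
  obtain R \<psi> where R: "R \<subseteq> A \<times> A"
    and mag: "\<forall>m. Poly_Mapping.keys m \<subseteq> R \<longrightarrow> magnus_map A (\<psi> m) = (0, m - tensor_swap m)"
    and ker: "\<forall>x\<in>carrier (free_nil A). fst (magnus_map A x) = 0 \<longrightarrow> (\<exists>m. Poly_Mapping.keys m \<subseteq> R \<and> x = \<psi> m)"
    using commutator_parametrization[of A] by (elim exE conjE)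
  obtain m where m: "Poly_Mapping.keys m \<subseteq> R" "x = \<psi> m" using bspec[OF ker assms(1)] assms(2) by auto
  then have s: "s = m - tensor_swap m" using mag assms(2) by simp
  have "tensor_swap (tensor_swap m) = m" by (rule poly_mapping_eqI) (simp add: lookup_tensor_swap)
  then show "tensor_swap s = - s" using s by (simp add: push_diff)
  show "Poly_Mapping.keys s \<subseteq> A \<times> A"
  proof (rule subsetI)
    fix p assume "p \<in> Poly_Mapping.keys s"
    then have "p \<in> Poly_Mapping.keys m \<or> prod.swap p \<in> Poly_Mapping.keys m"
      using s by (auto simp: in_keys_iff lookup_minus lookup_tensor_swap)
    then show "p \<in> A \<times> A" using m(1) R by (cases p) auto
  qed
qed

text \<open>An antisymmetric tensor vanishes on the pairs \<open>(u, u)\<close> and is recovered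
  from its restriction to \<open>R\<close>, which serves as the exponents of a product of
  commutators.\<close>

theorem magnus_map_surj:
  assumes "Poly_Mapping.keys s \<subseteq> A \<times> A" "tensor_swap s = - s"
  shows "\<exists>x\<in>carrier (free_nil A). magnus_map A x = (0, s)"
proof -
  obtain R \<psi> where R: "R \<subseteq> A \<times> A" "\<forall>u v. (u, v) \<in> R \<longrightarrow> (v, u) \<notin> R"
    "\<forall>u\<in>A. \<forall>v\<in>A. u \<noteq> v \<longrightarrow> (u, v) \<in> R \<or> (v, u) \<in> R"
    and \<psi>: "\<psi> \<in> hom (free_Abelian_group R) (free_nil A)"
    and mag: "\<forall>m. Poly_Mapping.keys m \<subseteq> R \<longrightarrow> magnus_map A (\<psi> m) = (0, m - tensor_swap m)"
    using commutator_parametrization[of A] by (elim exE conjE)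
  let ?m = "push R (\<lambda>p. p) s"
  have lm: "Poly_Mapping.lookup ?m p = (if p \<in> R then Poly_Mapping.lookup s p else 0)" for p
    by (induction s rule: frag_induction[OF subset_UNIV]) (auto simp: push_diff lookup_minus)
  have ls: "Poly_Mapping.lookup s (v, u) = - Poly_Mapping.lookup s (u, v)" for u v
    using assms(2) lookup_tensor_swap[of s "(u, v)"] by simp
  have "Poly_Mapping.lookup (?m - tensor_swap ?m) (u, v) = Poly_Mapping.lookup s (u, v)" for u v
  proof (cases "u \<in> A \<and> v \<in> A")
    case True
    consider "u = v" | "(u, v) \<in> R" "(v, u) \<notin> R" | "(v, u) \<in> R" "(u, v) \<notin> R"
      using R True by blast
    then show ?thesis
      using ls[of u v] ls[of u u] by cases (simp_all add: lookup_minus lookup_tensor_swap lm)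
  next
    case False
    then have "Poly_Mapping.lookup s (u, v) = 0" "(u, v) \<notin> R" "(v, u) \<notin> R"
      using assms(1) R(1) by (auto simp: in_keys_iff)
    then show ?thesis by (simp add: lookup_minus lookup_tensor_swap lm)
  qed
  then have "?m - tensor_swap ?m = s" by (intro poly_mapping_eqI) auto
  moreover have "\<psi> ?m \<in> carrier (free_nil A)"
    by (rule hom_in_carrier[OF \<psi>]) (simp add: keys_push_subset)
  moreover have "magnus_map A (\<psi> ?m) = (0, ?m - tensor_swap ?m)"
    using mag keys_push_subset[of R] by blast
  ultimately show ?thesis by auto
qed

lemma magnus_map_keys:
  assumes "x \<in> carrier (free_nil A)"
  shows "Poly_Mapping.keys (fst (magnus_map A x)) \<subseteq> A"
proof (cases "magnus_map A x")
  case (Pair a s)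
  then show ?thesis using hom_in_carrier[OF magnus_map_hom assms] by simp
qed

section \<open>Homotopy groups as cyclic groups\<close>

text \<open>The case \<open>m = 0\<close> fits without change: divisibility by 0 means being 0, and
  reduction modulo 0 is the identity.\<close>

lemma cyclic_onI:
  assumes "group Q" and c: "c \<in> carrier Q"
    and gen: "\<And>x. x \<in> carrier Q \<Longrightarrow> \<exists>j::int. x = c [^]\<^bsub>Q\<^esub> j"
    and ord: "\<And>j::int. c [^]\<^bsub>Q\<^esub> j = \<one>\<^bsub>Q\<^esub> \<longleftrightarrow> int m dvd j"
  shows "cyclic_on m Q c"
proof -
  interpret Q: group Q by fact
  have eq: "c [^]\<^bsub>Q\<^esub> i = c [^]\<^bsub>Q\<^esub> j \<longleftrightarrow> int m dvd i - j" for i j :: int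
  proof -
    have "c [^]\<^bsub>Q\<^esub> i = c [^]\<^bsub>Q\<^esub> j \<longleftrightarrow> c [^]\<^bsub>Q\<^esub> i \<otimes>\<^bsub>Q\<^esub> inv\<^bsub>Q\<^esub> (c [^]\<^bsub>Q\<^esub> j) = \<one>\<^bsub>Q\<^esub>"
      using c by (metis Q.int_pow_closed Q.inv_closed Q.inv_equality Q.inv_inv Q.r_inv)
    also have "\<dots> \<longleftrightarrow> int m dvd i - j" using c by (simp flip: ord add: Q.int_pow_diff)
    finally show ?thesis .
  qed
  have mod: "c [^]\<^bsub>Q\<^esub> (i mod int m) = c [^]\<^bsub>Q\<^esub> i" for i :: int
    unfolding eq by (metis mod_eq_dvd_iff mod_mod_trivial)
  have "(\<lambda>j::int. c [^]\<^bsub>Q\<^esub> j) \<in> hom (integer_mod_group m) Q"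
    using c by (intro homI) (simp_all add: mod Q.int_pow_mult)
  moreover have "inj_on (\<lambda>j::int. c [^]\<^bsub>Q\<^esub> j) (carrier (integer_mod_group m))"
  proof (rule inj_onI)
    fix i j assume ij: "i \<in> carrier (integer_mod_group m)" "j \<in> carrier (integer_mod_group m)"
      "c [^]\<^bsub>Q\<^esub> i = c [^]\<^bsub>Q\<^esub> j"
    then have "i mod int m = j mod int m" using eq by (simp add: mod_eq_dvd_iff)
    then show "i = j" using ij(1,2) by (auto simp: carrier_integer_mod_group split: if_splits)
  qed
  moreover have "(\<lambda>j::int. c [^]\<^bsub>Q\<^esub> j) ` carrier (integer_mod_group m) = carrier Q"
  proof (intro equalityI subsetI)
    fix x assume "x \<in> carrier Q"
    then obtain j :: int where j: "x = c [^]\<^bsub>Q\<^esub> j" using gen by blast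
    have "j mod int m \<in> carrier (integer_mod_group m)" by (simp add: carrier_integer_mod_group)
    then show "x \<in> (\<lambda>j::int. c [^]\<^bsub>Q\<^esub> j) ` carrier (integer_mod_group m)" using j mod by (metis image_eqI)
  qed (use c in auto)
  ultimately show ?thesis
    unfolding cyclic_on_def iso_def bij_betw_def using Q.is_group c by simp
qed

context
  fixes G :: "('a, 'b) monoid_scheme" and Z B :: "'a set"
  assumes G: "group G" and Z: "subgroup Z G" and B: "B \<lhd> G" and BZ: "B \<subseteq> Z"
begin

interpretation group G by (rule G)

lemma subquotient_normal: "B \<lhd> G\<lparr>carrier := Z\<rparr>"
  by (rule normal_restrict_supergroup[OF Z B BZ])

lemma subquotient_coset: "B #>\<^bsub>G\<lparr>carrier := Z\<rparr>\<^esub> x = B #>\<^bsub>G\<^esub> x"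
  by (simp add: r_coset_def)

lemma subquotient_coset_eq:
  assumes "x \<in> carrier G" shows "B #>\<^bsub>G\<^esub> x = B \<longleftrightarrow> x \<in> B"
  using coset_join1[OF _ assms] coset_join2[OF assms] normal_imp_subgroup[OF B] by blast

lemma cyclic_on_subquotient:
  assumes y: "y \<in> Z"
    and gen: "\<And>z. z \<in> Z \<Longrightarrow> \<exists>j::int. \<exists>b\<in>B. z = b \<otimes>\<^bsub>G\<^esub> y [^]\<^bsub>G\<^esub> j"
    and ord: "\<And>j::int. y [^]\<^bsub>G\<^esub> j \<in> B \<longleftrightarrow> int m dvd j"
  shows "cyclic_on m (G\<lparr>carrier := Z\<rparr> Mod B) (B #>\<^bsub>G\<^esub> y)"
proof -
  let ?Q = "G\<lparr>carrier := Z\<rparr> Mod B"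
  have yc: "y \<in> carrier G" using y subgroup.subset[OF Z] by blast
  have pow: "(B #>\<^bsub>G\<^esub> y) [^]\<^bsub>?Q\<^esub> j = B #>\<^bsub>G\<^esub> (y [^]\<^bsub>G\<^esub> j)" for j :: int
    using normal.FactGroup_int_pow[OF subquotient_normal, of y j] y
    by (simp add: subquotient_coset int_pow_consistent[OF Z y])
  show ?thesis
  proof (rule cyclic_onI)
    show "group ?Q" by (rule normal.factorgroup_is_group[OF subquotient_normal])
    show "B #>\<^bsub>G\<^esub> y \<in> carrier ?Q" using y by (auto simp: carrier_FactGroup subquotient_coset)
    show "(B #>\<^bsub>G\<^esub> y) [^]\<^bsub>?Q\<^esub> j = \<one>\<^bsub>?Q\<^esub> \<longleftrightarrow> int m dvd j" for j :: int
      unfolding pow using subquotient_coset_eq[of "y [^]\<^bsub>G\<^esub> j"] yc ord by simp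
    fix x assume "x \<in> carrier ?Q"
    then obtain z where z: "z \<in> Z" "x = B #>\<^bsub>G\<^esub> z" by (auto simp: carrier_FactGroup subquotient_coset)
    then obtain j :: int and b where b: "b \<in> B" "z = b \<otimes>\<^bsub>G\<^esub> y [^]\<^bsub>G\<^esub> j" using gen by blast
    have Bs: "B \<subseteq> carrier G" using BZ subgroup.subset[OF Z] by blast
    then have bc: "b \<in> carrier G" using b(1) by blast
    have "B #>\<^bsub>G\<^esub> z = (B #>\<^bsub>G\<^esub> b) #>\<^bsub>G\<^esub> (y [^]\<^bsub>G\<^esub> j)"
      unfolding b(2) using coset_mult_assoc[OF Bs bc int_pow_closed[OF yc]] by simp
    then have "x = (B #>\<^bsub>G\<^esub> y) [^]\<^bsub>?Q\<^esub> j"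
      unfolding pow using z(2) subquotient_coset_eq[OF bc] b(1) by simp
    then show "\<exists>j::int. x = (B #>\<^bsub>G\<^esub> y) [^]\<^bsub>?Q\<^esub> j" by blast
  qed
qed

lemma trivial_subquotient:
  assumes "Z \<subseteq> B" shows "trivial_group (G\<lparr>carrier := Z\<rparr> Mod B)"
proof (rule group.trivial_group_subset[THEN iffD2])
  show "group (G\<lparr>carrier := Z\<rparr> Mod B)" by (rule normal.factorgroup_is_group[OF subquotient_normal])
  show "carrier (G\<lparr>carrier := Z\<rparr> Mod B) \<subseteq> {\<one>\<^bsub>G\<lparr>carrier := Z\<rparr> Mod B\<^esub>}"
  proof
    fix x assume "x \<in> carrier (G\<lparr>carrier := Z\<rparr> Mod B)"
    then obtain z where z: "z \<in> Z" "x = B #>\<^bsub>G\<^esub> z" by (auto simp: carrier_FactGroup subquotient_coset)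
    then have "z \<in> carrier G" "z \<in> B" using assms subgroup.subset[OF Z] by auto
    then show "x \<in> {\<one>\<^bsub>G\<lparr>carrier := Z\<rparr> Mod B\<^esub>}" using subquotient_coset_eq z(2) by simp
  qed
qed

end

lemma subgroup_kernels:
  fixes G (structure)
  assumes "group G" "\<And>i. i \<in> I \<Longrightarrow> group_hom G H (h i)"
  shows "subgroup {x \<in> carrier G. \<forall>i\<in>I. h i x = \<one>\<^bsub>H\<^esub>} G"
proof -
  interpret group G by fact
  have one: "h i \<one> = \<one>\<^bsub>H\<^esub>" and inv: "\<And>x. x \<in> carrier G \<Longrightarrow> h i x = \<one>\<^bsub>H\<^esub> \<Longrightarrow> h i (inv x) = \<one>\<^bsub>H\<^esub>"
    and mult: "\<And>x y. x \<in> carrier G \<Longrightarrow> y \<in> carrier G \<Longrightarrow> h i x = \<one>\<^bsub>H\<^esub> \<Longrightarrow> h i y = \<one>\<^bsub>H\<^esub> \<Longrightarrow> h i (x \<otimes> y) = \<one>\<^bsub>H\<^esub>"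
    if "i \<in> I" for i
  proof -
    interpret h: group_hom G H "h i" by (rule assms(2)[OF that])
    show "h i \<one> = \<one>\<^bsub>H\<^esub>" by simp
    show "h i (inv x) = \<one>\<^bsub>H\<^esub>" if "x \<in> carrier G" "h i x = \<one>\<^bsub>H\<^esub>" for x
      using that by simp
    show "h i (x \<otimes> y) = \<one>\<^bsub>H\<^esub>" if "x \<in> carrier G" "y \<in> carrier G" "h i x = \<one>\<^bsub>H\<^esub>" "h i y = \<one>\<^bsub>H\<^esub>" for x y
      using that by simp
  qed
  show ?thesis
    by (rule subgroupI) (use one inv mult in \<open>auto intro: exI[of _ \<one>]\<close>)
qed

context simplicial_group
begin

lemma face_group_hom:
  "i \<le> Suc q \<Longrightarrow> group_hom (sgrp X (Suc q)) (sgrp X q) (sface X (Suc q) i)"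
  by (simp add: group_hom_def group_hom_axioms_def sgrp_group face_hom)

lemma moore_subgroup: "subgroup (moore X q) (sgrp X q)"
proof (cases q)
  case 0
  then have "moore X q = carrier (sgrp X q)" by (auto simp: moore_def)
  then show ?thesis using group.subgroup_self[OF sgrp_group] by simp
next
  case (Suc p)
  have "moore X q = {x \<in> carrier (sgrp X q). \<forall>i\<in>{0<..q}. sface X q i x = \<one>\<^bsub>sgrp X p\<^esub>}"
    using Suc by (auto simp: moore_def)
  then show ?thesis using subgroup_kernels[OF sgrp_group, of "{0<..q}" q "sgrp X p" "sface X q"]
      face_group_hom Suc by simp
qed

lemma moore_cycles_subgroup: "subgroup (moore_cycles X q) (sgrp X q)"
proof (cases q)
  case 0
  then have "moore_cycles X q = moore X q" by (auto simp: moore_cycles_def)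
  then show ?thesis using moore_subgroup by simp
next
  case (Suc p)
  have "moore_cycles X q = {x \<in> carrier (sgrp X q). \<forall>i\<in>{..q}. sface X q i x = \<one>\<^bsub>sgrp X p\<^esub>}"
    using Suc by (auto simp: moore_def moore_cycles_def) (metis neq0_conv)
  then show ?thesis using subgroup_kernels[OF sgrp_group, of "{..q}" q "sgrp X p" "sface X q"]
      face_group_hom Suc by simp
qed

lemma moore_boundaries_cycles: "moore_boundaries X q \<subseteq> moore_cycles X q"
proof
  fix b assume "b \<in> moore_boundaries X q"
  then obtain y where y: "y \<in> moore X (Suc q)" "b = sface X (Suc q) 0 y" by (auto simp: moore_boundaries_def)
  have yc: "y \<in> carrier (sgrp X (Suc q))" and y0: "\<And>i. 0 < i \<Longrightarrow> i \<le> Suc q \<Longrightarrow> sface X (Suc q) i y = \<one>\<^bsub>sgrp X q\<^esub>"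
    using y(1) by (auto simp: moore_def)
  have b: "b \<in> carrier (sgrp X q)" unfolding y(2) by (rule hom_in_carrier[OF face_hom yc]) simp
  have "sface X q i b = \<one>\<^bsub>sgrp X (q - 1)\<^esub>" if i: "q > 0" "i \<le> q" for i
  proof -
    obtain p where p: "q = Suc p" using i(1) by (cases q) auto
    have "sface X (Suc p) i (sface X (Suc (Suc p)) 0 y) = sface X (Suc p) 0 (sface X (Suc (Suc p)) (Suc i) y)"
      using face_face[of y p 0 "Suc i"] yc i p by simp
    also have "sface X (Suc (Suc p)) (Suc i) y = \<one>\<^bsub>sgrp X (Suc p)\<^esub>" using y0 i p by simp
    also have "sface X (Suc p) 0 \<one>\<^bsub>sgrp X (Suc p)\<^esub> = \<one>\<^bsub>sgrp X p\<^esub>"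
      by (rule group_hom.hom_one[OF face_group_hom]) simp
    finally show ?thesis using y(2) p by simp
  qed
  then show "b \<in> moore_cycles X q" using b by (simp add: moore_cycles_def moore_def)
qed

text \<open>The degeneracy \<open>s_0 z\<close> lifts \<open>z\<close> along the zeroth face.
  Conjugating \<open>y\<close> by it keeps the positive faces trivial, because conjugates of the
  identity are trivial, and conjugates the boundary by \<open>z\<close>.\<close>

lemma moore_boundaries_normal: "moore_boundaries X q \<lhd> sgrp X q"
proof (rule group.normal_invI[OF sgrp_group])
  show "subgroup (moore_boundaries X q) (sgrp X q)"
    unfolding moore_boundaries_def
    by (rule group_hom.subgroup_img_is_subgroup[OF face_group_hom moore_subgroup]) simp
  fix z b assume z: "z \<in> carrier (sgrp X q)" and "b \<in> moore_boundaries X q"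
  then obtain y where y: "y \<in> moore X (Suc q)" "b = sface X (Suc q) 0 y" by (auto simp: moore_boundaries_def)
  interpret G: group "sgrp X (Suc q)" by (rule sgrp_group)
  interpret H: group "sgrp X q" by (rule sgrp_group)
  let ?s = "sdegen X q 0 z"
  let ?w = "?s \<otimes>\<^bsub>sgrp X (Suc q)\<^esub> y \<otimes>\<^bsub>sgrp X (Suc q)\<^esub> inv\<^bsub>sgrp X (Suc q)\<^esub> ?s"
  have yc: "y \<in> carrier (sgrp X (Suc q))" using y(1) by (simp add: moore_def)
  have s: "?s \<in> carrier (sgrp X (Suc q))" by (rule hom_in_carrier[OF degen_hom z]) simp
  have face: "sface X (Suc q) i ?w = sface X (Suc q) i ?s \<otimes>\<^bsub>sgrp X q\<^esub> sface X (Suc q) i y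
      \<otimes>\<^bsub>sgrp X q\<^esub> inv\<^bsub>sgrp X q\<^esub> (sface X (Suc q) i ?s)" if "i \<le> Suc q" for i
  proof -
    interpret d: group_hom "sgrp X (Suc q)" "sgrp X q" "sface X (Suc q) i" by (rule face_group_hom[OF that])
    show ?thesis using s yc by simp
  qed
  have "sface X (Suc q) i ?w = \<one>\<^bsub>sgrp X q\<^esub>" if "0 < i" "i \<le> Suc q" for i
    using face[OF that(2)] y(1) that hom_in_carrier[OF face_hom[OF that(2)] s] by (simp add: moore_def)
  then have "?w \<in> moore X (Suc q)" using s yc by (simp add: moore_def)
  moreover have "sface X (Suc q) 0 ?w = z \<otimes>\<^bsub>sgrp X q\<^esub> b \<otimes>\<^bsub>sgrp X q\<^esub> inv\<^bsub>sgrp X q\<^esub> z"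
    using face[of 0] face_degen_same[OF z, of 0 0] y(2) by simp
  ultimately show "z \<otimes>\<^bsub>sgrp X q\<^esub> b \<otimes>\<^bsub>sgrp X q\<^esub> inv\<^bsub>sgrp X q\<^esub> z \<in> moore_boundaries X q"
    unfolding moore_boundaries_def by (metis image_eqI)
qed

lemma cyclic_on_homotopy_group:
  assumes "y \<in> moore_cycles X q"
    and "\<And>z. z \<in> moore_cycles X q \<Longrightarrow>
      \<exists>j::int. \<exists>b\<in>moore_boundaries X q. z = b \<otimes>\<^bsub>sgrp X q\<^esub> y [^]\<^bsub>sgrp X q\<^esub> j"
    and "\<And>j::int. y [^]\<^bsub>sgrp X q\<^esub> j \<in> moore_boundaries X q \<longleftrightarrow> int m dvd j"
  shows "cyclic_on m (homotopy_group X (int q)) (homotopy_class X q y)"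
  unfolding homotopy_group_def homotopy_class_def
  using cyclic_on_subquotient[OF sgrp_group moore_cycles_subgroup moore_boundaries_normal
      moore_boundaries_cycles assms] by simp

lemma trivial_homotopy_group:
  "moore_cycles X q \<subseteq> moore_boundaries X q \<Longrightarrow> trivial_group (homotopy_group X (int q))"
  unfolding homotopy_group_def
  using trivial_subquotient[OF sgrp_group moore_cycles_subgroup moore_boundaries_normal
      moore_boundaries_cycles] by simp

end

section \<open>Homotopy groups of the spheres\<close>

text \<open>The diagonal \<open>u \<mapsto> (u, u)\<close> commutes with the faces and reduces this
  to \<open>moore_degenerate_zero\<close>: above degree \<open>n\<close> every simplex of the sphere
  repeats a vertex, so its diagonal pair is degenerate.\<close>

lemma single_moore_zero:
  assumes "n \<le> r" "Poly_Mapping.keys a \<subseteq> sphere_simplices n (Suc r)"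
    and "\<And>i. 0 < i \<Longrightarrow> i \<le> Suc r \<Longrightarrow> push (sphere_simplices n r) (del_vertex i) a = 0"
  shows "a = 0"
proof -
  let ?d = "\<lambda>q. push (sphere_pairs n q) (\<lambda>u. (u, u))"
  have lk: "Poly_Mapping.lookup (?d (Suc r) a) (u, u) = Poly_Mapping.lookup a u" for u
    using assms(2) by (induction rule: frag_induction) (auto simp: push_diff lookup_minus sphere_pairs_def)
  have "pair_face n r i (?d (Suc r) a) = ?d r (push (sphere_simplices n r) (del_vertex i) a)" for i
  proof -
    have "pair_face n r i (?d (Suc r) a) = push (sphere_pairs n r) (\<lambda>u. map_prod (del_vertex i) (del_vertex i) (u, u)) a"
      unfolding pair_face_def by (rule push_push[OF assms(2)]) (auto simp: sphere_pairs_def)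
    also have "\<dots> = ?d r (push (sphere_simplices n r) (del_vertex i) a)"
      by (subst push_push[OF assms(2)]) (auto simp: sphere_pairs_def)
    finally show ?thesis .
  qed
  then have "?d (Suc r) a \<in> pair_moore n (Suc r)"
    using assms(3) keys_push_subset by (simp add: pair_moore_def)
  moreover have "Poly_Mapping.keys (?d (Suc r) a) \<subseteq> degenerate_pairs n (Suc r)"
  proof
    fix p assume "p \<in> Poly_Mapping.keys (?d (Suc r) a)"
    then obtain u where "u \<in> sphere_simplices n (Suc r)" "p = (u, u)"
      using keys_push assms(2) by fast
    then show "p \<in> degenerate_pairs n (Suc r)"
      using sphere_repeat[of u n r] assms(1)
      by (auto simp: degenerate_pairs_def sphere_pairs_def less_Suc_eq_le)
  qed
  ultimately have "?d (Suc r) a = 0" by (rule moore_degenerate_zero)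
  then show ?thesis using lk by (intro poly_mapping_eqI) (metis lookup_zero)
qed

lemma magnus_map_one: "magnus_map A \<one>\<^bsub>free_nil A\<^esub> = (0, 0)"
  using group_hom.hom_one[OF group_hom_magnus_map[of A]] by simp

lemma magnus_map_eq_one:
  assumes "x \<in> carrier (free_nil A)" "magnus_map A x = (0, 0)"
  shows "x = \<one>\<^bsub>free_nil A\<^esub>"
proof (rule magnus_map_inject[OF assms(1)])
  show "\<one>\<^bsub>free_nil A\<^esub> \<in> carrier (free_nil A)"
    by (rule monoid.one_closed[OF group.is_monoid[OF group_free_nil]])
qed (simp add: assms(2) magnus_map_one)

text \<open>Only the degree one part of a power is linear in the exponent in general; the degree two
  part picks up multiples of \<open>tensor a a\<close>, which are absent in
  \<open>magnus_map_pow\<close>.\<close>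

lemma fst_magnus_map_pow:
  assumes "x \<in> carrier (free_nil A)"
  shows "fst (magnus_map A (x [^]\<^bsub>free_nil A\<^esub> (j::int))) = frag_cmul j (fst (magnus_map A x))"
proof -
  have fst: "fst \<in> hom (magnus A) (free_Abelian_group A)" by (auto simp: hom_def)
  have "fst (magnus_map A (x [^]\<^bsub>free_nil A\<^esub> j)) = fst (magnus_map A x) [^]\<^bsub>free_Abelian_group A\<^esub> j"
    using hom_int_pow[OF hom_compose[OF magnus_map_hom fst] assms group_free_nil group_free_Abelian_group, of j]
    by simp
  then show ?thesis using magnus_map_keys[OF assms] by simp
qed

lemma magnus_map_pow:
  assumes "x \<in> carrier (free_nil A)" "magnus_map A x = (0, s)"
  shows "magnus_map A (x [^]\<^bsub>free_nil A\<^esub> (j::int)) = (0, frag_cmul j s)"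
proof -
  have nat: "(0, s) [^]\<^bsub>magnus A\<^esub> m = (0, frag_cmul (int m) s)" for m :: nat
    by (induction m) (simp_all add: nat_pow_def magnus_def tensor_linear frag_cmul_distrib)
  have "(0, s) [^]\<^bsub>magnus A\<^esub> j = (0, frag_cmul j s)"
    by (cases "j < 0") (simp_all add: int_pow_def2 nat inv_magnus tensor_linear)
  then show ?thesis
    using hom_int_pow[OF magnus_map_hom assms(1) group_free_nil group_magnus, of j] assms(2) by simp
qed

lemma magnus_map_diff:
  assumes "x \<in> carrier (free_nil A)" "y \<in> carrier (free_nil A)"
    and "magnus_map A x = (a, s)" "magnus_map A y = (a, t)"
  shows "magnus_map A (x \<otimes>\<^bsub>free_nil A\<^esub> inv\<^bsub>free_nil A\<^esub> y) = (0, s - t)"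
proof -
  interpret group_hom "free_nil A" "magnus A" "magnus_map A" by (rule group_hom_magnus_map)
  have "Poly_Mapping.keys a \<subseteq> A" using magnus_map_keys[OF assms(1)] assms(3) by simp
  then show ?thesis using assms by (simp add: inv_magnus tensor_linear)
qed

context
  fixes n :: nat
begin

interpretation X: simplicial_nil_group "nil_sphere n"
  by (rule simplicial_nil_group_nil_sphere)

abbreviation "mag q \<equiv> magnus_map (sphere_simplices n q)"

lemma sgrp_sphere: "sgrp (nil_sphere n) q = free_nil (sphere_simplices n q)"
  by (simp add: nil_sphere_def)

lemma mag_face:
  assumes "x \<in> carrier (free_nil (sphere_simplices n (Suc q)))" "mag (Suc q) x = (a, s)"
  shows "mag q (sface (nil_sphere n) (Suc q) i x)
    = (push (sphere_simplices n q) (del_vertex i) a, pair_face n q i s)"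
  using magnus_map_free_map[OF assms(1), of "sphere_simplices n q" "del_vertex i"] assms(2)
  by (simp add: nil_sphere_def pair_face_def sphere_pairs_def)

lemma face_closed:
  "x \<in> carrier (free_nil (sphere_simplices n (Suc q))) \<Longrightarrow> i \<le> Suc q \<Longrightarrow>
    sface (nil_sphere n) (Suc q) i x \<in> carrier (free_nil (sphere_simplices n q))"
  using hom_in_carrier[OF X.face_hom] by (simp add: sgrp_sphere)

text \<open>Injectivity of the Magnus map replaces an equation in a nonabelian group by two
  equations in free abelian groups.\<close>

lemma face_eq_one_iff:
  assumes "x \<in> carrier (free_nil (sphere_simplices n (Suc q)))" "mag (Suc q) x = (a, s)" "i \<le> Suc q"
  shows "sface (nil_sphere n) (Suc q) i x = \<one>\<^bsub>free_nil (sphere_simplices n q)\<^esub> \<longleftrightarrow>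
    push (sphere_simplices n q) (del_vertex i) a = 0 \<and> pair_face n q i s = 0"
  using magnus_map_eq_one[OF face_closed[OF assms(1,3)]] magnus_map_one mag_face[OF assms(1,2), of i]
  by (metis prod.inject)

text \<open>Above degree \<open>n\<close> the normalised chains of \<open>S\<^sup>n\<close> vanish, so the Moore complex of \<open>S(n)\<close>
  lies in the commutator subgroups.\<close>

lemma moore_sphere:
  assumes "n < q"
  shows "x \<in> moore (nil_sphere n) q \<longleftrightarrow>
    x \<in> carrier (free_nil (sphere_simplices n q)) \<and> (\<exists>s\<in>alt_moore n q. mag q x = (0, s))"
proof -
  obtain r where r: "q = Suc r" using assms by (cases q) auto
  show ?thesis
  proof (cases "x \<in> carrier (free_nil (sphere_simplices n q))")
    case True
    obtain a s where m: "mag q x = (a, s)" by force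
    have "x \<in> moore (nil_sphere n) q \<longleftrightarrow>
      (\<forall>i. 0 < i \<and> i \<le> q \<longrightarrow> push (sphere_simplices n r) (del_vertex i) a = 0 \<and> pair_face n r i s = 0)"
      using True face_eq_one_iff[OF True[unfolded r] m[unfolded r]]
      unfolding r moore_def by (auto simp: sgrp_sphere)
    also have "\<dots> \<longleftrightarrow> a = 0 \<and> s \<in> alt_moore n q"
    proof
      assume *: "\<forall>i. 0 < i \<and> i \<le> q \<longrightarrow> push (sphere_simplices n r) (del_vertex i) a = 0 \<and> pair_face n r i s = 0"
      have "a = 0"
        using single_moore_zero[of n r a] magnus_map_keys[OF True] * assms m r by simp
      then show "a = 0 \<and> s \<in> alt_moore n q"
        using magnus_map_ker[OF True, of s] * m r by (simp add: alt_moore_def pair_moore_def sphere_pairs_def)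
    qed (use r in \<open>auto simp: alt_moore_def pair_moore_def\<close>)
    finally show ?thesis using True m by auto
  qed (auto simp: moore_def sgrp_sphere)
qed

lemma alt_moore_lift:
  assumes "s \<in> alt_moore n q"
  shows "\<exists>x\<in>carrier (free_nil (sphere_simplices n q)). mag q x = (0, s)"
  using assms by (intro magnus_map_surj) (auto simp: alt_moore_def pair_moore_def sphere_pairs_def)

lemma boundaries_sphere:
  assumes "n \<le> q"
  shows "x \<in> moore_boundaries (nil_sphere n) q \<longleftrightarrow>
    x \<in> carrier (free_nil (sphere_simplices n q)) \<and> (\<exists>g\<in>alt_moore n (Suc q). mag q x = (0, pair_face n q 0 g))"
proof
  assume "x \<in> moore_boundaries (nil_sphere n) q"
  then obtain y where y: "y \<in> moore (nil_sphere n) (Suc q)" "x = sface (nil_sphere n) (Suc q) 0 y"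
    by (auto simp: moore_boundaries_def)
  then obtain g where g: "y \<in> carrier (free_nil (sphere_simplices n (Suc q)))" "g \<in> alt_moore n (Suc q)" "mag (Suc q) y = (0, g)"
    using moore_sphere[of "Suc q"] assms by auto
  then show "x \<in> carrier (free_nil (sphere_simplices n q)) \<and> (\<exists>g\<in>alt_moore n (Suc q). mag q x = (0, pair_face n q 0 g))"
    using mag_face[OF g(1,3), of 0] face_closed[OF g(1), of 0] y(2) by auto
next
  assume x: "x \<in> carrier (free_nil (sphere_simplices n q)) \<and> (\<exists>g\<in>alt_moore n (Suc q). mag q x = (0, pair_face n q 0 g))"
  then obtain g where g: "g \<in> alt_moore n (Suc q)" "mag q x = (0, pair_face n q 0 g)" by blast
  obtain y where y: "y \<in> carrier (free_nil (sphere_simplices n (Suc q)))" "mag (Suc q) y = (0, g)"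
    using alt_moore_lift[OF g(1)] by blast
  have "sface (nil_sphere n) (Suc q) 0 y = x"
    by (rule magnus_map_inject[OF face_closed[OF y(1)] conjunct1[OF x]]) (simp_all add: mag_face[OF y] g(2))
  moreover have "y \<in> moore (nil_sphere n) (Suc q)" using moore_sphere[of "Suc q"] assms y g(1) by auto
  ultimately show "x \<in> moore_boundaries (nil_sphere n) q" by (auto simp: moore_boundaries_def)
qed

lemma cycles_sphere:
  assumes "n < q"
  shows "x \<in> moore_cycles (nil_sphere n) q \<longleftrightarrow> x \<in> carrier (free_nil (sphere_simplices n q)) \<and>
    (\<exists>s\<in>alt_moore n q. mag q x = (0, s) \<and> pair_face n (q - 1) 0 s = 0)"
proof -
  obtain r where r: "q = Suc r" using assms by (cases q) auto
  have "sface (nil_sphere n) q 0 x = \<one>\<^bsub>sgrp (nil_sphere n) r\<^esub> \<longleftrightarrow> pair_face n r 0 s = 0"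
    if "x \<in> carrier (free_nil (sphere_simplices n q))" "mag q x = (0, s)" for s
    using face_eq_one_iff[OF that[unfolded r], of 0] by (simp add: r sgrp_sphere)
  then show ?thesis
    unfolding moore_cycles_def mem_Collect_eq moore_sphere[OF assms] using assms by (auto simp: r)
qed

lemma sphere_homotopy_generator:
  assumes k: "odd k" "k \<le> n"
  shows "\<exists>\<eta>. cyclic_on (if k = n then 0 else 2) (homotopy_group (nil_sphere n) (int (n + k))) \<eta>"
proof -
  let ?N = "free_nil (sphere_simplices n (n + k))"
  interpret N: group ?N by (rule group_free_nil)
  have q: "n < n + k" using odd_pos[OF k(1)] by simp
  obtain e where e: "e \<in> alt_moore n (n + k)" "pair_face n (n + k - 1) 0 e = 0"
    and gen: "\<forall>t\<in>alt_moore n (n + k). pair_face n (n + k - 1) 0 t = 0 \<longrightarrow>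
      (\<exists>c. \<exists>g\<in>alt_moore n (Suc (n + k)). t = frag_cmul c e + pair_face n (n + k) 0 g)"
    and ord: "\<forall>c. (\<exists>g\<in>alt_moore n (Suc (n + k)). frag_cmul c e = pair_face n (n + k) 0 g) \<longleftrightarrow>
      int (if k = n then 0 else 2) dvd c"
    using alt_moore_generator[OF k] by (elim bexE conjE)
  obtain y where y: "y \<in> carrier ?N" "mag (n + k) y = (0, e)" using alt_moore_lift[OF e(1)] by blast
  have "cyclic_on (if k = n then 0 else 2) (homotopy_group (nil_sphere n) (int (n + k)))
    (homotopy_class (nil_sphere n) (n + k) y)"
  proof (rule X.cyclic_on_homotopy_group)
    show "y \<in> moore_cycles (nil_sphere n) (n + k)" unfolding cycles_sphere[OF q] using y e by blast
    show "y [^]\<^bsub>sgrp (nil_sphere n) (n + k)\<^esub> j \<in> moore_boundaries (nil_sphere n) (n + k) \<longleftrightarrow>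
        int (if k = n then 0 else 2) dvd j" for j :: int
      unfolding boundaries_sphere[OF less_imp_le[OF q]] spec[OF ord, symmetric] sgrp_sphere
      using magnus_map_pow[OF y, of j] y(1) by simp
    fix z assume "z \<in> moore_cycles (nil_sphere n) (n + k)"
    then obtain t where z: "z \<in> carrier ?N" "mag (n + k) z = (0, t)"
      and t: "t \<in> alt_moore n (n + k)" "pair_face n (n + k - 1) 0 t = 0"
      unfolding cycles_sphere[OF q] by blast
    obtain c g where g: "g \<in> alt_moore n (Suc (n + k))" "t = frag_cmul c e + pair_face n (n + k) 0 g"
      using bspec[OF gen t(1)] t(2) by blast
    let ?y = "y [^]\<^bsub>?N\<^esub> c"
    let ?b = "z \<otimes>\<^bsub>?N\<^esub> inv\<^bsub>?N\<^esub> ?y"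
    \<comment> \<open>Dividing by the power of \<open>y\<close> subtracts
      \<open>frag_cmul c e\<close> from \<open>t\<close> and leaves exactly the boundary
      term.\<close>
    have "mag (n + k) ?b = (0, pair_face n (n + k) 0 g)"
      using magnus_map_diff[OF z(1) _ z(2) magnus_map_pow[OF y, of c]] y(1) g(2) by simp
    then have "?b \<in> moore_boundaries (nil_sphere n) (n + k)"
      unfolding boundaries_sphere[OF less_imp_le[OF q]] using z(1) y(1) g(1) by auto
    moreover have "z = ?b \<otimes>\<^bsub>?N\<^esub> ?y" using z(1) y(1) by (simp add: N.m_assoc)
    ultimately show "\<exists>j::int. \<exists>b\<in>moore_boundaries (nil_sphere n) (n + k).
        z = b \<otimes>\<^bsub>sgrp (nil_sphere n) (n + k)\<^esub> y [^]\<^bsub>sgrp (nil_sphere n) (n + k)\<^esub> j"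
      unfolding sgrp_sphere by blast
  qed
  then show ?thesis by blast
qed

lemma sphere_homotopy_above:
  assumes "k > 0" "\<not> (odd k \<and> k \<le> n)"
  shows "trivial_group (homotopy_group (nil_sphere n) (int (n + k)))"
proof (rule X.trivial_homotopy_group, rule subsetI)
  have q: "n < n + k" using assms(1) by simp
  fix z assume "z \<in> moore_cycles (nil_sphere n) (n + k)"
  then show "z \<in> moore_boundaries (nil_sphere n) (n + k)"
    unfolding cycles_sphere[OF q] boundaries_sphere[OF less_imp_le[OF q]]
    using alt_moore_boundary[OF assms(1) _ _ assms(2)] by blast
qed

lemma sphere_homotopy_below:
  assumes "q < n"
  shows "trivial_group (homotopy_group (nil_sphere n) (int q))"
proof (rule X.trivial_homotopy_group, rule subsetI)
  fix z assume "z \<in> moore_cycles (nil_sphere n) q"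
  then have z: "z \<in> carrier (free_nil (sphere_simplices n q))" by (simp add: moore_cycles_def moore_def sgrp_sphere)
  note empty = sphere_simplices_less[OF assms]
  obtain a s where m: "mag q z = (a, s)" by force
  have "a = 0" using magnus_map_keys[OF z] m by (simp add: empty)
  then have "s = 0" using magnus_map_ker(1)[OF z, of s] m by (simp add: empty)
  then have "z = \<one>\<^bsub>free_nil (sphere_simplices n q)\<^esub>" using magnus_map_eq_one[OF z] m \<open>a = 0\<close> by simp
  then show "z \<in> moore_boundaries (nil_sphere n) q"
    using subgroup.one_closed[OF normal_imp_subgroup[OF X.moore_boundaries_normal[of q]]]
    by (simp add: sgrp_sphere)
qed

text \<open>In degree \<open>n\<close> the group is free on one generator, hence infinite cyclic.
  Boundaries from degree \<open>n + 1\<close> have antisymmetric tensors in degree \<open>n\<close>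
  as Magnus images, and these vanish by \<open>alt_moore_bottom\<close>.\<close>

lemma sphere_homotopy_bottom:
  "cyclic_on 0 (homotopy_group (nil_sphere n) (int n)) (sphere_class n)"
  unfolding sphere_class_def
proof (rule X.cyclic_on_homotopy_group)
  let ?N = "free_nil (sphere_simplices n n)" and ?v = "[0..<Suc n]"
  interpret N: group ?N by (rule group_free_nil)
  note S = sphere_simplices_same[of n]
  have v: "?v \<in> sphere_simplices n n" unfolding S by simp
  have y: "sphere_gen n \<in> carrier ?N" unfolding sphere_gen_def by (rule free_gen_closed[OF v])
  have my: "mag n (sphere_gen n) = (frag_of ?v, 0)" unfolding sphere_gen_def by (rule magnus_map_gen[OF v])
  have no_faces: "pair_face n (n - 1) i t = 0" if "0 < n" for i t
    using keys_pair_face[of n "n - 1" i t] sphere_simplices_less[of "n - 1" n] that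
    by (simp add: sphere_pairs_def)
  have zero: "s = 0" if "Poly_Mapping.keys s \<subseteq> sphere_pairs n n" "tensor_swap s = - s" for s
    using that no_faces by (intro alt_moore_bottom[of s n]) (simp add: alt_moore_def pair_moore_def)
  have one: "\<one>\<^bsub>?N\<^esub> \<in> moore_boundaries (nil_sphere n) n"
    using subgroup.one_closed[OF normal_imp_subgroup[OF X.moore_boundaries_normal[of n]]]
    by (simp add: sgrp_sphere)
  have only_one: "b = \<one>\<^bsub>?N\<^esub>" if in_bd: "b \<in> moore_boundaries (nil_sphere n) n" for b
  proof -
    obtain g where b: "b \<in> carrier ?N" "g \<in> alt_moore n (Suc n)" "mag n b = (0, pair_face n n 0 g)"
      using in_bd unfolding boundaries_sphere[OF order.refl] by blast
    have "pair_face n n 0 g = 0" using alt_moore_bottom[OF alt_moore_face[OF b(2)]] .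
    then show ?thesis using magnus_map_eq_one[OF b(1)] b(3) by simp
  qed
  show "sphere_gen n \<in> moore_cycles (nil_sphere n) n" by (rule sphere_gen_cycle)
  show "sphere_gen n [^]\<^bsub>sgrp (nil_sphere n) n\<^esub> j \<in> moore_boundaries (nil_sphere n) n \<longleftrightarrow> int 0 dvd j" for j :: int
  proof
    assume "sphere_gen n [^]\<^bsub>sgrp (nil_sphere n) n\<^esub> j \<in> moore_boundaries (nil_sphere n) n"
    then have "sphere_gen n [^]\<^bsub>?N\<^esub> j = \<one>\<^bsub>?N\<^esub>" using only_one by (simp add: sgrp_sphere)
    then have "frag_cmul j (frag_of ?v) = 0"
      using fst_magnus_map_pow[OF y, of j] my magnus_map_one[of "sphere_simplices n n"] by simp
    then show "int 0 dvd j" by simp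
  next
    assume "int 0 dvd j"
    then show "sphere_gen n [^]\<^bsub>sgrp (nil_sphere n) n\<^esub> j \<in> moore_boundaries (nil_sphere n) n"
      using one by (simp add: sgrp_sphere)
  qed
  fix z assume "z \<in> moore_cycles (nil_sphere n) n"
  then have z: "z \<in> carrier ?N" by (simp add: moore_cycles_def moore_def sgrp_sphere)
  obtain a s where m: "mag n z = (a, s)" by force
  have a: "Poly_Mapping.keys a \<subseteq> {?v}" using magnus_map_keys[OF z] m S by simp
  define j where "j = Poly_Mapping.lookup a ?v"
  have aj: "a = frag_cmul j (frag_of ?v)"
  proof (rule poly_mapping_eqI)
    fix u show "Poly_Mapping.lookup a u = Poly_Mapping.lookup (frag_cmul j (frag_of ?v)) u"
      using a by (cases "u = ?v") (auto simp: j_def in_keys_iff simp del: upt_Suc)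
  qed
  let ?y = "sphere_gen n [^]\<^bsub>?N\<^esub> j"
  \<comment> \<open>The degree two part \<open>t\<close> of the power need not be computed: the
    quotient of \<open>z\<close> by the power has zero degree one part, so \<open>s - t\<close> is
    antisymmetric and therefore zero.\<close>
  obtain t where t: "mag n ?y = (a, t)"
    using fst_magnus_map_pow[OF y, of j] my aj by (metis fst_conv prod.collapse)
  let ?b = "z \<otimes>\<^bsub>?N\<^esub> inv\<^bsub>?N\<^esub> ?y"
  have bc: "?b \<in> carrier ?N" using z y by simp
  have mb: "mag n ?b = (0, s - t)" using magnus_map_diff[OF z _ m t] y by simp
  then have "s - t = 0" using magnus_map_ker[OF bc mb] by (intro zero) (simp_all add: sphere_pairs_def)
  then have "?b = \<one>\<^bsub>?N\<^esub>" using magnus_map_eq_one[OF bc] mb by simp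
  moreover have "z = ?b \<otimes>\<^bsub>?N\<^esub> ?y" using z y by (simp add: N.m_assoc)
  ultimately show "\<exists>j::int. \<exists>b\<in>moore_boundaries (nil_sphere n) n.
      z = b \<otimes>\<^bsub>sgrp (nil_sphere n) n\<^esub> sphere_gen n [^]\<^bsub>sgrp (nil_sphere n) n\<^esub> j"
    unfolding sgrp_sphere using one by (intro exI[of _ j] bexI[of _ "?b"]) simp_all
qed

end

theorem proposition4p3:
  fixes n :: nat
  shows "\<exists>\<eta> \<eta>'. \<forall>k :: int.
    let P = homotopy_group (nil_sphere n) (int n + k) in
    if k = 0 then cyclic_on 0 P (sphere_class n)
    else if k = int n \<and> odd k then cyclic_on 0 P \<eta>
    else if 0 < k \<and> k < int n \<and> odd k then cyclic_on 2 P (\<eta>' k)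
    else trivial_group P"
proof -
  let ?P = "\<lambda>k. homotopy_group (nil_sphere n) (int n + k)"
  \<comment> \<open>The existence of a generator is known for each \<open>k\<close> separately;
    choice turns this into one element and one function of \<open>k\<close>.\<close>
  let ?\<eta> = "SOME \<eta>. cyclic_on 0 (?P (int n)) \<eta>" and ?\<eta>' = "\<lambda>k. SOME \<eta>. cyclic_on 2 (?P k) \<eta>"
  have gen: "\<exists>\<eta>. cyclic_on (if k = int n then 0 else 2) (?P k) \<eta>" if k: "0 < k" "k \<le> int n" "odd k" for k
  proof -
    obtain j where j: "k = int j" using k(1) by (metis zero_le_imp_eq_int less_imp_le)
    then show ?thesis using sphere_homotopy_generator[of j n] k by simp
  qed
  have triv: "trivial_group (?P k)" if k: "k \<noteq> 0" "\<not> (0 < k \<and> k \<le> int n \<and> odd k)" for k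
  proof -
    consider "int n + k < 0" | "k < 0" "0 \<le> int n + k" | "0 < k" using k(1) by linarith
    then show ?thesis
    proof cases
      case 1
      then show ?thesis by (simp add: homotopy_group_def)
    next
      case 2
      then obtain q where "int n + k = int q" "q < n" by (metis zero_le_imp_eq_int add_less_same_cancel1 of_nat_less_iff)
      then show ?thesis using sphere_homotopy_below by simp
    next
      case 3
      then obtain j where j: "k = int j" by (metis zero_le_imp_eq_int less_imp_le)
      then show ?thesis using sphere_homotopy_above[of j n] k 3 by auto
    qed
  qed
  have "let P = ?P k in
    if k = 0 then cyclic_on 0 P (sphere_class n)
    else if k = int n \<and> odd k then cyclic_on 0 P ?\<eta>
    else if 0 < k \<and> k < int n \<and> odd k then cyclic_on 2 P (?\<eta>' k)
    else trivial_group P" for k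
  proof -
    consider "k = 0" | "k = int n" "odd k" | "0 < k" "k < int n" "odd k"
      | "k \<noteq> 0" "\<not> (0 < k \<and> k \<le> int n \<and> odd k)" by linarith
    then show ?thesis
    proof cases
      case 1
      then show ?thesis using sphere_homotopy_bottom by simp
    next
      case 2
      \<comment> \<open>For \<open>n = 0\<close> this case would give \<open>k = 0\<close>, which is
        even.\<close>
      then have "k > 0" by (cases "n = 0") auto
      then show ?thesis using 2 someI_ex[OF gen[of k]] by (simp add: Let_def)
    next
      case 3
      then show ?thesis using someI_ex[OF gen[of k]] by (simp add: Let_def)
    next
      case 4
      then have "\<not> (k = int n \<and> odd k)" "\<not> (0 < k \<and> k < int n \<and> odd k)" by auto
      then show ?thesis using triv[OF 4] 4(1) by (simp only: Let_def if_False)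
    qed
  qed
  then show ?thesis by (intro exI[of _ ?\<eta>] exI[of _ ?\<eta>'] allI)
qed

end
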